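(* For any constant $\varepsilon > 0$, there is $\gamma > 0$ such that for large enough $n \in \mathbb{Z}^+$ and any $k \in \{2, \ldots, n\}$, there is a weighted digraph $D^* = (V^*, A^* )$ on $n$ vertices satisfying: (i) the optimum of Max-$k$-Ordering on $D^*$ is at most $\frac{1}{2}\left(1 - \frac{1}{k}\right) + \varepsilon$; (ii) the LP relaxation for Max-$k$-Ordering augmented with $n^{\gamma/\log\log k}$ rounds of Sherali-Adams constraints has objective value at least $(1-\varepsilon)\left(1 - \frac{1}{k}\right)$.
   Context: Max-$k$-Ordering: given a weighted digraph, find $\ell:V\to[k]$ maximizing the weighted fraction of edges $(u,v)$ with $\ell(u)<\ell(v)$ (both the integral optimum and the LP objective count the weighted fraction of edges). The standard LP relaxation has variables $x^v_i\ge 0$ with $\sum_i x^v_i=1$, and $y^e_{ij}\ge 0$ for $e=(u,v)$ with $\sum_{\ell} y^e_{i\ell}=x^u_i$, $\sum_\ell y^e_{\ell j}=x^v_j$, with edge value $\sum_{i<j}y^e_{ij}$. $r$ rounds of Sherali-Adams add variables $z^S_\sigma\in[0,1]$ for vertex sets $1\le|S|\le r+1$ and $\sigma:S\to[k]$, with $z^S_\sigma=\sum_{\rho:T\to[k],\rho|_S=\sigma}z^T_\rho$ for $S\subseteq T$, and consistency with the $x$ and $y$ variables on singletons and edges. *)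

theory Defs
  imports Complex_Main "HOL-Library.FuncSet" "Graph_Theory.Pair_Digraph"
begin

text \<open>The labels \<open>[k]\<close> are \<open>{1..k}\<close>; a labeling of a vertex set \<open>S\<close> is an extensional
  function in \<open>S \<rightarrow>\<^sub>E {1..k}\<close>, so that distinct labelings are distinct functions.\<close>

definition weighted_digraph :: "'a pair_pre_digraph \<Rightarrow> ('a \<times> 'a \<Rightarrow> real) \<Rightarrow> bool" where
  "weighted_digraph D w \<longleftrightarrow>
     pair_digraph D \<and> parcs D \<noteq> {} \<and> (\<forall>e\<in>parcs D. 0 < w e)"

definition ordering_value ::
  "'a pair_pre_digraph \<Rightarrow> ('a \<times> 'a \<Rightarrow> real) \<Rightarrow> ('a \<Rightarrow> nat) \<Rightarrow> real" where
  "ordering_value D w l =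
     (\<Sum>e\<in>{e\<in>parcs D. l (fst e) < l (snd e)}. w e) / (\<Sum>e\<in>parcs D. w e)"

definition max_ordering_opt ::
  "nat \<Rightarrow> 'a pair_pre_digraph \<Rightarrow> ('a \<times> 'a \<Rightarrow> real) \<Rightarrow> real" where
  "max_ordering_opt k D w = (MAX l\<in>pverts D \<rightarrow>\<^sub>E {1..k}. ordering_value D w l)"

definition ordering_lp_feasible ::
  "nat \<Rightarrow> 'a pair_pre_digraph \<Rightarrow> ('a \<Rightarrow> nat \<Rightarrow> real) \<Rightarrow> ('a \<times> 'a \<Rightarrow> nat \<Rightarrow> nat \<Rightarrow> real) \<Rightarrow> bool" where
  "ordering_lp_feasible k D x y \<longleftrightarrow>
     (\<forall>v\<in>pverts D. (\<forall>i\<in>{1..k}. 0 \<le> x v i) \<and> (\<Sum>i\<in>{1..k}. x v i) = 1) \<and>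
     (\<forall>(u,v)\<in>parcs D.
        (\<forall>i\<in>{1..k}. \<forall>j\<in>{1..k}. 0 \<le> y (u,v) i j) \<and>
        (\<forall>i\<in>{1..k}. (\<Sum>l\<in>{1..k}. y (u,v) i l) = x u i) \<and>
        (\<forall>j\<in>{1..k}. (\<Sum>l\<in>{1..k}. y (u,v) l j) = x v j))"

definition ordering_lp_objective ::
  "nat \<Rightarrow> 'a pair_pre_digraph \<Rightarrow> ('a \<times> 'a \<Rightarrow> real) \<Rightarrow> ('a \<times> 'a \<Rightarrow> nat \<Rightarrow> nat \<Rightarrow> real) \<Rightarrow> real" where
  "ordering_lp_objective k D w y =
     (\<Sum>e\<in>parcs D. w e * (\<Sum>i\<in>{1..k}. \<Sum>j\<in>{i<..k}. y e i j)) / (\<Sum>e\<in>parcs D. w e)"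

text \<open>Only the entries \<open>z S \<sigma>\<close> with \<open>1 \<le> card S \<le> r + 1\<close> and \<open>\<sigma> \<in> S \<rightarrow>\<^sub>E {1..k}\<close> are variables
  of the program, so pairs of adjacent vertices are linked to \<open>y\<close> only when \<open>r \<ge> 1\<close>.\<close>

definition sherali_adams ::
  "nat \<Rightarrow> nat \<Rightarrow> 'a pair_pre_digraph \<Rightarrow> ('a \<Rightarrow> nat \<Rightarrow> real) \<Rightarrow>
   ('a \<times> 'a \<Rightarrow> nat \<Rightarrow> nat \<Rightarrow> real) \<Rightarrow> ('a set \<Rightarrow> ('a \<Rightarrow> nat) \<Rightarrow> real) \<Rightarrow> bool" where
  "sherali_adams r k D x y z \<longleftrightarrow>
     (\<forall>S. S \<subseteq> pverts D \<and> 1 \<le> card S \<and> card S \<le> r + 1 \<longrightarrow>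
        (\<forall>\<sigma>\<in>S \<rightarrow>\<^sub>E {1..k}. 0 \<le> z S \<sigma> \<and> z S \<sigma> \<le> 1)) \<and>
     (\<forall>S T. S \<subseteq> T \<and> T \<subseteq> pverts D \<and> 1 \<le> card S \<and> card T \<le> r + 1 \<longrightarrow>
        (\<forall>\<sigma>\<in>S \<rightarrow>\<^sub>E {1..k}.
           z S \<sigma> = (\<Sum>\<rho>\<in>{\<rho>\<in>T \<rightarrow>\<^sub>E {1..k}. restrict \<rho> S = \<sigma>}. z T \<rho>))) \<and>
     (\<forall>v\<in>pverts D. \<forall>\<sigma>\<in>{v} \<rightarrow>\<^sub>E {1..k}. z {v} \<sigma> = x v (\<sigma> v)) \<and>
     (\<forall>(u,v)\<in>parcs D. card {u,v} \<le> r + 1 \<longrightarrow>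
        (\<forall>\<sigma>\<in>{u,v} \<rightarrow>\<^sub>E {1..k}. z {u,v} \<sigma> = y (u,v) (\<sigma> u) (\<sigma> v)))"

definition ordering_sa_opt ::
  "nat \<Rightarrow> nat \<Rightarrow> 'a pair_pre_digraph \<Rightarrow> ('a \<times> 'a \<Rightarrow> real) \<Rightarrow> real" where
  "ordering_sa_opt r k D w =
     Sup {ordering_lp_objective k D w y | x y z.
            ordering_lp_feasible k D x y \<and> sherali_adams r k D x y z}"

text \<open>Logarithms are binary, and a real number of rounds is rounded down. Since
  \<open>log 2 (log 2 2) = 0\<close>, the exponent \<open>\<gamma> / log log k\<close> is meaningless for \<open>k = 2\<close>; there we
  read \<open>log log k\<close> as \<open>1\<close>, that is, \<open>n\<^sup>\<gamma>\<close> rounds.\<close>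

definition loglog :: "nat \<Rightarrow> real" where
  "loglog k = (if k \<le> 2 then 1 else log 2 (log 2 (real k)))"

definition sa_rounds :: "real \<Rightarrow> nat \<Rightarrow> nat \<Rightarrow> nat" where
  "sa_rounds \<gamma> n k = nat \<lfloor>real n powr (\<gamma> / loglog k)\<rfloor>"

end

theory Submission
  imports Defs "HOL-Probability.Probability" "HOL-Real_Asymp.Real_Asymp"
begin

text \<open>One graph serves all \<open>k\<close>: a random digraph with \<open>C n\<close> arcs, \<open>C\<close> a constant, from which
  one arc of every cycle of length at most \<open>g = c log n\<close> is deleted. The numbers of arcs between
  vertex sets are as in a quasirandom digraph, so a labeling satisfies about
  \<open>(1 - 1/k) / 2\<close> of the arcs; for large \<open>k\<close> one compares with boundedly many blocks of labels. The
  fractional solution uses only the labels \<open>1..q\<close> with \<open>q = min k K\<close>, \<open>K\<close> a constant, so that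
  \<open>n\<^sup>\<gamma>\<close> rounds can be handled for every \<open>k\<close>.

  Attach to each vertex \<open>u\<close> standard Gaussians \<open>X (u, i)\<close>, \<open>i \<in> \<int>/q\<close>, with
  \<open>X (v, i + 1)\<close> strongly correlated to \<open>X (u, i)\<close> for every arc \<open>(u, v)\<close>, and label \<open>u\<close> by the index
  of the largest one: then the label increases by \<open>1\<close> modulo \<open>q\<close> along almost every arc. The law of
  Gaussians depends only on their covariances, hence the local distributions are
  consistent as soon as the covariances come from one global kernel; positive semidefiniteness is
  only needed on small vertex sets. The kernel is (nearly) \<open>\<rho>\<close> to the power of the distance in the
  \<open>q\<close>-fold cover \<open>V \<times> \<int>/q\<close>.

  Small subgraphs of the random graph have hardly more arcs than vertices, hence can be built by
  adding vertices of degree at most one and long ears. On a graph built in this way, Gaussians with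
  almost the right covariances are constructed step by step: on an ear, run a stationary
  autoregressive chain and replace its end values by those prescribed at the two ends. The
  error is a negative power of \<open>n\<close>, and a small multiple of the identity absorbs it as long as the
  set has at most \<open>n\<^sup>\<beta>\<close> elements.\<close>

section \<open>Gram kernels and graph distances\<close>

text \<open>The obstacle is positive semidefiniteness: \<open>\<rho>\<close> to the power of the
  distance is a covariance on a tree, but need not be one on a graph with cycles. Two demands on
  \<open>\<rho>\<close> pull apart. It must be close to 1, since the largest Gaussian moves on to
  the next index along an arc only if correlated variables differ by less than the gap at the top.
  Yet \<open>\<rho> ^ h\<close>, the error of one ear, must beat the square of the number of
  vertices involved. Both are met because \<open>\<rho>\<close> is a constant while the girth is
  logarithmic, so that \<open>\<rho> ^ h\<close> is a power of n with negative exponent. This is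
  also why the number of labels in use is a constant: the admissible distance of
  \<open>\<rho>\<close> from 1 shrinks with \<open>q\<close>, and the exponent would shrink with it.
  Using only \<open>K\<close> labels costs 1/\<open>K\<close> in the objective. The factor 1 -
  1/\<open>q\<close> is lost at the wrap from label \<open>q\<close> back to 1; a uniform rotation
  makes each index equally likely to be the one that wraps.\<close>

text \<open>Positive semidefiniteness is encoded by a factorization because the vectors
  \<open>a p\<close> are what is used later: as coefficients of independent standard normals they
  yield Gaussians with covariance \<open>K\<close>.\<close>

definition gram :: "'p set \<Rightarrow> ('p \<Rightarrow> 'p \<Rightarrow> real) \<Rightarrow> bool" where
  "gram P K \<longleftrightarrow> (\<exists>m. \<exists>a::'p \<Rightarrow> nat \<Rightarrow> real. \<forall>p\<in>P. \<forall>q\<in>P. K p q = (\<Sum>j<m. a p j * a q j))"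

lemma gram_cong:
  assumes "gram P K" "\<And>p q. p \<in> P \<Longrightarrow> q \<in> P \<Longrightarrow> K p q = L p q"
  shows "gram P L"
  using assms unfolding gram_def by metis

lemma gram_subset: "gram P K \<Longrightarrow> Q \<subseteq> P \<Longrightarrow> gram Q K"
  unfolding gram_def by blast

lemma gram_sym: "gram P K \<Longrightarrow> p \<in> P \<Longrightarrow> q \<in> P \<Longrightarrow> K p q = K q p"
  unfolding gram_def by (auto simp: mult.commute)

lemma gram_rank_one: "gram P (\<lambda>p q. f p * f q)"
  unfolding gram_def by (rule exI[of _ 1], rule exI[of _ "\<lambda>p j. f p"]) simp

lemma gram_zero: "gram P (\<lambda>p q. 0)"
  unfolding gram_def by (rule exI[of _ 0]) simp

lemma gram_add:
  assumes "gram P K" "gram P L"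
  shows "gram P (\<lambda>p q. K p q + L p q)"
proof -
  from assms obtain m a m' b where
    a: "\<And>p q. p \<in> P \<Longrightarrow> q \<in> P \<Longrightarrow> K p q = (\<Sum>j<(m::nat). a p j * a q j)" and
    b: "\<And>p q. p \<in> P \<Longrightarrow> q \<in> P \<Longrightarrow> L p q = (\<Sum>j<(m'::nat). b p j * b q j)"
    unfolding gram_def by metis
  define c where "c p j = (if j < m then a p j else b p (j - m))" for p j
  have "K p q + L p q = (\<Sum>j<m+m'. c p j * c q j)" if "p \<in> P" "q \<in> P" for p q
  proof -
    have "(\<Sum>j<m+m'. c p j * c q j) = (\<Sum>j<m. c p j * c q j) + (\<Sum>j\<in>{m..<m+m'}. c p j * c q j)"
      by (subst sum.union_disjoint[symmetric]) (auto intro!: sum.cong)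
    also have "(\<Sum>j\<in>{m..<m+m'}. c p j * c q j) = (\<Sum>j<m'. c p (j + m) * c q (j + m))"
      using sum.shift_bounds_nat_ivl[of "\<lambda>j. c p j * c q j" 0 m m']
      by (simp add: add.commute lessThan_atLeast0)
    finally show ?thesis using a[OF that] b[OF that] by (simp add: c_def)
  qed
  then show ?thesis unfolding gram_def by blast
qed

lemma gram_sum:
  assumes "finite I" "\<And>i. i \<in> I \<Longrightarrow> gram P (K i)"
  shows "gram P (\<lambda>p q. \<Sum>i\<in>I. K i p q)"
  using assms
proof (induction I rule: finite_induct)
  case (insert i I)
  then show ?case using gram_add[of P "K i" "\<lambda>p q. \<Sum>i\<in>I. K i p q"] by simp
qed (simp add: gram_zero)

lemma gram_scale:
  assumes "gram P K" "0 \<le> c"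
  shows "gram P (\<lambda>p q. c * K p q)"
proof -
  from assms obtain m a where
    a: "\<And>p q. p \<in> P \<Longrightarrow> q \<in> P \<Longrightarrow> K p q = (\<Sum>j<(m::nat). a p j * a q j)"
    unfolding gram_def by metis
  have "c * K p q = (\<Sum>j<m. (sqrt c * a p j) * (sqrt c * a q j))" if "p \<in> P" "q \<in> P" for p q
  proof -
    have eq: "sqrt c * x * (sqrt c * y) = c * (x * y)" for x y
      using real_sqrt_mult_self[of c] \<open>0 \<le> c\<close> by (simp add: algebra_simps)
    show ?thesis by (simp only: a[OF that] sum_distrib_left eq)
  qed
  then show ?thesis
    unfolding gram_def by (intro exI[of _ m] exI[of _ "\<lambda>p j. sqrt c * a p j"]) blast
qed

text \<open>If \<open>K\<close> is the covariance of variables X, this is the covariance of the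
  variables \<open>c p\<close> X(\<open>f p\<close>) + \<open>d p\<close> X(\<open>g p\<close>). It
  serves to subtract from a chain variable its prediction by an end value.\<close>

lemma gram_lincomb:
  assumes "gram P K" "\<And>p. p \<in> Q \<Longrightarrow> f p \<in> P" "\<And>p. p \<in> Q \<Longrightarrow> g p \<in> P"
  shows "gram Q (\<lambda>p q. c p * c q * K (f p) (f q) + c p * d q * K (f p) (g q) +
                       d p * c q * K (g p) (f q) + d p * d q * K (g p) (g q))"
proof -
  from assms(1) obtain m a where
    a: "\<And>p q. p \<in> P \<Longrightarrow> q \<in> P \<Longrightarrow> K p q = (\<Sum>j<(m::nat). a p j * a q j)"
    unfolding gram_def by metis
  show ?thesis
    unfolding gram_def
  proof (intro exI ballI)
    fix p q assume "p \<in> Q" "q \<in> Q"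
    then show "c p * c q * K (f p) (f q) + c p * d q * K (f p) (g q) +
          d p * c q * K (g p) (f q) + d p * d q * K (g p) (g q) =
        (\<Sum>j<m. (\<lambda>p j. c p * a (f p) j + d p * a (g p) j) p j *
               (\<lambda>p j. c p * a (f p) j + d p * a (g p) j) q j)"
      using assms(2,3) by (simp add: a sum_distrib_left sum.distrib[symmetric] algebra_simps)
  qed
qed

lemma gram_pullback:
  assumes "gram P K" "\<And>p. p \<in> Q \<Longrightarrow> f p \<in> P"
  shows "gram Q (\<lambda>p q. c p * c q * K (f p) (f q))"
  using gram_lincomb[of P K Q f f c "\<lambda>_. 0"] assms by simp

lemma gram_diagonal:
  assumes "finite P" "\<And>p. p \<in> P \<Longrightarrow> 0 \<le> d p"
  shows "gram P (\<lambda>p q. if p = q then d p else 0)"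
proof -
  have "gram P (\<lambda>p q. \<Sum>s\<in>P. (if p = s then sqrt (d s) else 0) * (if q = s then sqrt (d s) else 0))"
    by (intro gram_sum assms gram_rank_one)
  then show ?thesis
  proof (rule gram_cong)
    fix p q assume "p \<in> P" "q \<in> P"
    have "(\<Sum>s\<in>P. (if p = s then sqrt (d s) else 0) * (if q = s then sqrt (d s) else 0)) =
        (\<Sum>s\<in>P. if s = p then (if p = q then d p else 0) else 0)"
      using assms \<open>p \<in> P\<close> by (intro sum.cong refl) auto
    then show "(\<Sum>s\<in>P. (if p = s then sqrt (d s) else 0) * (if q = s then sqrt (d s) else 0)) =
        (if p = q then d p else 0)"
      using assms(1) \<open>p \<in> P\<close> by (simp add: sum.delta)
  qed
qed

text \<open>Each ordered pair of indices contributes a rank one matrix, with entries 1 and the sign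
  of the entry of \<open>D\<close>, weighted by half its absolute value. Both orders together give
  the entry itself, and on the diagonal the absolute row sums; the slack up to the diagonal value is
  a nonnegative diagonal matrix.\<close>

lemma gram_diagonally_dominant:
  fixes D :: "'p \<Rightarrow> 'p \<Rightarrow> real"
  assumes fin: "finite P"
    and sym: "\<And>p q. p \<in> P \<Longrightarrow> q \<in> P \<Longrightarrow> D p q = D q p"
    and dom: "\<And>p. p \<in> P \<Longrightarrow> (\<Sum>q\<in>P - {p}. \<bar>D p q\<bar>) \<le> t"
  shows "gram P (\<lambda>p q. if p = q then t else D p q)"
proof -
  define R where "R = {(s, t). s \<in> P \<and> t \<in> P \<and> s \<noteq> t}"
  have R: "R = Sigma P (\<lambda>s. P - {s})" and finR: "finite R"
    using fin by (auto simp: R_def intro: finite_subset[of _ "P \<times> P"])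
  define f where "f = (\<lambda>(s, t) p. (if p = s then 1 else 0) + sgn (D s t) * (if p = t then 1 else 0))"
  define h where "h p q = (\<Sum>r\<in>R. (\<bar>D (fst r) (snd r)\<bar> / 2) * (f r p * f r q))" for p q
  have h: "gram P h"
    unfolding h_def by (intro gram_sum finR gram_scale gram_rank_one) simp
  have h_eq: "h p q = (if p = q then (\<Sum>q\<in>P - {p}. \<bar>D p q\<bar>) else D p q)"
    if p: "p \<in> P" and q: "q \<in> P" for p q
  proof -
    have sg: "\<bar>x\<bar> * sgn x = x" "\<bar>x\<bar> * (sgn x * sgn x) = \<bar>x\<bar>" for x :: real
      by (auto simp: sgn_if)
    have "h p q = (\<Sum>s\<in>P. \<Sum>t\<in>P - {s}. (\<bar>D s t\<bar> / 2) * (f (s,t) p * f (s,t) q))"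
      unfolding h_def R using fin by (subst sum.Sigma) (auto intro!: sum.cong)
    also have "\<dots> = (\<Sum>s\<in>P. \<Sum>t\<in>P - {s}. (if p = s \<and> q = s then \<bar>D s t\<bar> / 2 else 0)
        + (if p = s \<and> q = t then D s t / 2 else 0) + (if p = t \<and> q = s then D s t / 2 else 0)
        + (if p = t \<and> q = t then \<bar>D s t\<bar> / 2 else 0))"
      by (intro sum.cong refl) (auto simp: f_def sgn_if)
    also have "\<dots> = (\<Sum>s\<in>P. \<Sum>t\<in>P - {s}. if p = s \<and> q = s then \<bar>D s t\<bar> / 2 else 0)
        + (\<Sum>s\<in>P. \<Sum>t\<in>P - {s}. if p = s \<and> q = t then D s t / 2 else 0)
        + (\<Sum>s\<in>P. \<Sum>t\<in>P - {s}. if p = t \<and> q = s then D s t / 2 else 0)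
        + (\<Sum>s\<in>P. \<Sum>t\<in>P - {s}. if p = t \<and> q = t then \<bar>D s t\<bar> / 2 else 0)"
      by (simp add: sum.distrib)
    also have "(\<Sum>s\<in>P. \<Sum>t\<in>P - {s}. if p = s \<and> q = s then \<bar>D s t\<bar> / 2 else 0) =
        (\<Sum>s\<in>P. if s = p then (if p = q then \<Sum>t\<in>P - {p}. \<bar>D p t\<bar> / 2 else 0) else 0)"
      by (intro sum.cong refl) auto
    also have "\<dots> = (if p = q then (\<Sum>t\<in>P - {p}. \<bar>D p t\<bar> / 2) else 0)"
      using p fin by (simp add: sum.delta)
    also have "(\<Sum>s\<in>P. \<Sum>t\<in>P - {s}. if p = s \<and> q = t then D s t / 2 else 0) =
        (\<Sum>s\<in>P. if s = p then (\<Sum>t\<in>P - {p}. if q = t then D p t / 2 else 0) else 0)"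
      by (intro sum.cong refl) (auto intro!: sum.cong)
    also have "\<dots> = (if p = q then 0 else D p q / 2)"
      using p q fin by (simp add: sum.delta sum.delta')
    also have "(\<Sum>s\<in>P. \<Sum>t\<in>P - {s}. if p = t \<and> q = s then D s t / 2 else 0) =
        (\<Sum>s\<in>P. if s = q then (\<Sum>t\<in>P - {q}. if p = t then D q t / 2 else 0) else 0)"
      by (intro sum.cong refl) (auto intro!: sum.cong)
    also have "\<dots> = (if p = q then 0 else D q p / 2)"
      using p q fin by (simp add: sum.delta sum.delta')
    also have "(\<Sum>s\<in>P. \<Sum>t\<in>P - {s}. if p = t \<and> q = t then \<bar>D s t\<bar> / 2 else 0) =
        (\<Sum>s\<in>P. \<Sum>t\<in>P - {s}. if t = p then (if p = q then \<bar>D s p\<bar> / 2 else 0) else 0)"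
      by (intro sum.cong refl) auto
    also have "\<dots> = (\<Sum>s\<in>P. if s = p then 0 else (if p = q then \<bar>D s p\<bar> / 2 else 0))"
      using p fin by (intro sum.cong refl) (simp add: sum.delta)
    also have "\<dots> = (\<Sum>s\<in>P - {p}. if p = q then \<bar>D s p\<bar> / 2 else 0)"
      using fin p by (subst sum.remove[of P p]) (auto intro!: sum.cong)
    also have "\<dots> = (if p = q then \<Sum>s\<in>P - {p}. \<bar>D p s\<bar> / 2 else 0)"
      using sym p by (auto intro!: sum.cong)
    finally show ?thesis
      using sym[OF p q] by (auto simp: sum_divide_distrib[symmetric])
  qed
  have "gram P (\<lambda>p q. h p q + (if p = q then t - (\<Sum>q\<in>P - {p}. \<bar>D p q\<bar>) else 0))"
    by (intro gram_add h gram_diagonal fin) (use dom in auto)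
  then show ?thesis
    by (rule gram_cong) (auto simp: h_eq)
qed

text \<open>This is the covariance of a stationary autoregressive chain.\<close>

lemma gram_geometric:
  fixes \<rho> :: real
  assumes "0 \<le> \<rho>" "\<rho> \<le> 1"
  shows "gram {..m} (\<lambda>i j. \<rho> ^ (max i j - min i j))"
proof (induction m)
  case 0
  show ?case by (rule gram_cong[OF gram_rank_one[of _ "\<lambda>_. 1"]]) auto
next
  case (Suc m)
  \<comment> \<open>The newest variable is \<open>\<rho>\<close> times its predecessor plus
    independent noise of variance \<open>1 - \<rho>^2\<close>, which keeps the variance 1.\<close>
  let ?c = "\<lambda>i. if i = Suc m then \<rho> else 1" and ?f = "\<lambda>i. if i = Suc m then m else i"
  have "gram {..Suc m} (\<lambda>i j. ?c i * ?c j * \<rho> ^ (max (?f i) (?f j) - min (?f i) (?f j)) +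
      (if i = j then (if i = Suc m then 1 - \<rho>^2 else 0) else 0))"
    by (intro gram_add gram_pullback[OF Suc] gram_diagonal)
       (use assms in \<open>auto simp: le_Suc_eq power_le_one\<close>)
  then show ?case
  proof (rule gram_cong)
    have "\<rho> * \<rho> ^ (m - j) = \<rho> ^ (Suc m - j)" if "j \<le> m" for j
      using that by (simp add: Suc_diff_le)
    then show "?c i * ?c j * \<rho> ^ (max (?f i) (?f j) - min (?f i) (?f j)) +
      (if i = j then (if i = Suc m then 1 - \<rho>^2 else 0) else 0) = \<rho> ^ (max i j - min i j)"
      if "i \<in> {..Suc m}" "j \<in> {..Suc m}" for i j
      using that by (auto simp: power2_eq_square max_def min_def le_Suc_eq)
  qed
qed

text \<open>\<open>dist_kernel \<rho> A W u v\<close> is \<open>\<rho>\<close> to the power of the distance of \<open>u\<close> and \<open>v\<close> in the subgraph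
  induced by \<open>W\<close>, and \<open>0\<close> if they are not connected there.\<close>

definition induced :: "('p \<Rightarrow> 'p \<Rightarrow> bool) \<Rightarrow> 'p set \<Rightarrow> 'p rel" where
  "induced A W = {(x, y). x \<in> W \<and> y \<in> W \<and> A x y}"

definition dist_kernel :: "real \<Rightarrow> ('p \<Rightarrow> 'p \<Rightarrow> bool) \<Rightarrow> 'p set \<Rightarrow> 'p \<Rightarrow> 'p \<Rightarrow> real" where
  "dist_kernel \<rho> A W u v = (SUP n. if (u, v) \<in> induced A W ^^ n then \<rho> ^ n else 0)"

lemma induced_mono: "W \<subseteq> W' \<Longrightarrow> induced A W \<subseteq> induced A W'"
  by (auto simp: induced_def)

locale kernel_graph =
  fixes \<rho> :: real and A :: "'p \<Rightarrow> 'p \<Rightarrow> bool"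
  assumes rho: "0 < \<rho>" "\<rho> < 1"
    and sym: "\<And>x y. A x y \<Longrightarrow> A y x"
    and irrefl: "\<And>x. \<not> A x x"
begin

abbreviation "dk \<equiv> dist_kernel \<rho> A"

lemma rho_power: "0 < \<rho> ^ n" "\<rho> ^ n \<le> 1"
  using rho by (auto simp: power_le_one)

lemma dk_bdd: "bdd_above (range (\<lambda>n. if (u, v) \<in> induced A W ^^ n then \<rho> ^ n else 0))"
  by (rule bdd_aboveI[of _ 1]) (auto simp: rho_power)

lemma dk_ge: "(u, v) \<in> induced A W ^^ n \<Longrightarrow> \<rho> ^ n \<le> dk W u v"
  unfolding dist_kernel_def by (rule order_trans[OF _ cSUP_upper[OF _ dk_bdd, of n]]) auto

lemma dk_le:
  assumes "\<And>n. (u, v) \<in> induced A W ^^ n \<Longrightarrow> \<rho> ^ n \<le> c" "0 \<le> c"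
  shows "dk W u v \<le> c"
  unfolding dist_kernel_def by (rule cSUP_least) (use assms in auto)

lemma dk_nonneg: "0 \<le> dk W u v"
  unfolding dist_kernel_def by (rule order_trans[OF _ cSUP_upper[OF _ dk_bdd, of 0]]) auto

lemma dk_le_1: "dk W u v \<le> 1"
  by (rule dk_le) (auto simp: rho_power)

lemma dk_refl: "dk W u u = 1"
  using dk_ge[where n = 0 and u = u and v = u and W = W] dk_le_1[of W u u] by simp

lemma dk_sym: "dk W u v = dk W v u"
proof -
  have conv: "(v, u) \<in> induced A W ^^ n" if "(u, v) \<in> induced A W ^^ n" for n u v
    using that
  proof (induction n arbitrary: v)
    case (Suc n)
    then obtain w where w: "(u, w) \<in> induced A W ^^ n" "(w, v) \<in> induced A W" by auto
    then have "(v, w) \<in> induced A W" using sym by (auto simp: induced_def)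
    then show ?case using Suc.IH[OF w(1)] by (rule relpow_Suc_I2)
  qed simp
  then have "(u, v) \<in> induced A W ^^ n \<longleftrightarrow> (v, u) \<in> induced A W ^^ n" for n by blast
  then show ?thesis unfolding dist_kernel_def by simp
qed

lemma dk_mono:
  assumes "W \<subseteq> W'" shows "dk W u v \<le> dk W' u v"
proof (rule dk_le)
  fix n assume "(u, v) \<in> induced A W ^^ n"
  then have "(u, v) \<in> induced A W' ^^ n"
    using induced_mono[OF assms] unfolding relpow_fun_conv by blast
  then show "\<rho> ^ n \<le> dk W' u v" by (rule dk_ge)
qed (rule dk_nonneg)

text \<open>The kernel is the smallest nonnegative function that is at least 1 at \<open>u\<close>
  and drops by a factor of at most \<open>\<rho>\<close> per step. Upper bounds on the kernel of an
  enlarged set come from guessing such a function, without analysing shortest paths.\<close>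

lemma dk_least:
  assumes step: "\<And>x y. (x, y) \<in> induced A W \<Longrightarrow> \<rho> * F x \<le> F y"
    and "1 \<le> F u" "0 \<le> F v"
  shows "dk W u v \<le> F v"
proof (rule dk_le[OF _ \<open>0 \<le> F v\<close>])
  fix n assume "(u, v) \<in> induced A W ^^ n"
  then show "\<rho> ^ n \<le> F v"
  proof (induction n arbitrary: v)
    case (Suc n)
    then obtain w where "(u, w) \<in> induced A W ^^ n" "(w, v) \<in> induced A W" by auto
    then have "\<rho> * \<rho> ^ n \<le> \<rho> * F w" "\<rho> * F w \<le> F v"
      using Suc.IH[of w] step[of w v] rho by auto
    then show ?case by simp
  qed (use assms in auto)
qed

lemma dk_step:
  assumes "(x, y) \<in> induced A W"
  shows "\<rho> * dk W u x \<le> dk W u y"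
proof -
  have "dk W u x \<le> dk W u y / \<rho>"
  proof (rule dk_le)
    fix n assume "(u, x) \<in> induced A W ^^ n"
    with assms have "(u, y) \<in> induced A W ^^ Suc n" by auto
    from dk_ge[OF this] show "\<rho> ^ n \<le> dk W u y / \<rho>" using rho by (simp add: field_simps)
  qed (use dk_nonneg rho in auto)
  then show ?thesis using rho by (simp add: field_simps)
qed

lemma dk_chain:
  assumes "\<And>i. i < n \<Longrightarrow> (x i, x (Suc i)) \<in> induced A W"
  shows "\<rho> ^ n * dk W u (x 0) \<le> dk W u (x n)"
  using assms
proof (induction n)
  case (Suc n)
  have "\<rho> ^ Suc n * dk W u (x 0) = \<rho> * (\<rho> ^ n * dk W u (x 0))" by simp
  also have "\<dots> \<le> \<rho> * dk W u (x n)" using Suc rho by (intro mult_left_mono) auto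
  also have "\<dots> \<le> dk W u (x (Suc n))" using Suc.prems by (intro dk_step) auto
  finally show ?case .
qed simp

end

section \<open>Graphs built from pendant vertices and long ears\<close>

text \<open>\<open>vertex\<close> also covers isolated vertices, as \<open>p\<close> need not be a
  neighbour. An ear has an even number \<open>2 * h\<close> of inner vertices, so that they split
  into two halves of \<open>h\<close>, each attached to its own end. One length suffices: removing
  part of a longer path leaves pendant pieces, which \<open>vertex\<close> handles.\<close>

inductive buildable :: "('p \<Rightarrow> 'p \<Rightarrow> bool) \<Rightarrow> nat \<Rightarrow> 'p set \<Rightarrow> bool" for A h where
  empty: "buildable A h {}"
| vertex: "buildable A h W \<Longrightarrow> v \<notin> W \<Longrightarrow> (\<And>w. w \<in> W \<Longrightarrow> A v w \<Longrightarrow> w = p) \<Longrightarrow> buildable A h (insert v W)"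
| ear: "buildable A h W \<Longrightarrow> 0 < h \<Longrightarrow> x 0 \<in> W \<Longrightarrow> x (2 * h + 1) \<in> W \<Longrightarrow> inj_on x {1..2 * h} \<Longrightarrow>
    x ` {1..2 * h} \<inter> W = {} \<Longrightarrow> (\<And>i. i \<le> 2 * h \<Longrightarrow> A (x i) (x (Suc i))) \<Longrightarrow>
    (\<And>i w. i \<in> {1..2 * h} \<Longrightarrow> w \<in> W \<union> x ` {1..2 * h} \<Longrightarrow> A (x i) w \<Longrightarrow>
      w = x (i - 1) \<or> w = x (Suc i)) \<Longrightarrow>
    buildable A h (W \<union> x ` {1..2 * h})"

text \<open>The new vertex gets \<open>r\<close> times the variable of its neighbour plus
  independent noise, with \<open>r\<close> equal to \<open>\<rho>\<close> or, without a neighbour,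
  to 0. It adds one step to distances and creates no shortcut, so the error does not grow.\<close>

lemma (in kernel_graph) approx_vertex:
  assumes K: "gram W K" "\<And>u. u \<in> W \<Longrightarrow> K u u = 1"
      "\<And>u v. u \<in> W \<Longrightarrow> v \<in> W \<Longrightarrow> \<bar>K u v - dk W u v\<bar> \<le> e"
    and W: "finite W" "v \<notin> W" and p: "\<And>w. w \<in> W \<Longrightarrow> A v w \<Longrightarrow> w = p" and "0 \<le> e"
  shows "\<exists>K'. gram (insert v W) K' \<and> (\<forall>u\<in>insert v W. K' u u = 1) \<and>
    (\<forall>u\<in>insert v W. \<forall>w\<in>insert v W. \<bar>K' u w - dk (insert v W) u w\<bar> \<le> e)"
proof (cases "W = {}")
  case True
  have "gram {v} (\<lambda>_ _. 1)" using gram_rank_one[of "{v}" "\<lambda>_. 1"] by simp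
  then show ?thesis using True dk_refl \<open>0 \<le> e\<close> by (intro exI[of _ "\<lambda>_ _. 1"]) auto
next
  case False
  \<comment> \<open>When \<open>p\<close> lies outside \<open>W\<close>, \<open>r\<close> is 0 and
    any vertex of \<open>W\<close> may stand in for it.\<close>
  define p' where "p' = (if p \<in> W then p else SOME w. w \<in> W)"
  define r where "r = (if p \<in> W \<and> A v p then \<rho> else 0)"
  have p': "p' \<in> W" using False by (auto simp: p'_def some_in_eq)
  have r: "0 \<le> r" "r \<le> 1" "r ^ 2 \<le> 1" using rho by (auto simp: r_def power_le_one)
  let ?W = "insert v W"
  let ?c = "\<lambda>u. if u = v then r else 1" and ?f = "\<lambda>u. if u = v then p' else u"
  define K' where "K' u w = ?c u * ?c w * K (?f u) (?f w) +
    (if u = w then (if u = v then 1 - r\<^sup>2 else 0) else 0)" for u w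
  have gram: "gram ?W K'"
    unfolding K'_def by (intro gram_add gram_pullback[OF K(1)] gram_diagonal) (use r p' W in auto)
  have diag: "K' u u = 1" if "u \<in> ?W" for u
    using that K(2) p' W by (auto simp: K'_def power2_eq_square)
  have upper: "dk ?W u w \<le> (if w = v then r * dk W u p' else dk W u w)" if "u \<in> W" for u w
  proof -
    let ?F = "\<lambda>w. if w = v then r * dk W u p' else dk W u w"
    show ?thesis
    proof (rule dk_least[where F = ?F])
      fix x y assume xy: "(x, y) \<in> induced A ?W"
      have nbr: "w = p' \<and> r = \<rho>" if "A v w" "w \<in> W" for w
        using that p[of w] by (auto simp: p'_def r_def)
      have "x \<in> ?W" "y \<in> ?W" "A x y" using xy by (auto simp: induced_def)
      then consider "x \<in> W" "y \<in> W" "(x, y) \<in> induced A W" | "x = v" "y = p'" "r = \<rho>" | "x = p'" "y = v" "r = \<rho>"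
        using nbr[of x] nbr[of y] sym[of x y] irrefl[of v] by (auto simp: induced_def)
      then show "\<rho> * ?F x \<le> ?F y"
      proof cases
        case 1
        then show ?thesis using W dk_step[of x y W u] by auto
      next
        case 2
        have "\<rho> * (\<rho> * dk W u p') \<le> 1 * dk W u p'"
          unfolding mult.assoc[symmetric]
          by (intro mult_right_mono dk_nonneg mult_le_one) (use rho in auto)
        then show ?thesis using 2 p' W by auto
      next
        case 3
        then show ?thesis using p' W by auto
      qed
    qed (use that W r dk_nonneg dk_refl in auto)
  qed
  have dW: "dk ?W u w = dk W u w" if "u \<in> W" "w \<in> W" for u w
    using upper[of u w] that W dk_mono[of W ?W u w] by (intro antisym) (auto split: if_splits)
  have dv: "dk ?W u v = r * dk W u p'" if "u \<in> W" for u
  proof (rule antisym)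
    show "dk ?W u v \<le> r * dk W u p'" using upper[OF that, of v] by simp
    show "r * dk W u p' \<le> dk ?W u v"
    proof (cases "p \<in> W \<and> A v p")
      case True
      then have "(p', v) \<in> induced A ?W" using sym by (auto simp: induced_def p'_def)
      from dk_step[OF this, of u] show ?thesis using True dW[OF that p'] by (simp add: r_def)
    next
      case False
      then have "r = 0" by (auto simp: r_def)
      then show ?thesis using dk_nonneg by simp
    qed
  qed
  have scale: "\<bar>r * a - r * b\<bar> \<le> e" if "\<bar>a - b\<bar> \<le> e" for a b
  proof -
    have "\<bar>r * a - r * b\<bar> = r * \<bar>a - b\<bar>" using r by (simp add: abs_mult right_diff_distrib[symmetric])
    also have "\<dots> \<le> 1 * \<bar>a - b\<bar>" by (intro mult_right_mono r) auto
    finally show ?thesis using that by simp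
  qed
  have "\<bar>K' u w - dk ?W u w\<bar> \<le> e" if u: "u \<in> ?W" and w: "w \<in> ?W" for u w
  proof -
    consider "u = v" "w = v" | "u \<in> W" "w \<in> W" | "u \<in> W" "w = v" | "u = v" "w \<in> W"
      using u w by auto
    then show ?thesis
    proof cases
      case 1
      then show ?thesis using diag[of v] dk_refl \<open>0 \<le> e\<close> by simp
    next
      case 2
      then have "K' u w = K u w" using W by (auto simp: K'_def)
      then show ?thesis using 2 K(3) dW by auto
    next
      case 3
      then have "K' u w = r * K u p'" using W by (auto simp: K'_def)
      then show ?thesis using 3 K(3)[of u p'] p' dv scale by auto
    next
      case 4
      then have "K' u w = r * K p' w" using W by (auto simp: K'_def)
      then show ?thesis using 4 K(3)[of w p'] gram_sym[OF K(1), of w p'] p' dv[of w] scale dk_sym[of ?W u w] by auto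
    qed
  qed
  with gram diag show ?thesis by blast
qed

text \<open>An inner vertex at position i of the first half receives the value of a stationary
  chain, minus \<open>\<rho> ^ i\<close> times the chain's own end value, plus
  \<open>\<rho> ^ i\<close> times the prescribed variable at \<open>x 0\<close>; the second half is
  treated likewise from the other end. Only correlations between the two halves are distorted. This
  costs at most three terms \<open>\<rho> ^ h\<close> relative to the guess \<open>F\<close>, and
  one more between \<open>F\<close> and the true kernel.\<close>

lemma (in kernel_graph) approx_ear:
  assumes K: "gram W K" "\<And>u. u \<in> W \<Longrightarrow> K u u = 1"
      "\<And>u v. u \<in> W \<Longrightarrow> v \<in> W \<Longrightarrow> \<bar>K u v - dk W u v\<bar> \<le> \<delta>"
    and x: "x 0 \<in> W" "x (2 * h + 1) \<in> W" "inj_on x {1..2 * h}" "x ` {1..2 * h} \<inter> W = {}"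
    and edges: "\<And>i. i \<le> 2 * h \<Longrightarrow> A (x i) (x (Suc i))"
    and only: "\<And>i w. i \<in> {1..2 * h} \<Longrightarrow> w \<in> W \<union> x ` {1..2 * h} \<Longrightarrow> A (x i) w \<Longrightarrow>
      w = x (i - 1) \<or> w = x (Suc i)"
    and "0 \<le> \<delta>"
  defines "W' \<equiv> W \<union> x ` {1..2 * h}"
  shows "\<exists>K'. gram W' K' \<and> (\<forall>u\<in>W'. K' u u = 1) \<and>
    (\<forall>u\<in>W'. \<forall>w\<in>W'. \<bar>K' u w - dk W' u w\<bar> \<le> \<delta> + 4 * \<rho> ^ h)"
proof -
  define m where "m = 2 * h + 1"
  define ix where "ix = inv_into {1..2 * h} x"
  define en where "en w = (if ix w \<le> h then 0 else m)" for w
  define e where "e w = (if w \<in> W then w else x (en w))" for w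
  define s where "s w = (if w \<in> W then 0 else if ix w \<le> h then ix w else m - ix w)" for w
  define G where "G i j = \<rho> ^ (max i j - min i j)" for i j :: nat
  \<comment> \<open>Covariance of the chain after subtracting the prediction from the end
    \<open>en\<close> of the half, \<open>s\<close> steps away. The residual variance is
    \<open>1 - \<rho> ^ (2 * s)\<close>; in \<open>K'\<close> the prescribed end variable, scaled by
    \<open>\<rho> ^ s\<close>, restores it to 1.\<close>
  define Y where "Y u w = (if u \<in> W \<or> w \<in> W then 0 else G (ix u) (ix w) - \<rho> ^ s w * G (ix u) (en w)
      - \<rho> ^ s u * G (en u) (ix w) + \<rho> ^ s u * \<rho> ^ s w * G (en u) (en w))" for u w
  define K' where "K' u w = \<rho> ^ s u * \<rho> ^ s w * K (e u) (e w) + Y u w" for u w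
  \<comment> \<open>The guess for the kernel on the enlarged set: the better of two routes, through
    the nearest ends or along the ear. Routes through a farther end use more than \<open>h\<close>
    steps and are covered by the tolerance \<open>\<rho> ^ h\<close>.\<close>
  define F where "F u w = max (\<rho> ^ s u * \<rho> ^ s w * dk W (e u) (e w))
      (if u \<in> W \<or> w \<in> W then 0 else G (ix u) (ix w))" for u w
  have ix: "ix (x i) = i" if "i \<in> {1..2 * h}" for i
    unfolding ix_def using that x(3) by (intro inv_into_f_f)
  have notW: "x i \<notin> W" if "i \<in> {1..2 * h}" for i using x(4) that by blast
  have new: "\<exists>i\<in>{1..2 * h}. u = x i \<and> ix u = i" if "u \<in> W'" "u \<notin> W" for u
    using that ix by (auto simp: W'_def)
  have eW: "e u \<in> W" if "u \<in> W'" for u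
    using that x by (auto simp: e_def en_def m_def)
  have s_le: "s u \<le> h" if "u \<in> W'" for u
    using new[OF that] by (auto simp: s_def m_def)
  have ix_le: "ix u \<le> m" if "u \<in> W'" "u \<notin> W" for u
    using new[OF that] by (auto simp: m_def)
  have rp: "\<rho> ^ i \<le> \<rho> ^ j" if "j \<le> i" for i j
    using that rho by (intro power_decreasing) auto
  have gramY: "gram W' Y"
  proof -
    have "gram {..m} G" unfolding G_def using rho by (intro gram_geometric) auto
    from gram_lincomb[OF this, of W' "\<lambda>w. if w \<in> W then 0 else ix w" "\<lambda>w. if w \<in> W then 0 else en w"
        "\<lambda>w. if w \<in> W then 0 else 1" "\<lambda>w. if w \<in> W then 0 else - (\<rho> ^ s w)"]
    show ?thesis
      by (rule gram_cong) (use ix_le in \<open>auto simp: Y_def en_def\<close>)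
  qed
  have gram: "gram W' K'"
    unfolding K'_def by (intro gram_add gramY gram_pullback[OF K(1)] eW)
  have diag: "K' u u = 1" if "u \<in> W'" for u
    using K(2)[OF eW[OF that]] new[OF that]
    by (cases "u \<in> W") (auto simp: K'_def Y_def s_def en_def G_def m_def power_add[symmetric] algebra_simps)
  have close: "\<bar>K' u w - F u w\<bar> \<le> \<delta> + 3 * \<rho> ^ h" if u: "u \<in> W'" and w: "w \<in> W'" for u w
  proof (cases "u \<in> W \<or> w \<in> W")
    case True
    let ?c = "\<rho> ^ s u * \<rho> ^ s w"
    have c: "0 \<le> ?c" "?c \<le> 1" using rho by (auto intro!: mult_le_one power_le_one)
    have "K' u w - F u w = ?c * (K (e u) (e w) - dk W (e u) (e w))"
      using True mult_nonneg_nonneg[OF c(1) dk_nonneg[of W "e u" "e w"]]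
      by (simp add: K'_def F_def Y_def right_diff_distrib max_absorb1)
    then have "\<bar>K' u w - F u w\<bar> = ?c * \<bar>K (e u) (e w) - dk W (e u) (e w)\<bar>"
      using abs_mult[of ?c] c(1) by simp
    also have "\<dots> \<le> 1 * \<delta>"
      using c K(3)[OF eW[OF u] eW[OF w]] by (intro mult_mono) auto
    finally show ?thesis using rho_power[of h] by simp
  next
    case False
    then have NW: "u \<notin> W" "w \<notin> W" by auto
    have cross: "\<bar>K' u w - F u w\<bar> \<le> \<delta> + 3 * \<rho> ^ h"
      if NW: "u \<notin> W" "w \<notin> W" and i: "ix u \<le> h" and j: "h < ix w" and u: "u \<in> W'" and w: "w \<in> W'" for u w
    proof -
      obtain i j where ij: "i \<in> {1..2 * h}" "ix u = i" "j \<in> {1..2 * h}" "ix w = j" "j \<le> 2 * h"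
        using new[OF u NW(1)] new[OF w NW(2)] by auto
      let ?c = "\<rho> ^ s u * \<rho> ^ s w" and ?k = "K (x 0) (x m)" and ?d = "dk W (x 0) (x m)"
      have c: "0 \<le> ?c" "?c \<le> 1" using rho by (auto intro!: mult_le_one power_le_one)
      have ceq: "?c = \<rho> ^ (i + (m - j))" using NW i j ij by (simp add: s_def power_add)
      have "\<bar>?c * ?k - ?c * ?d\<bar> = ?c * \<bar>?k - ?d\<bar>"
        unfolding right_diff_distrib[symmetric] using abs_mult[of ?c] c(1) by simp
      also have "\<dots> \<le> 1 * \<delta>"
        using c K(3)[OF x(1,2)] by (intro mult_mono) (auto simp: m_def)
      finally have kd: "\<bar>?c * ?k - ?c * ?d\<bar> \<le> \<delta>" by simp
      have Y: "Y u w = \<rho> ^ (j - i) - \<rho> ^ (m - j) * \<rho> ^ (m - i) - \<rho> ^ i * \<rho> ^ j + ?c * \<rho> ^ m"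
        using NW i j ij by (simp add: Y_def s_def en_def G_def max_def min_def m_def)
      have b1: "0 \<le> \<rho> ^ (m - j) * \<rho> ^ (m - i)" "\<rho> ^ (m - j) * \<rho> ^ (m - i) \<le> \<rho> ^ h"
        using i j ij rp[of h "m - j + (m - i)"] rho by (auto simp: power_add[symmetric] m_def)
      have b2: "0 \<le> \<rho> ^ i * \<rho> ^ j" "\<rho> ^ i * \<rho> ^ j \<le> \<rho> ^ h"
        using i j ij rp[of h "i + j"] rho by (auto simp: power_add[symmetric] m_def)
      have "?c * \<rho> ^ m \<le> 1 * \<rho> ^ h"
        using c rho by (intro mult_mono rp) (auto simp: m_def)
      then have b3: "0 \<le> ?c * \<rho> ^ m" "?c * \<rho> ^ m \<le> \<rho> ^ h" using c rho by auto
      have b4: "0 \<le> ?c * ?d" "0 \<le> \<rho> ^ (j - i)"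
        using c dk_nonneg[of W "x 0" "x m"] rho by auto
      \<comment> \<open>\<open>K'\<close> adds the two routes while \<open>F\<close> takes the
        better one. Their lengths on the ear, \<open>j - i\<close> and \<open>i + (m - j)\<close>,
        sum to \<open>m = 2 * h + 1\<close>, so the worse route contributes at most
        \<open>\<rho> ^ h\<close>.\<close>
      have b5: "min (?c * ?d) (\<rho> ^ (j - i)) \<le> \<rho> ^ h"
      proof (cases "h \<le> j - i")
        case True
        then show ?thesis using rp[OF True] by linarith
      next
        case False
        have "?c * ?d \<le> \<rho> ^ (i + (m - j)) * 1"
          unfolding ceq using rho by (intro mult_left_mono dk_le_1) auto
        also have "\<dots> \<le> \<rho> ^ h" using rp[of h "i + (m - j)"] False ij by (auto simp: m_def)
        finally show ?thesis by linarith
      qed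
      have "F u w = max (?c * ?d) (\<rho> ^ (j - i))"
        using NW i j ij by (simp add: F_def e_def en_def G_def max_def min_def)
      moreover have "K' u w = ?c * ?k + Y u w"
        using NW i j ij by (simp add: K'_def e_def en_def)
      ultimately show ?thesis
        unfolding Y using kd b1 b2 b3 b4 b5
        unfolding max_def min_def abs_le_iff by (simp split: if_splits; linarith)
    qed
    obtain i j where ij: "i \<in> {1..2 * h}" "ix u = i" "j \<in> {1..2 * h}" "ix w = j"
      using new[OF u NW(1)] new[OF w NW(2)] by auto
    consider "i \<le> h" "h < j" | "j \<le> h" "h < i" | "(i \<le> h) = (j \<le> h)" by linarith
    then show ?thesis
    proof cases
      case 1
      then show ?thesis using cross[OF NW] u w ij by auto
    next
      case 2
      have "F u w = F w u"
        unfolding F_def using dk_sym[of W "e u" "e w"] by (simp add: G_def max.commute min.commute mult.commute mult.left_commute)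
      moreover have "K' u w = K' w u" using gram_sym[OF gram u w] .
      ultimately show ?thesis using cross[OF NW(2,1)] u w ij 2 by auto
    next
      case 3
      \<comment> \<open>Both vertices are corrected by the same end, whose variance is 1 in the
        chain as well as in \<open>W\<close>; the corrections cancel and the chain covariance
        remains.\<close>
      have same: "e u = e w" "en u = en w" using 3 ij NW by (auto simp: e_def en_def)
      have "K' u w = G i j"
        using 3 NW ij K(2)[OF eW[OF w]] unfolding K'_def same(1)
        by (auto simp: Y_def s_def en_def G_def m_def algebra_simps)
      moreover have "F u w = G i j"
      proof -
        have "\<rho> ^ s u * \<rho> ^ s w \<le> G i j"
          unfolding G_def power_add[symmetric] using 3 NW ij by (intro rp) (auto simp: s_def m_def)
        then show ?thesis using NW ij unfolding F_def same(1) dk_refl by auto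
      qed
      ultimately show ?thesis using \<open>0 \<le> \<delta>\<close> rho_power[of h] by simp
    qed
  qed
  have ind: "(x i, x (Suc i)) \<in> induced A W'" "(x (Suc i), x i) \<in> induced A W'" if "i \<le> 2 * h" for i
  proof -
    have "x i \<in> W'" if "i \<le> m" for i
      using that x(1,2) by (cases "i = 0 \<or> i = m") (auto simp: W'_def m_def)
    then show "(x i, x (Suc i)) \<in> induced A W'" "(x (Suc i), x i) \<in> induced A W'"
      using that edges[OF that] sym by (auto simp: induced_def m_def)
  qed
  have chain: "\<rho> ^ (j - i) * dk W' z (x i) \<le> dk W' z (x j)"
      "\<rho> ^ (j - i) * dk W' z (x j) \<le> dk W' z (x i)" if "i \<le> j" "j \<le> m" for i j z
  proof -
    show "\<rho> ^ (j - i) * dk W' z (x i) \<le> dk W' z (x j)"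
      using dk_chain[of "j - i" "\<lambda>k. x (i + k)" W' z] that ind by (auto simp: m_def)
    have "(x (j - k), x (j - Suc k)) \<in> induced A W'" if "k < j - i" for k
      using that \<open>j \<le> m\<close> ind(2)[of "j - Suc k"] by (auto simp: m_def Suc_diff_Suc)
    from dk_chain[of "j - i" "\<lambda>k. x (j - k)", OF this]
    show "\<rho> ^ (j - i) * dk W' z (x j) \<le> dk W' z (x i)" using that by auto
  qed
  have to_end: "\<rho> ^ s w * dk W' z (e w) \<le> dk W' z w" if w: "w \<in> W'" for w z
  proof (cases "w \<in> W")
    case False
    then obtain j where j: "j \<in> {1..2 * h}" "w = x j" "ix w = j" using new[OF w] by auto
    then show ?thesis using chain(1)[of 0 j z] chain(2)[of j m z] False
      by (auto simp: s_def e_def en_def m_def)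
  qed (simp add: s_def e_def)
  have lower: "F u w \<le> dk W' u w" if u: "u \<in> W'" and w: "w \<in> W'" for u w
  proof -
    have "\<rho> ^ s u * \<rho> ^ s w * dk W (e u) (e w) \<le> \<rho> ^ s u * \<rho> ^ s w * dk W' (e u) (e w)"
      using rho by (intro mult_left_mono dk_mono) (auto simp: W'_def)
    also have "\<dots> = \<rho> ^ s w * (\<rho> ^ s u * dk W' (e w) (e u))"
      by (simp add: dk_sym[of W' "e u"] mult_ac)
    also have "\<dots> \<le> \<rho> ^ s w * dk W' (e w) u"
      using rho by (intro mult_left_mono to_end u) auto
    also have "\<dots> \<le> dk W' u w" using to_end[OF w, of u] by (simp add: dk_sym[of W' u])
    finally have "\<rho> ^ s u * \<rho> ^ s w * dk W (e u) (e w) \<le> dk W' u w" .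
    moreover have "G (ix u) (ix w) \<le> dk W' u w" if NW: "u \<notin> W" "w \<notin> W"
    proof -
      obtain i j where ij: "i \<in> {1..2 * h}" "ix u = i" "u = x i" "j \<in> {1..2 * h}" "ix w = j" "w = x j"
        using new[OF u NW(1)] new[OF w NW(2)] by auto
      then show ?thesis using chain(1)[of i j u] chain(2)[of j i u]
        by (cases "i \<le> j") (auto simp: G_def m_def dk_refl)
    qed
    ultimately show ?thesis using dk_nonneg by (auto simp: F_def)
  qed
  \<comment> \<open>\<open>dk_least\<close> is applied to \<open>max (\<rho> ^ h) (F u w)\<close>.
    The floor is needed at the middle edge, where the nearest end switches and \<open>F\<close>
    alone may jump.\<close>
  have upper: "dk W' u w \<le> max (\<rho> ^ h) (F u w)" if u: "u \<in> W'" and w: "w \<in> W'" for u w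
  proof -
    \<comment> \<open>Along the ear, \<open>F u\<close> is the maximum of \<open>a\<close>, the
      route through the ends, and \<open>b\<close>, the route inside the ear. At the two end
      positions \<open>b\<close> is 0 and \<open>a\<close> takes over.\<close>
    define a where "a i = \<rho> ^ s u * \<rho> ^ min i (m - i) * dk W (e u) (if i \<le> h then x 0 else x m)" for i
    define b where "b i = (if u \<in> W \<or> i = 0 \<or> i = m then 0 else G (ix u) i)" for i
    have Fx: "F u (x i) = max (a i) (b i)" if i: "i \<le> m" for i
    proof -
      consider "i = 0" | "i = m" | "i \<in> {1..2 * h}"
        using i by (force simp: m_def)
      then show ?thesis
      proof cases
        case 3
        then show ?thesis using notW ix[OF 3]
          by (auto simp: F_def a_def b_def s_def e_def en_def m_def min_def)
      qed (use x in \<open>auto simp: F_def a_def b_def s_def e_def m_def\<close>)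
    qed
    have a0: "0 \<le> a i" for i unfolding a_def using rho dk_nonneg by auto
    have a_h: "a i \<le> \<rho> ^ min i (m - i)" for i
    proof -
      have "a i \<le> 1 * \<rho> ^ min i (m - i) * 1"
        unfolding a_def using rho dk_nonneg dk_le_1 by (intro mult_mono) (auto intro: power_le_one)
      then show ?thesis by simp
    qed
    have astep: "\<rho> * a i \<le> max (\<rho> ^ h) (a (Suc i))" "\<rho> * a (Suc i) \<le> max (\<rho> ^ h) (a i)" if "i \<le> 2 * h" for i
    proof -
      consider "i < h" | "i = h" | "h < i" by linarith
      then have "\<rho> * a i \<le> max (\<rho> ^ h) (a (Suc i)) \<and> \<rho> * a (Suc i) \<le> max (\<rho> ^ h) (a i)"
      proof cases
        case 1
        have "min i (m - i) = i" "min (Suc i) (m - Suc i) = Suc i" using 1 by (auto simp: m_def)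
        then have "a (Suc i) = \<rho> * a i" using 1 by (simp add: a_def)
        moreover have "\<rho> * (\<rho> * a i) \<le> 1 * a i"
          unfolding mult.assoc[symmetric] using a0 rho by (intro mult_right_mono mult_le_one) auto
        ultimately show ?thesis by auto
      next
        case 2
        have "\<rho> * t \<le> \<rho> ^ h" if "t \<le> \<rho> ^ h" "0 \<le> t" for t
          using mult_mono[of \<rho> 1 t "\<rho> ^ h"] that rho by auto
        then have "\<rho> * a i \<le> \<rho> ^ h" "\<rho> * a (Suc i) \<le> \<rho> ^ h"
          using 2 a_h[of i] a_h[of "Suc i"] a0 by (auto simp: m_def)
        then show ?thesis by auto
      next
        case 3
        have "m - i = Suc (m - Suc i)" using that by (auto simp: m_def)
        moreover have "min i (m - i) = m - i" "min (Suc i) (m - Suc i) = m - Suc i"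
          using 3 by (auto simp: m_def)
        ultimately have "a i = \<rho> * a (Suc i)" using 3 by (simp add: a_def)
        moreover have "\<rho> * (\<rho> * a (Suc i)) \<le> 1 * a (Suc i)"
          unfolding mult.assoc[symmetric] using a0 rho by (intro mult_right_mono mult_le_one) auto
        ultimately show ?thesis by auto
      qed
      then show "\<rho> * a i \<le> max (\<rho> ^ h) (a (Suc i))" "\<rho> * a (Suc i) \<le> max (\<rho> ^ h) (a i)" by auto
    qed
    have Gstep: "\<rho> * G i j \<le> G i j'" if "j' = Suc j \<or> j = Suc j'" for i j j'
    proof -
      have "\<rho> ^ Suc (max i j - min i j) \<le> \<rho> ^ (max i j' - min i j')"
        using that by (intro rp) auto
      then show ?thesis by (simp add: G_def)
    qed
    have bstep: "\<rho> * b i \<le> max (\<rho> ^ h) (max (a (Suc i)) (b (Suc i)))"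
        "\<rho> * b (Suc i) \<le> max (\<rho> ^ h) (max (a i) (b i))" if i: "i \<le> 2 * h" for i
    proof -
      have "\<rho> * b i \<le> max (\<rho> ^ h) (max (a (Suc i)) (b (Suc i))) \<and>
          \<rho> * b (Suc i) \<le> max (\<rho> ^ h) (max (a i) (b i))"
      proof (cases "u \<in> W")
        case True
        then show ?thesis using a0[of i] a0[of "Suc i"] by (auto simp: b_def max_def)
      next
        case False
        then obtain j where j: "j \<in> {1..2 * h}" "u = x j" "ix u = j" using new[OF u] by auto
        have "max j 1 - min j 1 = j - 1" "max j (2 * h) - min j (2 * h) = 2 * h - j" using j by auto
        then have G_ends: "\<rho> * G j 1 = \<rho> ^ Suc (j - 1)" "\<rho> * G j (2 * h) = \<rho> ^ Suc (2 * h - j)"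
          by (simp_all only: G_def power_Suc)
        have first: "\<rho> * G j 1 \<le> max (\<rho> ^ h) (a 0)"
        proof (cases "j \<le> h")
          case True
          then have "a 0 = \<rho> ^ j" using False j by (simp add: a_def s_def e_def en_def dk_refl)
          moreover have "Suc (j - 1) = j" using j by auto
          ultimately show ?thesis unfolding G_ends by auto
        next
          case False
          have "\<rho> * G j 1 \<le> \<rho> ^ h" unfolding G_ends using False by (intro rp) auto
          then show ?thesis by simp
        qed
        have last: "\<rho> * G j (2 * h) \<le> max (\<rho> ^ h) (a m)"
        proof (cases "j \<le> h")
          case False
          then have "a m = \<rho> ^ (m - j)" using \<open>u \<notin> W\<close> j by (simp add: a_def s_def e_def en_def dk_refl m_def)
          moreover have "Suc (2 * h - j) = m - j" using j by (auto simp: m_def)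
          ultimately show ?thesis unfolding G_ends by auto
        next
          case True
          have "\<rho> * G j (2 * h) \<le> \<rho> ^ h" unfolding G_ends using True by (intro rp) auto
          then show ?thesis by simp
        qed
        have G0: "0 \<le> G i j" for i j using rho by (simp add: G_def)
        consider "i = 0" | "i = 2 * h" "i \<noteq> 0" | "i \<noteq> 0" "i < 2 * h" using i by linarith
        then show ?thesis
        proof cases
          case 1
          then show ?thesis using first j a0[of 1] False by (auto simp: b_def m_def)
        next
          case 2
          then show ?thesis using last j a0[of i] False by (auto simp: b_def m_def)
        next
          case 3
          then show ?thesis using Gstep[of "Suc i" i j] Gstep[of i "Suc i" j] False j
            by (auto simp: b_def m_def)
        qed
      qed
      then show "\<rho> * b i \<le> max (\<rho> ^ h) (max (a (Suc i)) (b (Suc i)))"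
        "\<rho> * b (Suc i) \<le> max (\<rho> ^ h) (max (a i) (b i))" by auto
    qed
    have max3: "\<rho> * max (\<rho> ^ h) (max p q) \<le> t" if "\<rho> ^ h \<le> t" "\<rho> * p \<le> t" "\<rho> * q \<le> t" for p q t
    proof -
      have "\<rho> * \<rho> ^ h \<le> 1 * \<rho> ^ h" using rho by (intro mult_right_mono) auto
      then have "\<rho> * \<rho> ^ h \<le> t" using that(1) by linarith
      then show ?thesis using that(2,3) by (auto simp: max_def)
    qed
    have xstep: "\<rho> * max (\<rho> ^ h) (F u (x i)) \<le> max (\<rho> ^ h) (F u (x (Suc i)))"
        "\<rho> * max (\<rho> ^ h) (F u (x (Suc i))) \<le> max (\<rho> ^ h) (F u (x i))" if "i \<le> 2 * h" for i
    proof -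
      have "\<rho> * a i \<le> max (\<rho> ^ h) (max (a (Suc i)) (b (Suc i)))"
        "\<rho> * a (Suc i) \<le> max (\<rho> ^ h) (max (a i) (b i))"
        using astep[OF that] by (auto simp: le_max_iff_disj)
      then show "\<rho> * max (\<rho> ^ h) (F u (x i)) \<le> max (\<rho> ^ h) (F u (x (Suc i)))"
        "\<rho> * max (\<rho> ^ h) (F u (x (Suc i))) \<le> max (\<rho> ^ h) (F u (x i))"
        using Fx[of i] Fx[of "Suc i"] that bstep[OF that] by (auto simp: m_def intro!: max3)
    qed
    show ?thesis
    proof (rule dk_least[where F = "\<lambda>w. max (\<rho> ^ h) (F u w)"])
      fix y z assume yz: "(y, z) \<in> induced A W'"
      have nbr: "\<exists>i\<le>2 * h. (y = x i \<and> z = x (Suc i)) \<or> (z = x i \<and> y = x (Suc i))"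
        if nW: "y \<notin> W" and yz: "(y, z) \<in> induced A W'" for y z
      proof -
        have y: "y \<in> W'" "z \<in> W'" "A y z" using yz by (auto simp: induced_def)
        obtain i where i: "i \<in> {1..2 * h}" "y = x i" using new[OF y(1) nW] by auto
        have "z = x (i - 1) \<or> z = x (Suc i)" using only[OF i(1), of z] y i by (auto simp: W'_def)
        moreover have "i = Suc (i - 1)" "i - 1 \<le> 2 * h" using i by auto
        ultimately show ?thesis using i by (metis atLeastAtMost_iff)
      qed
      have zy: "(z, y) \<in> induced A W'" using yz sym by (auto simp: induced_def)
      consider "y \<in> W" "z \<in> W" | "y \<notin> W" | "z \<notin> W" by blast
      then show "\<rho> * max (\<rho> ^ h) (F u y) \<le> max (\<rho> ^ h) (F u z)"
      proof cases
        case 1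
        then have "(y, z) \<in> induced A W" using yz by (auto simp: induced_def)
        from dk_step[OF this, of "e u"] have "\<rho> ^ s u * (\<rho> * dk W (e u) y) \<le> \<rho> ^ s u * dk W (e u) z"
          using rho by (intro mult_left_mono) auto
        moreover have "0 \<le> \<rho> ^ s u * dk W (e u) t" for t using rho dk_nonneg by auto
        then have "F u y = \<rho> ^ s u * dk W (e u) y" "F u z = \<rho> ^ s u * dk W (e u) z"
          using 1 by (auto simp: F_def s_def[of y] s_def[of z] e_def[of y] e_def[of z])
        ultimately show ?thesis using max3[of "max (\<rho> ^ h) (F u z)" "F u y" "F u y"]
          by (auto simp: mult_ac)
      next
        case 2
        then show ?thesis using nbr[OF 2 yz] xstep by auto
      next
        case 3
        then show ?thesis using nbr[OF 3 zy] xstep by auto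
      qed
    next
      show "1 \<le> max (\<rho> ^ h) (F u u)"
        by (auto simp: F_def s_def G_def dk_refl)
    qed (use rho in \<open>auto simp: le_max_iff_disj\<close>)
  qed
  have "\<bar>K' u w - dk W' u w\<bar> \<le> \<delta> + 4 * \<rho> ^ h" if "u \<in> W'" "w \<in> W'" for u w
  proof -
    have "0 \<le> F u w" using rho dk_nonneg by (auto simp: F_def le_max_iff_disj)
    then have "\<bar>F u w - dk W' u w\<bar> \<le> \<rho> ^ h"
      using lower[OF that] upper[OF that] rho_power(1)[of h] by (auto simp: max_def split: if_splits)
    then show ?thesis using close[OF that] by linarith
  qed
  with gram diag show ?thesis by blast
qed

text \<open>Each ear costs \<open>4 * \<rho> ^ h\<close> and brings new vertices, so the number of
  ears is charged to \<open>card W\<close>.\<close>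

theorem (in kernel_graph) approx_buildable:
  assumes "buildable A h W"
  shows "finite W \<and> (\<exists>K. gram W K \<and> (\<forall>u\<in>W. K u u = 1) \<and>
    (\<forall>u\<in>W. \<forall>v\<in>W. \<bar>K u v - dk W u v\<bar> \<le> 4 * real (card W) * \<rho> ^ h))"
  using assms
proof induction
  case empty
  then show ?case using gram_zero[of "{}"] by auto
next
  case (vertex W v p)
  then obtain K where K: "gram W K" "\<And>u. u \<in> W \<Longrightarrow> K u u = 1"
    "\<And>u v. u \<in> W \<Longrightarrow> v \<in> W \<Longrightarrow> \<bar>K u v - dk W u v\<bar> \<le> 4 * real (card W) * \<rho> ^ h" by metis
  have fin: "finite W" using vertex by blast
  have le: "4 * real (card W) * \<rho> ^ h \<le> 4 * real (card (insert v W)) * \<rho> ^ h"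
    using fin rho by (intro mult_right_mono mult_left_mono) (auto simp: card_insert_le)
  have "0 \<le> 4 * real (card W) * \<rho> ^ h" using rho by auto
  from approx_vertex[OF K fin vertex(2) vertex(3) this] obtain K' where
    "gram (insert v W) K'" "\<forall>u\<in>insert v W. K' u u = 1"
    "\<forall>u\<in>insert v W. \<forall>w\<in>insert v W. \<bar>K' u w - dk (insert v W) u w\<bar> \<le> 4 * real (card W) * \<rho> ^ h"
    by blast
  then show ?case using fin le by (intro conjI exI[of _ K']) (blast intro: order_trans finite.insertI)+
next
  case (ear W x)
  then obtain K where K: "gram W K" "\<And>u. u \<in> W \<Longrightarrow> K u u = 1"
    "\<And>u v. u \<in> W \<Longrightarrow> v \<in> W \<Longrightarrow> \<bar>K u v - dk W u v\<bar> \<le> 4 * real (card W) * \<rho> ^ h" by metis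
  have fin: "finite W" using ear by blast
  have "card (W \<union> x ` {1..2 * h}) = card W + 2 * h"
    using fin ear(5,6) by (subst card_Un_disjoint) (auto simp: card_image)
  then have le: "4 * real (card W) * \<rho> ^ h + 4 * \<rho> ^ h \<le> 4 * real (card (W \<union> x ` {1..2 * h})) * \<rho> ^ h"
    using \<open>0 < h\<close> rho by (auto simp: algebra_simps)
  let ?W = "W \<union> x ` {1..2 * h}"
  have "0 \<le> 4 * real (card W) * \<rho> ^ h" using rho by auto
  from approx_ear[OF K ear(3-8) this] obtain K' where
    "gram ?W K'" "\<forall>u\<in>?W. K' u u = 1"
    "\<forall>u\<in>?W. \<forall>w\<in>?W. \<bar>K' u w - dk ?W u w\<bar> \<le> 4 * real (card W) * \<rho> ^ h + 4 * \<rho> ^ h"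
    by blast
  then show ?case using fin le by (intro conjI exI[of _ K']) (blast intro: order_trans finite_UnI finite_imageI)+
qed

section \<open>Ear decompositions of sparse graphs\<close>

definition nbrs :: "('v \<Rightarrow> 'v \<Rightarrow> bool) \<Rightarrow> 'v set \<Rightarrow> 'v \<Rightarrow> 'v set" where
  "nbrs A U v = {w \<in> U. A v w}"

text \<open>Walking from any vertex without backtracking, one meets a vertex of degree at least \<open>3\<close>
  within \<open>m\<close> steps unless the claim holds; read backwards, the walk is determined by its last
  arc, so that there are too few vertices of degree at least \<open>3\<close> to reach all of \<open>U\<close>.\<close>

lemma degree_two_walk:
  fixes A :: "'v \<Rightarrow> 'v \<Rightarrow> bool"
  assumes fin: "finite U"
    and sym: "\<And>x y. A x y \<Longrightarrow> A y x"
    and deg: "\<And>v. v \<in> U \<Longrightarrow> 2 \<le> card (nbrs A U v)"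
    and sparse: "3 * m * (\<Sum>v\<in>U. card (nbrs A U v) - 2) < card U"
  obtains y :: "nat \<Rightarrow> 'v" where "\<And>i. y i \<in> U" "\<And>i. A (y i) (y (Suc i))"
    "\<And>i. y i \<noteq> y (i + 2)" "\<And>i. 0 < i \<Longrightarrow> i < m \<Longrightarrow> card (nbrs A U (y i)) = 2"
proof (rule ccontr)
  assume none: "\<not> thesis"
  \<comment> \<open>The state of a walk is a pair of the previous and the current vertex;
    \<open>nx\<close> makes one fixed non-backtracking move.\<close>
  define nx where "nx d = (snd d, SOME z. z \<in> nbrs A U (snd d) \<and> z \<noteq> fst d)" for d
  define w where "w d i = fst ((nx ^^ i) d)" for d i
  have finN: "finite (nbrs A U v)" for v using fin by (simp add: nbrs_def)
  have other: "\<exists>z. z \<in> nbrs A U v \<and> z \<noteq> x" if "v \<in> U" for v x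
  proof (rule ccontr)
    assume "\<not> ?thesis"
    then have "nbrs A U v \<subseteq> {x}" by auto
    then show False using deg[OF that] card_mono[of "{x}" "nbrs A U v"] by auto
  qed
  have nx: "snd (nx d) \<in> nbrs A U (snd d)" "snd (nx d) \<noteq> fst d" "fst (nx d) = snd d"
    if "snd d \<in> U" for d
    using someI_ex[OF other[OF that, of "fst d"]] by (auto simp: nx_def)
  have w_Suc: "w d (Suc i) = snd ((nx ^^ i) d)" for d i by (simp add: w_def nx_def)
  have walk: "w d i \<in> U \<and> w d (Suc i) \<in> nbrs A U (w d i)"
    if "fst d \<in> U" "snd d \<in> nbrs A U (fst d)" for d i
  proof (induction i)
    case 0
    show ?case using that by (simp add: w_def nx_def)
  next
    case (Suc i)
    then have *: "w d (Suc i) \<in> U" by (simp add: nbrs_def)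
    then show ?case using nx(1)[of "(nx ^^ i) d"] by (simp add: w_Suc)
  qed
  have nb: "w d i \<noteq> w d (i + 2)" if "fst d \<in> U" "snd d \<in> nbrs A U (fst d)" for d i
    using nx(2)[of "(nx ^^ i) d"] walk[OF that, of "Suc i"] by (simp add: w_Suc w_def[of d i])
  let ?B = "{b \<in> U. 3 \<le> card (nbrs A U b)}"
  \<comment> \<open>Every \<open>x\<close> is recovered by walking back from the first vertex of
    degree at least 3 on its walk. It is thus determined by an arc at such a vertex and a number of
    steps below \<open>m\<close>.\<close>
  have "U \<subseteq> (\<lambda>(s, d). snd ((nx ^^ s) d)) ` ({..<m} \<times> Sigma ?B (nbrs A U))"
  proof
    fix x assume x: "x \<in> U"
    obtain x' where x': "x' \<in> nbrs A U x" using other[OF x] by blast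
    let ?w = "w (x, x')"
    have wU: "?w i \<in> U" "?w (Suc i) \<in> nbrs A U (?w i)" "?w i \<noteq> ?w (i + 2)" for i
      using walk[of "(x, x')" i] nb[of "(x, x')" i] x x' by auto
    have "\<exists>i. 0 < i \<and> i < m \<and> card (nbrs A U (?w i)) \<noteq> 2"
      using none that[of ?w] wU by (auto simp: nbrs_def)
    then have ex: "\<exists>i. 0 < i \<and> i < m \<and> 3 \<le> card (nbrs A U (?w i))"
      using deg[OF wU(1)] by (metis Suc_1 eval_nat_numeral(3) le_antisym not_less_eq_eq)
    define i where "i = (LEAST i. 0 < i \<and> i < m \<and> 3 \<le> card (nbrs A U (?w i)))"
    have i: "0 < i" "i < m" "3 \<le> card (nbrs A U (?w i))"
      using LeastI_ex[OF ex] unfolding i_def by auto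
    have two: "card (nbrs A U (?w j)) = 2" if j: "0 < j" "j < i" for j
    proof -
      have "\<not> (0 < j \<and> j < m \<and> 3 \<le> card (nbrs A U (?w j)))"
        using j(2) unfolding i_def by (rule not_less_Least)
      then show ?thesis using j i(2) deg[OF wU(1), of j] by auto
    qed
    \<comment> \<open>At a vertex of degree 2 the non-backtracking move is forced, hence
      \<open>nx\<close> retraces the walk in reverse.\<close>
    have rev: "(nx ^^ s) (?w i, ?w (i - 1)) = (?w (i - s), ?w (i - Suc s))" if "s < i" for s
      using that
    proof (induction s)
      case (Suc s)
      define j where "j = i - Suc (Suc s)"
      have j: "i - s = j + 2" "i - Suc s = Suc j" using Suc.prems by (auto simp: j_def)
      have "{?w j, ?w (j + 2)} \<subseteq> nbrs A U (?w (Suc j))"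
        using wU(1)[of j] wU(2)[of j] wU(2)[of "Suc j"] sym by (auto simp: nbrs_def)
      moreover have "card {?w j, ?w (j + 2)} = 2" using wU(3)[of j] by simp
      moreover have "card (nbrs A U (?w (Suc j))) = 2" using two Suc.prems j by auto
      ultimately have "{?w j, ?w (j + 2)} = nbrs A U (?w (Suc j))"
        using finN by (metis card_subset_eq)
      then have "z = ?w j" if "z \<in> nbrs A U (?w (Suc j))" "z \<noteq> ?w (j + 2)" for z
        using that by auto
      moreover have "(nx ^^ Suc s) (?w i, ?w (i - 1)) = nx (?w (j + 2), ?w (Suc j))"
        using Suc.IH Suc.prems j by simp
      moreover have "snd (nx (?w (j + 2), ?w (Suc j))) \<in> nbrs A U (?w (Suc j))"
        "snd (nx (?w (j + 2), ?w (Suc j))) \<noteq> ?w (j + 2)"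
        using nx[of "(?w (j + 2), ?w (Suc j))"] wU(1) by auto
      moreover have "fst (nx d) = snd d" for d by (simp add: nx_def)
      ultimately show ?case using j unfolding j_def[symmetric] by (auto simp: prod_eq_iff simp del: funpow.simps)
    qed simp
    have "x = snd ((nx ^^ (i - 1)) (?w i, ?w (i - 1)))"
      using rev[of "i - 1"] i by (simp add: w_def)
    moreover have "(?w i, ?w (i - 1)) \<in> Sigma ?B (nbrs A U)"
      using i wU(1) wU(2)[of "i - 1"] sym by (auto simp: nbrs_def)
    ultimately show "x \<in> (\<lambda>(s, d). snd ((nx ^^ s) d)) ` ({..<m} \<times> Sigma ?B (nbrs A U))"
      using i(2) by (intro image_eqI[of _ _ "(i - 1, ?w i, ?w (i - 1))"]) auto
  qed
  then have "card U \<le> card ({..<m} \<times> Sigma ?B (nbrs A U))"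
    using fin finN by (intro surj_card_le) auto
  also have "\<dots> = m * (\<Sum>b\<in>?B. card (nbrs A U b))"
    using fin finN by (simp add: card_cartesian_product)
  \<comment> \<open>A degree d \<ge> 3 is at most 3 (d - 2); this is the origin of the 3 in
    \<open>sparse\<close>.\<close>
  also have "\<dots> \<le> m * (\<Sum>b\<in>?B. 3 * (card (nbrs A U b) - 2))"
    by (intro mult_left_mono sum_mono) auto
  also have "\<dots> \<le> m * (\<Sum>b\<in>U. 3 * (card (nbrs A U b) - 2))"
    using fin by (intro mult_left_mono sum_mono2) auto
  finally show False using sparse by (simp add: sum_distrib_left[symmetric])
qed

text \<open>If every point of \<open>W\<close> has two neighbours in \<open>W\<close>, then so has
  every vertex of the projection \<open>U\<close>, and the sparsity of the base graph yields a long
  path of degree-two vertices in \<open>U\<close>. It lifts to \<open>W\<close>, because a point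
  above such a vertex has its two neighbours above the two sides of the path. The inner part of the
  lift is an ear that can be removed. So sparsity is required of the base only.\<close>

lemma buildable_cover:
  fixes A :: "'v \<Rightarrow> 'v \<Rightarrow> bool" and A' :: "'p \<Rightarrow> 'p \<Rightarrow> bool" and \<pi> :: "'p \<Rightarrow> 'v"
  assumes sym: "\<And>x y. A x y \<Longrightarrow> A y x" and sym': "\<And>x y. A' x y \<Longrightarrow> A' y x"
    and cover: "\<And>p p'. A' p p' \<Longrightarrow> A (\<pi> p) (\<pi> p')"
    and local_inj: "\<And>p p' p''. A' p p' \<Longrightarrow> A' p p'' \<Longrightarrow> \<pi> p' = \<pi> p'' \<Longrightarrow> p' = p''"
    and girth: "\<And>y :: nat \<Rightarrow> 'v. (\<And>i. A (y i) (y (Suc i))) \<Longrightarrow> (\<And>i. y i \<noteq> y (i + 2)) \<Longrightarrow>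
      inj_on y {..2 * h + 1}"
    and sparse: "\<And>U. finite U \<Longrightarrow> U \<noteq> {} \<Longrightarrow> U \<subseteq> V \<Longrightarrow> card U \<le> t \<Longrightarrow> (\<And>v. v \<in> U \<Longrightarrow> 2 \<le> card (nbrs A U v)) \<Longrightarrow>
      3 * (2 * h + 1) * (\<Sum>v\<in>U. card (nbrs A U v) - 2) < card U"
    and "0 < h"
    and "finite W" "\<pi> ` W \<subseteq> V" "card W \<le> t"
  shows "buildable A' h W"
  using \<open>finite W\<close> \<open>\<pi> ` W \<subseteq> V\<close> \<open>card W \<le> t\<close>
proof (induction "card W" arbitrary: W rule: less_induct)
  case less
  have rec: "buildable A' h W'" if "W' \<subset> W" for W'
    using less.hyps[of W'] that less.prems psubset_card_mono[of W W'] finite_subset[of W' W] by auto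
  consider "W = {}" | v p where "v \<in> W" "\<And>w. w \<in> W \<Longrightarrow> A' v w \<Longrightarrow> w = p"
    | "W \<noteq> {}" "\<And>v p. v \<in> W \<Longrightarrow> \<exists>w\<in>W. A' v w \<and> w \<noteq> p" by blast
  then show ?case
  proof cases
    case 1
    then show ?thesis by (simp add: buildable.empty)
  next
    case 2
    have "buildable A' h (insert v (W - {v}))"
      by (rule buildable.vertex[OF rec]) (use 2 in auto)
    then show ?thesis using 2 by (simp add: insert_absorb)
  next
    case 3
    define U where "U = \<pi> ` W"
    have U: "finite U" "U \<noteq> {}" "U \<subseteq> V" "card U \<le> t"
      using less.prems 3 card_image_le[of W \<pi>] by (auto simp: U_def)
    have finN: "finite (nbrs A U v)" for v using U by (simp add: nbrs_def)
    have two: "\<exists>p' p''. p' \<in> W \<and> p'' \<in> W \<and> A' p p' \<and> A' p p'' \<and> \<pi> p' \<noteq> \<pi> p''" if "p \<in> W" for p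
      using 3(2)[OF that] local_inj by metis
    have deg: "2 \<le> card (nbrs A U v)" if "v \<in> U" for v
    proof -
      obtain p where p: "p \<in> W" "v = \<pi> p" using \<open>v \<in> U\<close> by (auto simp: U_def)
      obtain p' p'' where "p' \<in> W" "p'' \<in> W" "A' p p'" "A' p p''" "\<pi> p' \<noteq> \<pi> p''"
        using two[OF p(1)] by blast
      then have "{\<pi> p', \<pi> p''} \<subseteq> nbrs A U v" "card {\<pi> p', \<pi> p''} = 2"
        using p cover by (auto simp: nbrs_def U_def)
      then show ?thesis using card_mono[OF finN] by metis
    qed
    let ?m = "2 * h + 1"
    obtain y where y: "\<And>i. y i \<in> U" "\<And>i. A (y i) (y (Suc i))" "\<And>i. y i \<noteq> y (i + 2)"
      "\<And>i. 0 < i \<Longrightarrow> i < ?m \<Longrightarrow> card (nbrs A U (y i)) = 2"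
      using degree_two_walk[OF U(1) sym deg sparse[OF U deg]] by blast
    have inj: "inj_on y {..?m}" by (rule girth) (use y in auto)
    have N: "nbrs A U (y (Suc i)) = {y i, y (i + 2)}" if "Suc i < ?m" for i
    proof -
      have "{y i, y (i + 2)} \<subseteq> nbrs A U (y (Suc i))"
        using y(1,2) sym[OF y(2)[of i]] y(2)[of "Suc i"] by (auto simp: nbrs_def)
      moreover have "card {y i, y (i + 2)} = 2" using y(3)[of i] by simp
      ultimately show ?thesis using y(4)[of "Suc i"] that finN by (metis card_subset_eq zero_less_Suc)
    qed
    have lift: "\<exists>p'\<in>W. A' p p' \<and> \<pi> p' = z"
      if p: "p \<in> W" "\<pi> p = y (Suc i)" "Suc i < ?m" "z \<in> {y i, y (i + 2)}" for p i z
    proof -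
      obtain p' p'' where p': "p' \<in> W" "p'' \<in> W" "A' p p'" "A' p p''" "\<pi> p' \<noteq> \<pi> p''"
        using two[OF p(1)] by blast
      then have "\<pi> p' \<in> nbrs A U (y (Suc i))" "\<pi> p'' \<in> nbrs A U (y (Suc i))"
        using cover p(2) by (force simp: nbrs_def U_def)+
      then show ?thesis using p' p(4) N[OF p(3)] by auto
    qed
    \<comment> \<open>The lift starts above \<open>y 1\<close>, not \<open>y 0\<close>: neighbours
      above both sides are guaranteed only at vertices of degree 2. The point above
      \<open>y 0\<close> is then found by one step back.\<close>
    have "\<exists>f. \<forall>n. (n < ?m \<longrightarrow> f n \<in> W \<and> \<pi> (f n) = y (Suc n)) \<and> (Suc n < ?m \<longrightarrow> A' (f n) (f (Suc n)))"
    proof (rule dependent_nat_choice)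
      show "\<exists>p. 0 < ?m \<longrightarrow> p \<in> W \<and> \<pi> p = y (Suc 0)" using y(1)[of 1] by (auto simp: U_def)
      show "\<exists>p'. (Suc n < ?m \<longrightarrow> p' \<in> W \<and> \<pi> p' = y (Suc (Suc n))) \<and> (Suc n < ?m \<longrightarrow> A' p p')"
        if "n < ?m \<longrightarrow> p \<in> W \<and> \<pi> p = y (Suc n)" for p n
        using lift[of p n "y (n + 2)"] that by auto
    qed
    then obtain f where f: "\<And>n. n < ?m \<Longrightarrow> f n \<in> W \<and> \<pi> (f n) = y (Suc n)"
      "\<And>n. Suc n < ?m \<Longrightarrow> A' (f n) (f (Suc n))" by blast
    obtain p0 where p0: "p0 \<in> W" "A' (f 0) p0" "\<pi> p0 = y 0"
      using lift[of "f 0" 0 "y 0"] f(1)[of 0] \<open>0 < h\<close> by auto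
    define x where "x i = (case i of 0 \<Rightarrow> p0 | Suc n \<Rightarrow> f n)" for i
    have x: "x i \<in> W" "\<pi> (x i) = y i" if "i \<le> ?m" for i
      using that f(1)[of "i - 1"] p0 by (auto simp: x_def split: nat.split)
    have xA: "A' (x i) (x (Suc i))" if "i \<le> 2 * h" for i
      using that f(2)[of "i - 1"] sym'[OF p0(2)] by (auto simp: x_def split: nat.split)
    have injx: "inj_on x {..?m}"
      using inj x(2) unfolding inj_on_def by (metis atMost_iff)
    have only: "w = x (i - 1) \<or> w = x (Suc i)" if i: "i \<in> {1..2 * h}" and w: "w \<in> W" "A' (x i) w" for i w
    proof -
      obtain j where j: "i = Suc j" using i by (cases i) auto
      have "\<pi> w \<in> nbrs A U (y i)" using cover[OF w(2)] x(2)[of i] i w by (auto simp: nbrs_def U_def)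
      then have "\<pi> w = y j \<or> \<pi> w = y (j + 2)" using N[of j] i j by auto
      then have "\<pi> w = \<pi> (x j) \<or> \<pi> w = \<pi> (x (Suc i))" using x(2)[of j] x(2)[of "Suc i"] i j by auto
      moreover have "A' (x i) (x j)" "A' (x i) (x (Suc i))"
        using xA[of i] sym'[OF xA[of j]] i j by auto
      ultimately show ?thesis using local_inj[OF w(2)] j by auto
    qed
    let ?N = "x ` {1..2 * h}"
    have NW: "?N \<subseteq> W" using x(1) by auto
    have "buildable A' h ((W - ?N) \<union> ?N)"
    proof (rule buildable.ear)
      have "x 1 \<in> ?N" using \<open>0 < h\<close> by (intro imageI) auto
      then show "buildable A' h (W - ?N)" using NW by (intro rec) blast
      show "x 0 \<in> W - ?N" "x (2 * h + 1) \<in> W - ?N"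
        using x(1) inj_onD[OF injx] by fastforce+
      show "inj_on x {1..2 * h}" using injx by (rule inj_on_subset) auto
      show "w = x (i - 1) \<or> w = x (Suc i)"
        if "i \<in> {1..2 * h}" "w \<in> W - ?N \<union> ?N" "A' (x i) w" for i w
        using only[OF that(1) _ that(3)] that(2) NW by blast
    qed (use xA \<open>0 < h\<close> in auto)
    then show ?thesis using NW by (simp add: Un_absorb2)
  qed
qed

section \<open>A sparse quasirandom digraph\<close>

lemma exp_ge_power_div_fact: "real s ^ s / fact s \<le> exp (real s)"
proof -
  have "(\<Sum>k\<in>{s}. real s ^ k /\<^sub>R fact k) \<le> (\<Sum>k. real s ^ k /\<^sub>R fact k)"
    by (intro sum_le_suminf summable_exp_generic) auto
  then show ?thesis by (simp add: exp_def divide_inverse mult.commute)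
qed

lemma binomial_le_exp_power:
  assumes "1 \<le> s"
  shows "real (n choose s) \<le> (exp 1 * real n / real s) ^ s"
proof -
  have "real (n choose s) * fact s \<le> real n ^ s"
    using binomial_fact_pow[of n s] by (metis of_nat_fact of_nat_le_iff of_nat_mult of_nat_power)
  then have "real (n choose s) \<le> real n ^ s / fact s" by (simp add: field_simps)
  also have "\<dots> = (real n / real s) ^ s * (real s ^ s / fact s)"
    using assms by (simp add: power_divide)
  also have "\<dots> \<le> (real n / real s) ^ s * exp (real s)"
    by (intro mult_left_mono exp_ge_power_div_fact) auto
  also have "\<dots> = (exp 1 * real n / real s) ^ s"
    by (simp add: power_mult_distrib power_divide exp_of_nat_mult[symmetric])
  finally show ?thesis .
qed

text \<open>Counting form of independence: the random digraph is a function from arc indices to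
  pairs of vertices, and probabilities are ratios of cardinalities.\<close>

lemma card_PiE_constrained_le:
  fixes R :: "'i \<Rightarrow> 'z set"
  assumes "finite M" "finite Z" "Z \<noteq> {}" "I \<subseteq> M" "\<And>i. i \<in> I \<Longrightarrow> R i \<subseteq> Z \<and> card (R i) \<le> r"
  shows "real (card {e \<in> M \<rightarrow>\<^sub>E Z. \<forall>i\<in>I. e i \<in> R i}) \<le>
    (real r / real (card Z)) ^ card I * real (card (M \<rightarrow>\<^sub>E Z))"
proof -
  have fin: "finite I" using assms finite_subset by blast
  have Z: "card Z > 0" using assms by (simp add: card_gt_0_iff)
  have "{e \<in> M \<rightarrow>\<^sub>E Z. \<forall>i\<in>I. e i \<in> R i} = PiE M (\<lambda>i. if i \<in> I then R i else Z)"
  proof (intro set_eqI iffI)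
    fix e assume e: "e \<in> PiE M (\<lambda>i. if i \<in> I then R i else Z)"
    have "e i \<in> Z \<and> (i \<in> I \<longrightarrow> e i \<in> R i)" if "i \<in> M" for i
      using PiE_mem[OF e that] assms(5)[of i] by (cases "i \<in> I") auto
    then show "e \<in> {e \<in> M \<rightarrow>\<^sub>E Z. \<forall>i\<in>I. e i \<in> R i}"
      using e assms(4) by (simp add: PiE_iff subset_iff)
  qed (simp add: PiE_iff)
  then have "card {e \<in> M \<rightarrow>\<^sub>E Z. \<forall>i\<in>I. e i \<in> R i} = (\<Prod>i\<in>M. card (if i \<in> I then R i else Z))"
    using assms(1) by (simp add: card_PiE)
  also have "\<dots> \<le> (\<Prod>i\<in>M. if i \<in> I then r else card Z)"
    using assms by (intro prod_mono) auto
  also have "\<dots> = r ^ card I * card Z ^ card (M - I)"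
    using assms(1,4) fin by (subst prod.If_cases) (auto simp: Int_absorb1 Diff_eq[symmetric])
  finally have "real (card {e \<in> M \<rightarrow>\<^sub>E Z. \<forall>i\<in>I. e i \<in> R i}) \<le> real (r ^ card I * card Z ^ card (M - I))"
    by (rule of_nat_mono)
  also have "\<dots> = real r ^ card I * real (card Z) ^ card (M - I)" by simp
  also have "\<dots> = (real r / real (card Z)) ^ card I * real (card Z) ^ (card I + card (M - I))"
    using Z by (simp add: power_add power_divide)
  also have "card I + card (M - I) = card M"
    using assms(1,4) fin by (simp add: card_Diff_subset card_mono)
  finally show ?thesis using assms(1) by (simp add: card_PiE)
qed

text \<open>Chernoff's method: the exponential moment with parameter l =
  \<open>\<epsilon> / 2\<close> and the bound exp l \<le> 1 + l + l^2 leave the exponent l^2 -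
  \<epsilon> l = - \<epsilon>^2 / 4 per coordinate.\<close>

lemma card_hits_tail:
  fixes \<epsilon> p :: real
  assumes "finite M" "finite Z" "Z \<noteq> {}" "Y \<subseteq> Z" "0 < \<epsilon>" "\<epsilon> \<le> 1" and p: "p = card Y / card Z"
  shows "real (card {e \<in> M \<rightarrow>\<^sub>E Z. (p + \<epsilon>) * card M \<le> card {i \<in> M. e i \<in> Y}}) \<le>
    exp (- (\<epsilon>\<^sup>2 / 4) * card M) * card (M \<rightarrow>\<^sub>E Z)"
proof -
  define l where "l = \<epsilon> / 2"
  have l: "0 \<le> l" "l \<le> 1" using assms by (auto simp: l_def)
  have Z: "card Z > 0" using assms by (simp add: card_gt_0_iff)
  have p01: "0 \<le> p" "p \<le> 1" using assms card_mono[of Z Y] Z by (auto simp: divide_le_eq)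
  let ?B = "{e \<in> M \<rightarrow>\<^sub>E Z. (p + \<epsilon>) * card M \<le> card {i \<in> M. e i \<in> Y}}"
  have finO: "finite (M \<rightarrow>\<^sub>E Z)" using assms by (intro finite_PiE) auto
  have "(\<Sum>e\<in>?B. exp (l * ((p + \<epsilon>) * card M))) \<le> (\<Sum>e\<in>?B. exp (l * card {i \<in> M. e i \<in> Y}))"
    using l by (intro sum_mono) (auto intro: mult_left_mono)
  also have "\<dots> \<le> (\<Sum>e\<in>M \<rightarrow>\<^sub>E Z. exp (l * card {i \<in> M. e i \<in> Y}))"
    using finO by (intro sum_mono2) auto
  also have "\<dots> = (\<Sum>e\<in>M \<rightarrow>\<^sub>E Z. \<Prod>i\<in>M. if e i \<in> Y then exp l else 1)"
  proof (intro sum.cong refl)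
    fix e
    have "(\<Prod>i\<in>M. if e i \<in> Y then exp l else 1) = exp l ^ card {i \<in> M. e i \<in> Y}"
      using assms(1) by (simp add: prod.If_cases Int_def)
    then show "exp (l * card {i \<in> M. e i \<in> Y}) = (\<Prod>i\<in>M. if e i \<in> Y then exp l else 1)"
      by (simp add: exp_of_nat2_mult)
  qed
  also have "\<dots> = (\<Prod>i\<in>M. \<Sum>z\<in>Z. if z \<in> Y then exp l else 1)"
    using assms by (subst prod_sum_PiE) auto
  also have "\<dots> = (card Y * exp l + (real (card Z) - real (card Y))) ^ card M"
  proof -
    have "(\<Sum>z\<in>Z. if z \<in> Y then exp l else 1) = card Y * exp l + card (Z - Y)"
      using assms by (simp add: sum.If_cases Int_absorb1 Diff_eq[symmetric])
    also have "real (card (Z - Y)) = real (card Z) - real (card Y)"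
      using card_mono[OF assms(2,4)] finite_subset[OF assms(4,2)] assms(4)
      by (simp add: card_Diff_subset of_nat_diff)
    finally show ?thesis by (simp only: prod_constant)
  qed
  also have "card Y * exp l + (real (card Z) - real (card Y)) = card Z * (1 + p * (exp l - 1))"
    using Z p by (simp add: field_simps)
  also have "\<dots> ^ card M \<le> (card Z * exp (p * l + l\<^sup>2)) ^ card M"
  proof (intro power_mono mult_left_mono)
    have "1 + p * (exp l - 1) \<le> 1 + p * (l + l\<^sup>2)"
      using exp_bound[OF l] p01 by (intro add_left_mono mult_left_mono) auto
    also have "\<dots> \<le> 1 + (p * l + l\<^sup>2)"
      using p01 by (simp add: distrib_left mult_left_le_one_le)
    also have "\<dots> \<le> exp (p * l + l\<^sup>2)" by (rule exp_ge_add_one_self)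
    finally show "1 + p * (exp l - 1) \<le> exp (p * l + l\<^sup>2)" .
  qed (use p01 l in auto)
  also have "\<dots> = exp ((p * l + l\<^sup>2) * card M) * card (M \<rightarrow>\<^sub>E Z)"
    using assms(1) by (simp add: power_mult_distrib card_PiE exp_of_nat2_mult)
  finally have "card ?B * exp (l * ((p + \<epsilon>) * card M)) \<le> exp ((p * l + l\<^sup>2) * card M) * card (M \<rightarrow>\<^sub>E Z)"
    by simp
  then have "card ?B \<le> exp ((p * l + l\<^sup>2) * card M) * card (M \<rightarrow>\<^sub>E Z) / exp (l * ((p + \<epsilon>) * card M))"
    by (simp add: pos_le_divide_eq)
  also have "\<dots> = exp ((p * l + l\<^sup>2) * card M - l * ((p + \<epsilon>) * card M)) * card (M \<rightarrow>\<^sub>E Z)"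
    by (simp add: exp_diff)
  also have "(p * l + l\<^sup>2) * card M - l * ((p + \<epsilon>) * card M) = - (\<epsilon>\<^sup>2 / 4) * card M"
    by (simp add: l_def power2_eq_square field_simps)
  finally show ?thesis .
qed

section \<open>Short closed walks and dense small sets\<close>

text \<open>Arc indices must be distinct but vertices need not be: this makes the conditions on
  \<open>e\<close> independent. Length 1 is a loop and length 2 covers repeated and reversed arcs,
  so destroying the short closed walks also removes these.\<close>

definition closed_walk :: "(nat \<Rightarrow> nat \<times> nat) \<Rightarrow> nat \<Rightarrow> nat list \<times> nat list \<Rightarrow> bool" where
  "closed_walk e j c \<longleftrightarrow> length (fst c) = j \<and> length (snd c) = j \<and> distinct (snd c) \<and>
    (\<forall>a<j. e (snd c ! a) \<in> {(fst c ! a, fst c ! (Suc a mod j)), (fst c ! (Suc a mod j), fst c ! a)})"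

definition candidates :: "nat \<Rightarrow> nat \<Rightarrow> nat \<Rightarrow> (nat list \<times> nat list) set" where
  "candidates n m j = {vs. set vs \<subseteq> {..<n} \<and> length vs = j} \<times> {is. set is \<subseteq> {..<m} \<and> length is = j}"

lemma candidates: "finite (candidates n m j)" "card (candidates n m j) = n ^ j * m ^ j"
  by (auto simp: candidates_def finite_lists_length_eq card_lists_length_eq card_cartesian_product)

lemma card_closed_walk_le:
  assumes "c \<in> candidates n m j" "0 < n"
  shows "real (card {e \<in> {..<m} \<rightarrow>\<^sub>E ({..<n} \<times> {..<n}). closed_walk e j c}) \<le>
    (2 / (real n)\<^sup>2) ^ j * real (card ({..<m} \<rightarrow>\<^sub>E ({..<n} \<times> {..<n})))"
proof (cases "length (fst c) = j \<and> length (snd c) = j \<and> distinct (snd c)")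
  case False
  then have none: "{e \<in> {..<m} \<rightarrow>\<^sub>E ({..<n} \<times> {..<n}). closed_walk e j c} = {}"
    by (auto simp: closed_walk_def)
  show ?thesis unfolding none by simp
next
  case True
  let ?Z = "{..<n} \<times> {..<n}"
  define pr where "pr a = {(fst c ! a, fst c ! (Suc a mod j)), (fst c ! (Suc a mod j), fst c ! a)}" for a
  define R where "R i = {z. \<exists>a<j. snd c ! a = i \<and> z \<in> pr a}" for i
  have len: "length (fst c) = j" "length (snd c) = j" "set (fst c) \<subseteq> {..<n}" "set (snd c) \<subseteq> {..<m}"
    using assms by (auto simp: candidates_def)
  have R: "R (snd c ! a) = pr a" if "a < j" for a
    using that True by (auto simp: R_def nth_eq_iff_index_eq)
  have prZ: "pr a \<subseteq> ?Z" "card (pr a) \<le> 2" if "a < j" for a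
  proof -
    have "fst c ! b < n" if "b < j" for b using len that nth_mem by blast
    then show "pr a \<subseteq> ?Z" using that by (auto simp: pr_def)
    have "pr a = set [(fst c ! a, fst c ! (Suc a mod j)), (fst c ! (Suc a mod j), fst c ! a)]"
      by (simp add: pr_def)
    then show "card (pr a) \<le> 2" by (metis card_length length_Cons list.size(3) numeral_2_eq_2)
  qed
  have "{e \<in> {..<m} \<rightarrow>\<^sub>E ?Z. closed_walk e j c} = {e \<in> {..<m} \<rightarrow>\<^sub>E ?Z. \<forall>i\<in>set (snd c). e i \<in> R i}"
  proof -
    have "(\<forall>i\<in>set (snd c). e i \<in> R i) \<longleftrightarrow> (\<forall>a<j. e (snd c ! a) \<in> R (snd c ! a))" for e
      using len(2) by (metis in_set_conv_nth)
    then show ?thesis using True R by (simp add: closed_walk_def pr_def[symmetric])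
  qed
  also have "real (card \<dots>) \<le> (real 2 / real (card ?Z)) ^ card (set (snd c)) * real (card ({..<m} \<rightarrow>\<^sub>E ?Z))"
  proof (rule card_PiE_constrained_le)
    show "R i \<subseteq> ?Z \<and> card (R i) \<le> 2" if "i \<in> set (snd c)" for i
      using that R prZ len by (metis in_set_conv_nth)
  qed (use len assms in auto)
  also have "card (set (snd c)) = j" using True by (simp add: distinct_card)
  finally show ?thesis by (simp add: power2_eq_square)
qed

text \<open>The expected number of closed walks along distinct arc indices is the same as in a random
  multigraph: \<open>(2 C)\<^sup>j\<close> for walks of length \<open>j\<close>.\<close>

lemma sum_closed_walks_le:
  fixes n m C g :: nat
  assumes "0 < n" "m = C * n" "1 \<le> C"
  shows "(\<Sum>e\<in>{..<m} \<rightarrow>\<^sub>E ({..<n} \<times> {..<n}). real (card (Sigma {1..g} (\<lambda>j. {c \<in> candidates n m j. closed_walk e j c}))))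
    \<le> g * (2 * real C) ^ g * card ({..<m} \<rightarrow>\<^sub>E ({..<n} \<times> {..<n}))"
proof -
  let ?O = "{..<m} \<rightarrow>\<^sub>E ({..<n} \<times> {..<n})"
  have finO: "finite ?O" by (intro finite_PiE) auto
  have "(\<Sum>e\<in>?O. real (card (Sigma {1..g} (\<lambda>j. {c \<in> candidates n m j. closed_walk e j c}))))
      = (\<Sum>e\<in>?O. \<Sum>j\<in>{1..g}. \<Sum>c\<in>candidates n m j. if closed_walk e j c then 1 else 0)"
    using candidates(1) by (intro sum.cong refl) (simp add: sum.If_cases Int_def)
  also have "\<dots> = (\<Sum>j\<in>{1..g}. \<Sum>c\<in>candidates n m j. \<Sum>e\<in>?O. if closed_walk e j c then 1 else 0)"
    by (subst sum.swap, intro sum.cong refl, subst sum.swap) simp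
  also have "\<dots> = (\<Sum>j\<in>{1..g}. \<Sum>c\<in>candidates n m j. real (card {e \<in> ?O. closed_walk e j c}))"
    using finO by (intro sum.cong refl) (simp add: sum.If_cases Int_def)
  also have "\<dots> \<le> (\<Sum>j\<in>{1..g}. \<Sum>c\<in>candidates n m j. (2 / (real n)\<^sup>2) ^ j * real (card ?O))"
    using assms by (intro sum_mono card_closed_walk_le) auto
  also have "\<dots> = (\<Sum>j\<in>{1..g}. (2 * real C) ^ j * real (card ?O))"
  proof (intro sum.cong refl)
    fix j
    have "(real n ^ j * real m ^ j) * (2 / (real n)\<^sup>2) ^ j = (real n * real m * (2 / (real n)\<^sup>2)) ^ j"
      by (simp only: power_mult_distrib)
    also have "real n * real m * (2 / (real n)\<^sup>2) = 2 * real C"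
      using assms by (simp add: power2_eq_square)
    finally show "(\<Sum>c\<in>candidates n m j. (2 / (real n)\<^sup>2) ^ j * real (card ?O)) = (2 * real C) ^ j * real (card ?O)"
      by (simp add: candidates)
  qed
  also have "\<dots> \<le> (\<Sum>j\<in>{1..g}. (2 * real C) ^ g * real (card ?O))"
    using assms by (intro sum_mono mult_right_mono power_increasing) auto
  finally show ?thesis by simp
qed

text \<open>A union bound over the vertex sets of size \<open>s\<close> and the sets of \<open>s + d\<close> arcs inside them.\<close>

lemma card_dense_sets_le:
  fixes c :: real and n m C s d :: nat
  assumes n: "1 < n" and m: "m = C * n" and C: "1 \<le> C"
    and s: "1 \<le> s" "s\<^sup>2 \<le> n" and d: "d \<le> s" "real s / (12 * c) \<le> d * (ln n / 2)"
    and c: "1 / (12 * c) = 6 + 2 * real C"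
  shows "real (card {e \<in> {..<m} \<rightarrow>\<^sub>E ({..<n} \<times> {..<n}). \<exists>U\<subseteq>{..<n}. card U = s \<and>
      s + d \<le> card {i \<in> {..<m}. e i \<in> U \<times> U}}) \<le> (1 / 8) ^ s * card ({..<m} \<rightarrow>\<^sub>E ({..<n} \<times> {..<n}))"
proof -
  let ?Z = "{..<n} \<times> {..<n}" and ?O = "{..<m} \<rightarrow>\<^sub>E ({..<n} \<times> {..<n})" and ?j = "s + d"
  let ?U = "{U. U \<subseteq> {..<n} \<and> card U = s}" and ?I = "{I. I \<subseteq> {..<m} \<and> card I = ?j}"
  have finO: "finite ?O" by (intro finite_PiE) auto
  have fin: "finite ?U" "finite ?I" by (auto intro: finite_subset[OF _ finite_Pow_iff[THEN iffD2, OF finite_lessThan]])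
  let ?E = "\<lambda>(U, I). {e \<in> ?O. \<forall>i\<in>I. e i \<in> U \<times> U}"
  have "{e \<in> ?O. \<exists>U\<subseteq>{..<n}. card U = s \<and> ?j \<le> card {i \<in> {..<m}. e i \<in> U \<times> U}} \<subseteq> (\<Union>x\<in>?U \<times> ?I. ?E x)"
  proof
    fix e assume "e \<in> {e \<in> ?O. \<exists>U\<subseteq>{..<n}. card U = s \<and> ?j \<le> card {i \<in> {..<m}. e i \<in> U \<times> U}}"
    then obtain U where e: "e \<in> ?O" and U: "U \<subseteq> {..<n}" "card U = s"
      and j: "?j \<le> card {i \<in> {..<m}. e i \<in> U \<times> U}" by blast
    obtain I where "I \<subseteq> {i \<in> {..<m}. e i \<in> U \<times> U}" "card I = ?j"
      using obtain_subset_with_card_n[OF j] by blast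
    then have "(U, I) \<in> ?U \<times> ?I" "e \<in> ?E (U, I)" using e U by auto
    then show "e \<in> (\<Union>x\<in>?U \<times> ?I. ?E x)" by blast
  qed
  then have "card {e \<in> ?O. \<exists>U\<subseteq>{..<n}. card U = s \<and> ?j \<le> card {i \<in> {..<m}. e i \<in> U \<times> U}} \<le> card (\<Union>x\<in>?U \<times> ?I. ?E x)"
    using fin finO by (intro card_mono finite_UN_I) (auto intro: finite_subset[OF _ finO])
  also have "\<dots> \<le> (\<Sum>x\<in>?U \<times> ?I. card (?E x))"
    using fin by (intro card_UN_le finite_cartesian_product)
  finally have "real (card {e \<in> ?O. \<exists>U\<subseteq>{..<n}. card U = s \<and> ?j \<le> card {i \<in> {..<m}. e i \<in> U \<times> U}})
      \<le> real (\<Sum>x\<in>?U \<times> ?I. card (?E x))" by (rule of_nat_mono)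
  also have "\<dots> = (\<Sum>x\<in>?U \<times> ?I. real (card (?E x)))" by (rule of_nat_sum)
  also have "\<dots> \<le> (\<Sum>x\<in>?U \<times> ?I. (real (s\<^sup>2) / real (card ?Z)) ^ ?j * real (card ?O))"
  proof (rule sum_mono)
    fix x assume "x \<in> ?U \<times> ?I"
    then obtain U I where x: "x = (U, I)" "U \<subseteq> {..<n}" "card U = s" "I \<subseteq> {..<m}" "card I = ?j" by blast
    have "real (card {e \<in> ?O. \<forall>i\<in>I. e i \<in> U \<times> U}) \<le> (real (s\<^sup>2) / real (card ?Z)) ^ card I * real (card ?O)"
    proof (rule card_PiE_constrained_le)
      show "U \<times> U \<subseteq> ?Z \<and> card (U \<times> U) \<le> s\<^sup>2"
        using x by (auto simp: card_cartesian_product power2_eq_square)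
      have "(0, 0) \<in> ?Z" using n by simp
      then show "?Z \<noteq> {}" by blast
    qed (use x in auto)
    then show "real (card (?E x)) \<le> (real (s\<^sup>2) / real (card ?Z)) ^ ?j * real (card ?O)"
      using x by simp
  qed
  also have "\<dots> = real (n choose s) * real (m choose ?j) * (real s / real n) ^ (2 * ?j) * real (card ?O)"
  proof -
    have "(real (s\<^sup>2) / real (card ?Z)) ^ ?j = (real s / real n) ^ (2 * ?j)"
      unfolding power_mult by (simp add: power_divide power2_eq_square)
    then show ?thesis by (simp only: sum_constant card_cartesian_product n_subsets finite_lessThan card_lessThan of_nat_mult mult_ac)
  qed
  also have "\<dots> \<le> (1 / 8) ^ s * real (card ?O)"
  proof (rule mult_right_mono)
    \<comment> \<open>As s^2 \<le> n, the ratio s / n is at most n^(-1/2), so that every excess arc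
      gains a factor \<open>exp (ln n / 2)\<close>.\<close>
    have sn: "real s / real n \<le> exp (- (ln n / 2))"
    proof -
      have "real s \<le> sqrt n" using s(2) by (metis of_nat_le_iff of_nat_power real_le_rsqrt)
      then have "real s / real n \<le> sqrt n / n" by (intro divide_right_mono) auto
      also have "\<dots> = inverse (sqrt n)" using n by (simp add: real_div_sqrt inverse_eq_divide field_simps)
      also have "sqrt n = exp (ln n / 2)" using n by (simp add: ln_sqrt[symmetric])
      finally show ?thesis by (simp add: exp_minus)
    qed
    have "real (n choose s) * real (m choose ?j) * (real s / real n) ^ (2 * ?j)
        \<le> (exp 1 * real n / real s) ^ s * (exp 1 * real m / real s) ^ ?j * (real s / real n) ^ (2 * ?j)"
    proof (intro mult_right_mono mult_mono)
      have "real (m choose ?j) \<le> (exp 1 * real m / real ?j) ^ ?j" using s by (intro binomial_le_exp_power) auto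
      also have "\<dots> \<le> (exp 1 * real m / real s) ^ ?j" using s by (intro power_mono divide_left_mono) auto
      finally show "real (m choose ?j) \<le> (exp 1 * real m / real s) ^ ?j" .
    qed (use s in \<open>auto intro: binomial_le_exp_power\<close>)
    \<comment> \<open>The choices contribute (n / s)^(2 s + d) and the probability (s / n)^(2 s + 2
      d). All but \<open>d\<close> factors cancel, so only the excess of arcs over vertices
      pays.\<close>
    also have "\<dots> = exp 1 ^ s * (exp 1 * C) ^ ?j * (real s / real n) ^ d"
    proof -
      define x where "x = real s / real n"
      have x: "x \<noteq> 0" using n s by (auto simp: x_def)
      have e: "exp 1 * real n / real s = exp 1 / x" "exp 1 * real m / real s = exp 1 * C / x"
        using n s m by (auto simp: x_def field_simps)
      have "(exp 1 / x) ^ s * (exp 1 * C / x) ^ ?j * x ^ (2 * ?j) = exp 1 ^ s * (exp 1 * C) ^ ?j * x ^ d"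
      proof -
        have "2 * ?j = s + ?j + d" by simp
        then have "x ^ (2 * ?j) = x ^ s * x ^ ?j * x ^ d" by (simp only: power_add)
        then show ?thesis using x by (simp add: power_divide)
      qed
      then show ?thesis unfolding e x_def[symmetric] .
    qed
    also have "\<dots> \<le> exp 1 ^ s * (exp 1 * exp (real C)) ^ (2 * s) * exp (- (ln n / 2)) ^ d"
    proof (intro mult_mono power_mono sn)
      have "real C \<le> exp (real C)" using exp_ge_add_one_self[of "real C"] by linarith
      then have "exp 1 * real C \<le> exp 1 * exp (real C)" by simp
      then have "(exp 1 * real C) ^ ?j \<le> (exp 1 * exp (real C)) ^ ?j" by (intro power_mono) auto
      also have "\<dots> \<le> (exp 1 * exp (real C)) ^ (2 * s)"
      proof (intro power_increasing)
        have "1 \<le> exp (1 + real C)" by simp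
        then show "1 \<le> exp 1 * exp (real C)" by (simp add: exp_add)
      qed (use d in auto)
      finally show "(exp 1 * real C) ^ ?j \<le> (exp 1 * exp (real C)) ^ (2 * s)" .
    qed auto
    also have "\<dots> = exp (real s + real (2 * s) * (1 + real C) - d * (ln n / 2))"
    proof -
      have "exp 1 ^ s * (exp 1 * exp (real C)) ^ (2 * s) * exp (- (ln n / 2)) ^ d =
          exp (real s * 1 + real (2 * s) * (1 + real C) + real d * - (ln n / 2))"
        by (simp only: exp_of_nat_mult[symmetric] exp_add[symmetric])
      then show ?thesis by simp
    qed
    \<comment> \<open>The constant \<open>c\<close> is tuned to this place:
      \<open>d * (ln n / 2)\<close> is at least \<open>s * (6 + 2 * C)\<close>, while the choices
      cost only s + 2 s (1 + C).\<close>
    also have "\<dots> \<le> exp (real s * (- 3))"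
    proof -
      have "real s / (12 * c) = s * (6 + 2 * real C)" using c by (metis mult.right_neutral times_divide_eq_right)
      then have "real s * (6 + 2 * real C) \<le> d * (ln n / 2)" using d by simp
      then show ?thesis by (simp add: algebra_simps)
    qed
    also have "\<dots> = exp (- 3) ^ s" by (rule exp_of_nat_mult)
    also have "\<dots> \<le> (1 / 8) ^ s"
    proof (intro power_mono)
      have "2 ^ 3 \<le> exp (1 :: real) ^ 3" using exp_ge_add_one_self[of 1] by (intro power_mono) auto
      also have "exp (1 :: real) ^ 3 = exp 3" by (simp add: exp_of_nat_mult[symmetric])
      finally show "exp (- 3) \<le> 1 / (8 :: real)" by (simp add: exp_minus field_simps)
    qed auto
    finally show "real (n choose s) * real (m choose ?j) * (real s / real n) ^ (2 * ?j) \<le> (1 / 8) ^ s" .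
  qed auto
  finally show ?thesis .
qed

section \<open>From the deletion of short cycles to large girth\<close>

definition adjacent :: "'v rel \<Rightarrow> 'v \<Rightarrow> 'v \<Rightarrow> bool" where
  "adjacent E u v \<longleftrightarrow> (u, v) \<in> E \<or> (v, u) \<in> E"

text \<open>A shortest return of a non-backtracking walk is a cycle.\<close>

lemma nonbacktracking_inj_on:
  assumes loopfree: "\<And>v. \<not> adjacent E v v"
    and acyclic: "\<And>y j. 3 \<le> j \<Longrightarrow> j \<le> g \<Longrightarrow> inj_on y {..<j} \<Longrightarrow>
      (\<And>a. a < j \<Longrightarrow> adjacent E (y a) (y (Suc a mod j))) \<Longrightarrow> False"
    and walk: "\<And>i. i < l \<Longrightarrow> adjacent E (y i) (y (Suc i))"
    and nb: "\<And>i. i + 2 \<le> l \<Longrightarrow> y i \<noteq> y (i + 2)" and "l \<le> g"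
  shows "inj_on y {..l}"
proof (rule ccontr)
  assume "\<not> inj_on y {..l}"
  then have ex: "\<exists>j. 0 < j \<and> (\<exists>i. i + j \<le> l \<and> y i = y (i + j))"
  proof -
    obtain i k where ik: "i \<le> l" "k \<le> l" "y i = y k" "i \<noteq> k"
      using \<open>\<not> inj_on y {..l}\<close> by (auto simp: inj_on_def)
    show ?thesis
    proof (cases "i < k")
      case True
      then show ?thesis using ik by (intro exI[of _ "k - i"] conjI exI[of _ i]) auto
    next
      case False
      then show ?thesis using ik by (intro exI[of _ "i - k"] conjI exI[of _ k]) auto
    qed
  qed
  define j where "j = (LEAST j. 0 < j \<and> (\<exists>i. i + j \<le> l \<and> y i = y (i + j)))"
  obtain i where i: "0 < j" "i + j \<le> l" "y i = y (i + j)"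
    using LeastI_ex[OF ex] unfolding j_def by blast
  have least: "y i' \<noteq> y (i' + j')" if "0 < j'" "j' < j" "i' + j' \<le> l" for i' j'
    using not_less_Least[of j' "\<lambda>j. 0 < j \<and> (\<exists>i. i + j \<le> l \<and> y i = y (i + j))"] that
    unfolding j_def by blast
  have "j \<noteq> 1" using i walk[of i] loopfree by (auto simp: adjacent_def)
  moreover have "j \<noteq> 2" using i nb[of i] by auto
  ultimately have j: "3 \<le> j" "j \<le> g" using i \<open>l \<le> g\<close> by auto
  let ?y = "\<lambda>a. y (i + a)"
  have "inj_on ?y {..<j}"
  proof (rule linorder_inj_onI)
    show "y (i + a) \<noteq> y (i + b)" if "a < b" "a \<in> {..<j}" "b \<in> {..<j}" for a b
      using least[of "b - a" "i + a"] that i by auto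
  qed auto
  moreover have "adjacent E (?y a) (?y (Suc a mod j))" if "a < j" for a
    using that walk[of "i + a"] i by (cases "Suc a = j") auto
  ultimately show False using acyclic[OF j, of ?y] by blast
qed

text \<open>The relation between \<open>c\<close> and \<open>C\<close> gives
  \<open>c * (2 * C) \<le> 1 / 6\<close>, so (2 C)^g is at most n^(1/6): the short closed walks are
  far fewer than the arcs.\<close>

lemma eventually_cycles_negligible:
  fixes C :: nat and c \<epsilon> :: real
  assumes C: "1 \<le> C" and c: "0 < c" "1 / (12 * c) = 6 + 2 * real C" and "0 < \<epsilon>"
  shows "\<forall>\<^sub>F n in sequentially.
    4 * real (nat \<lfloor>c * ln (real n)\<rfloor>) * (2 * real C) ^ nat \<lfloor>c * ln (real n)\<rfloor> \<le> \<epsilon> * real (C * n)"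
proof -
  have "\<forall>\<^sub>F n in sequentially. 4 * (c * ln (real n)) * exp (ln (real n) / 6) \<le> \<epsilon> * real n"
    using assms by real_asymp
  then show ?thesis
    using eventually_gt_at_top[of 1]
  proof eventually_elim
    case (elim n)
    let ?g = "nat \<lfloor>c * ln (real n)\<rfloor>"
    have ln: "0 \<le> ln (real n)" using elim by simp
    then have g: "real ?g \<le> c * ln n" using c by simp
    have c_le: "c * (2 * real C) \<le> 1 / 6"
    proof -
      have "1 = (6 + 2 * real C) * (12 * c)" using c by (simp add: field_simps)
      also have "\<dots> = 72 * c + 12 * (c * (2 * real C))" by (simp add: algebra_simps)
      finally show ?thesis using c by linarith
    qed
    have "2 * real C \<le> exp (2 * real C)" using exp_ge_add_one_self[of "2 * real C"] by linarith
    then have "(2 * real C) ^ ?g \<le> exp (2 * real C) ^ ?g" by (intro power_mono) auto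
    also have "\<dots> = exp (real ?g * (2 * real C))" by (simp add: exp_of_nat_mult)
    also have "\<dots> \<le> exp (ln n / 6)"
    proof -
      have "real ?g * (2 * real C) \<le> (c * ln n) * (2 * real C)" using g by (intro mult_right_mono) auto
      also have "\<dots> = (c * (2 * real C)) * ln n" by simp
      also have "\<dots> \<le> 1 / 6 * ln n" using c_le ln by (intro mult_right_mono) auto
      finally show ?thesis by simp
    qed
    finally have "4 * real ?g * (2 * real C) ^ ?g \<le> 4 * (c * ln n) * exp (ln n / 6)"
      using g by (intro mult_mono) auto
    also have "\<dots> \<le> \<epsilon> * real n" using elim by simp
    also have "\<dots> \<le> \<epsilon> * real (C * n)"
      using C \<open>0 < \<epsilon>\<close> by (intro mult_left_mono of_nat_mono) auto
    finally show ?case .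
  qed
qed

text \<open>\<open>m\<close> is the number of arcs drawn, while \<open>E\<close> is what survives
  the deletion. Large girth is stated for non-backtracking walks, the form in which long paths are
  produced. The last clause says that sets U of at most sqrt n vertices span fewer than (1 + 1 / (6
  g)) |U| arcs; in the 6, a factor 3 comes from the degree count and 2 from counting each arc at
  both ends.\<close>

definition sparse_quasirandom :: "real \<Rightarrow> real \<Rightarrow> nat \<Rightarrow> nat \<Rightarrow> nat rel \<Rightarrow> bool" where
  "sparse_quasirandom m \<epsilon> g n E \<longleftrightarrow> E \<subseteq> {..<n} \<times> {..<n} \<and>
    (\<forall>A \<subseteq> {..<n}. \<forall>B \<subseteq> {..<n}.
      real (card (E \<inter> A \<times> B)) \<le> (real (card A) * real (card B) / (real n)\<^sup>2 + \<epsilon>) * m) \<and>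
    (1 - \<epsilon>) * m \<le> real (card E) \<and>
    (\<forall>u v. (u, v) \<in> E \<longrightarrow> u \<noteq> v \<and> (v, u) \<notin> E) \<and>
    (\<forall>l \<le> g. \<forall>y. (\<forall>i<l. adjacent E (y i) (y (Suc i))) \<longrightarrow>
      (\<forall>i. i + 2 \<le> l \<longrightarrow> y i \<noteq> y (i + 2)) \<longrightarrow> inj_on y {..l}) \<and>
    (\<forall>U \<subseteq> {..<n}. U \<noteq> {} \<longrightarrow> (card U)\<^sup>2 \<le> n \<longrightarrow>
      6 * g * card (E \<inter> U \<times> U) < (6 * g + 1) * card U)"

theorem sparse_quasirandom_digraph:
  fixes \<epsilon> :: real
  assumes \<epsilon>: "0 < \<epsilon>" "\<epsilon> \<le> 1"
  obtains C :: nat and c :: real where "1 \<le> C" "0 < c" "\<forall>\<^sub>F n in sequentially. \<exists>E.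
      sparse_quasirandom (C * n) \<epsilon> (nat \<lfloor>c * ln n\<rfloor>) n E"
proof -
  \<comment> \<open>The tail bound exp (- (\<epsilon>^2 / 4) C n) has to beat the 4^n pairs of
    vertex sets; this choice makes it at most exp (- 4 n).\<close>
  define C where "C = nat \<lceil>16 / \<epsilon>\<^sup>2\<rceil>"
  \<comment> \<open>As \<open>g n\<close> is at most \<open>c * ln n\<close>, an excess of
    \<open>s / (6 * g n)\<close> arcs is worth at least \<open>s / (12 * c)\<close> in the exponent,
    and this \<open>c\<close> turns that into \<open>s * (6 + 2 * C)\<close>.\<close>
  define c where "c = 1 / (12 * (6 + 2 * real C))"
  have Ceps: "16 \<le> real C * \<epsilon>\<^sup>2"
  proof -
    have "16 / \<epsilon>\<^sup>2 \<le> real C" unfolding C_def by linarith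
    then show ?thesis using \<epsilon> by (simp add: field_simps)
  qed
  then have C: "1 \<le> C" by (cases "C = 0") auto
  have c: "0 < c" "1 / (12 * c) = 6 + 2 * real C" by (auto simp: c_def)
  define g where "g n = nat \<lfloor>c * ln (real n)\<rfloor>" for n :: nat
  have "\<forall>\<^sub>F n in sequentially. 3 \<le> c * ln (real n)" using c(1) by real_asymp
  then have "\<forall>\<^sub>F n in sequentially. 3 \<le> g n"
    by eventually_elim (simp add: g_def le_nat_iff le_floor_iff)
  then have "\<forall>\<^sub>F n in sequentially. \<exists>E. sparse_quasirandom (C * n) \<epsilon> (g n) n E"
    using eventually_cycles_negligible[OF C c \<epsilon>(1), folded g_def] eventually_gt_at_top[of 1]
  proof eventually_elim
    case (elim n)
    define m where "m = C * n"
    let ?V = "{..<n}"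
    let ?Z = "?V \<times> ?V"
    define O' where "O' = {..<m} \<rightarrow>\<^sub>E ?Z"
    have finO: "finite O'" unfolding O'_def by (intro finite_PiE) auto
    have n: "0 < n" using elim by simp
    have Z: "?Z \<noteq> {}" using n by auto
    have O_pos: "0 < card O'"
      using n by (simp add: O'_def card_PiE)
    \<comment> \<open>Four times the bound on the mean number of short closed walks, so that by
      Markov's inequality at most a quarter of the arc sequences exceed it.\<close>
    define x0 where "x0 = 4 * real (g n) * (2 * real C) ^ g n"
    have x0: "0 < x0" "x0 \<le> \<epsilon> * m" using elim C by (auto simp: x0_def m_def)
    define X where "X e = Sigma {1..g n} (\<lambda>j. {c \<in> candidates n m j. closed_walk e j c})" for e
    define hits where "hits e Y = card {i \<in> {..<m}. e i \<in> Y}" for e :: "nat \<Rightarrow> nat \<times> nat" and Y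
    define d where "d s = nat \<lceil>real s / (6 * g n)\<rceil>" for s :: nat
    define B1 where "B1 = (\<Union>(A, B)\<in>Pow ?V \<times> Pow ?V.
        {e \<in> O'. (real (card (A \<times> B)) / real (card ?Z) + \<epsilon>) * card {..<m} \<le> hits e (A \<times> B)})"
    define B2 where "B2 = (\<Union>s\<in>{s. 1 \<le> s \<and> s\<^sup>2 \<le> n}.
        {e \<in> O'. \<exists>U\<subseteq>?V. card U = s \<and> s + d s \<le> hits e (U \<times> U)})"
    define B3 where "B3 = {e \<in> O'. x0 < card (X e)}"
    have fin_s: "finite {s. 1 \<le> s \<and> s\<^sup>2 \<le> n}"
      by (rule finite_subset[of _ "{..n}"]) (auto dest: power2_nat_le_imp_le)
    have "real (card B1) \<le> 1 / 4 * card O'"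
    proof -
      have "real (card B1) \<le> real (\<Sum>(A, B)\<in>Pow ?V \<times> Pow ?V.
          card {e \<in> O'. (real (card (A \<times> B)) / real (card ?Z) + \<epsilon>) * card {..<m} \<le> hits e (A \<times> B)})"
        unfolding B1_def case_prod_beta by (intro of_nat_mono card_UN_le) auto
      also have "\<dots> = (\<Sum>(A, B)\<in>Pow ?V \<times> Pow ?V.
          real (card {e \<in> O'. (real (card (A \<times> B)) / real (card ?Z) + \<epsilon>) * card {..<m} \<le> hits e (A \<times> B)}))"
        by (simp add: case_prod_beta)
      also have "\<dots> \<le> (\<Sum>(A, B)\<in>Pow ?V \<times> Pow ?V. exp (- (\<epsilon>\<^sup>2 / 4) * card {..<m}) * card O')"
      proof (rule sum_mono, clarify)
        fix A B assume "A \<subseteq> ?V" "B \<subseteq> ?V"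
        then have "A \<times> B \<subseteq> ?Z" by auto
        from card_hits_tail[OF _ _ Z this \<epsilon> refl, of "{..<m}"]
        show "real (card {e \<in> O'. (real (card (A \<times> B)) / real (card ?Z) + \<epsilon>) * card {..<m} \<le> hits e (A \<times> B)})
            \<le> exp (- (\<epsilon>\<^sup>2 / 4) * card {..<m}) * card O'"
          by (simp add: O'_def hits_def)
      qed
      also have "\<dots> = 4 ^ n * exp (- (\<epsilon>\<^sup>2 / 4) * m) * card O'"
        by (simp add: card_cartesian_product card_Pow power_mult_distrib[symmetric])
      also have "\<dots> \<le> 1 / 4 * card O'"
      proof (rule mult_right_mono)
        have "2 ^ 2 \<le> exp (1 :: real) ^ 2" using exp_ge_add_one_self[of 1] by (intro power_mono) auto
        also have "exp (1 :: real) ^ 2 = exp 2" by (simp add: exp_of_nat_mult[symmetric])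
        finally have e2: "4 \<le> exp (2 :: real)" by simp
        have "4 ^ n * exp (- (\<epsilon>\<^sup>2 / 4) * m) \<le> exp 2 ^ n * exp (- 4 * n)"
        proof (intro mult_mono power_mono e2)
          have "16 * real n \<le> (real C * \<epsilon>\<^sup>2) * real n" using Ceps by (intro mult_right_mono) auto
          then show "exp (- (\<epsilon>\<^sup>2 / 4) * m) \<le> exp (- 4 * n)" by (simp add: m_def mult_ac)
        qed auto
        also have "\<dots> = exp (real n * - 2)"
          by (simp add: exp_of_nat_mult[symmetric] exp_add[symmetric])
        also have "\<dots> \<le> exp (- 2)" using n by simp
        also have "\<dots> \<le> 1 / 4" using e2 by (simp add: exp_minus field_simps)
        finally show "4 ^ n * exp (- (\<epsilon>\<^sup>2 / 4) * m) \<le> 1 / 4" .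
      qed auto
      finally show ?thesis .
    qed
    moreover have "real (card B2) \<le> 1 / 7 * card O'"
    proof -
      have "real (card B2) \<le> real (\<Sum>s\<in>{s. 1 \<le> s \<and> s\<^sup>2 \<le> n}.
          card {e \<in> O'. \<exists>U\<subseteq>?V. card U = s \<and> s + d s \<le> hits e (U \<times> U)})"
        unfolding B2_def using fin_s by (intro of_nat_mono card_UN_le) auto
      also have "\<dots> \<le> (\<Sum>s\<in>{s. 1 \<le> s \<and> s\<^sup>2 \<le> n}. (1 / 8) ^ s * card O')"
        unfolding of_nat_sum
      proof (rule sum_mono)
        fix s assume s: "s \<in> {s. 1 \<le> s \<and> s\<^sup>2 \<le> n}"
        have gpos: "1 \<le> real (g n)" using elim by simp
        have "real s / (6 * real (g n)) \<le> real s / 1" using gpos by (intro divide_left_mono) auto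
        then have "d s \<le> s" unfolding d_def by linarith
        moreover have "real s / (12 * c) \<le> d s * (ln n / 2)"
        proof -
          have ln: "0 < ln (real n)" using elim by simp
          have "real (g n) \<le> c * ln n" using c(1) ln by (simp add: g_def)
          then have "real s * real (g n) \<le> real s * (c * ln n)" by (intro mult_left_mono) auto
          then have "real s / (12 * c) \<le> real s / (6 * real (g n)) * (ln n / 2)"
            using gpos c(1) ln by (simp add: field_simps)
          also have "\<dots> \<le> d s * (ln n / 2)" unfolding d_def using ln by (intro mult_right_mono) linarith+
          finally show ?thesis .
        qed
        ultimately show "real (card {e \<in> O'. \<exists>U\<subseteq>?V. card U = s \<and> s + d s \<le> hits e (U \<times> U)}) \<le> (1 / 8) ^ s * card O'"
          unfolding O'_def hits_def using s elim by (intro card_dense_sets_le[OF _ m_def C _ _ _ _ c(2)]) auto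
      qed
      also have "\<dots> \<le> (\<Sum>s\<in>{1..n}. (1 / 8) ^ s * card O')"
        by (intro sum_mono2) (auto dest: power2_nat_le_imp_le)
      also have "\<dots> = (\<Sum>s\<in>{1..n}. (1 / 8) ^ s) * card O'" by (simp add: sum_distrib_right)
      also have "\<dots> \<le> 1 / 7 * card O'"
      proof (rule mult_right_mono)
        have "(\<Sum>s\<in>{1..n}. (1 / 8 :: real) ^ s) = 1 / 7 - (1 / 8) ^ n / 7" by (induction n) auto
        also have "\<dots> \<le> 1 / 7" by simp
        finally show "(\<Sum>s\<in>{1..n}. (1 / 8 :: real) ^ s) \<le> 1 / 7" .
      qed auto
      finally show ?thesis .
    qed
    moreover have "real (card B3) \<le> 1 / 4 * card O'"
    proof -
      have "real (card B3) * x0 = (\<Sum>e\<in>B3. x0)" by simp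
      also have "\<dots> \<le> (\<Sum>e\<in>B3. real (card (X e)))" unfolding B3_def by (intro sum_mono) auto
      also have "\<dots> \<le> (\<Sum>e\<in>O'. real (card (X e)))"
        unfolding B3_def using finO by (intro sum_mono2) auto
      also have "\<dots> \<le> g n * (2 * real C) ^ g n * card O'"
        unfolding X_def O'_def using n C by (intro sum_closed_walks_le) (auto simp: m_def)
      also have "\<dots> = x0 * (1 / 4 * card O')" by (simp add: x0_def)
      finally show ?thesis using x0 by (simp add: mult.commute)
    qed
    ultimately have "real (card (B1 \<union> B2 \<union> B3)) < card O'"
    proof -
      assume a: "real (card B1) \<le> 1 / 4 * card O'" "real (card B2) \<le> 1 / 7 * card O'" "real (card B3) \<le> 1 / 4 * card O'"
      have "card (B1 \<union> B2 \<union> B3) \<le> card B1 + card B2 + card B3"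
        by (meson add_le_mono card_Un_le le_refl order_trans)
      then have "real (card (B1 \<union> B2 \<union> B3)) \<le> real (card B1 + card B2 + card B3)" by (rule of_nat_mono)
      then show ?thesis using a O_pos by simp
    qed
    moreover have "B1 \<union> B2 \<union> B3 \<subseteq> O'" by (auto simp: B1_def B2_def B3_def)
    ultimately have "\<not> O' \<subseteq> B1 \<union> B2 \<union> B3" by (metis less_irrefl subset_antisym)
    then obtain e where e: "e \<in> O'" "e \<notin> B1" "e \<notin> B2" "e \<notin> B3" by blast
    \<comment> \<open>One arc index, the first, for each short closed walk; hence at most
      \<open>card (X e)\<close> indices are lost.\<close>
    define R where "R = (\<lambda>(j, c). hd (snd c)) ` X e"
    define M where "M = {..<m} - R"
    define E where "E = e ` M"
    have finX: "finite (X e)" unfolding X_def using candidates(1) by auto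
    have eZ: "e i \<in> ?Z" if "i < m" for i using e(1) that by (auto simp: O'_def)
    have no_walk: "\<not> closed_walk e j (vs, is)"
      if "1 \<le> j" "j \<le> g n" "set vs \<subseteq> ?V" "set is \<subseteq> M" for j vs "is"
    proof
      assume w: "closed_walk e j (vs, is)"
      then have len: "length vs = j" "length is = j" by (auto simp: closed_walk_def)
      then have "(j, vs, is) \<in> X e" using that w by (auto simp: X_def candidates_def M_def)
      then have "hd is \<in> R" unfolding R_def by force
      moreover have "hd is \<in> M" using that len by (cases "is") auto
      ultimately show False by (simp add: M_def)
    qed
    have M: "i < m" if "i \<in> M" for i using that by (simp add: M_def)
    have EZ: "E \<subseteq> ?Z" unfolding E_def using eZ M by blast
    have pair: "i = i'" if "i \<in> M" "i' \<in> M" "e i = (u, v)" "e i' \<in> {(u, v), (v, u)}" for i i' u v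
    proof (rule ccontr)
      assume "i \<noteq> i'"
      then have "closed_walk e 2 ([u, v], [i, i'])"
        using that by (auto simp: closed_walk_def less_2_cases_iff)
      moreover have "u < n" "v < n" using eZ[OF M[OF that(1)]] that(3) by auto
      ultimately show False using no_walk[of 2 "[u, v]" "[i, i']"] that elim by auto
    qed
    have inj: "inj_on e M"
      by (rule inj_onI) (metis pair insertI1 surj_pair)
    have noloop: "u \<noteq> v" if uv: "(u, v) \<in> E" for u v
    proof
      assume "u = v"
      then obtain i where i: "i \<in> M" "e i = (v, v)" using uv by (auto simp: E_def)
      then have "closed_walk e 1 ([v], [i])" by (auto simp: closed_walk_def)
      moreover have "v < n" using eZ[OF M[OF i(1)]] i by auto
      ultimately show False using no_walk[of 1 "[v]" "[i]"] i elim by auto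
    qed
    have anti: "(v, u) \<notin> E" if uv: "(u, v) \<in> E" for u v
    proof
      assume "(v, u) \<in> E"
      then obtain i i' where i: "i \<in> M" "i' \<in> M" "e i = (u, v)" "e i' = (v, u)"
        using uv unfolding E_def by (metis imageE)
      then show False using pair[OF i(1,2,3)] noloop[OF uv] by auto
    qed
    have cyc: False
      if j: "3 \<le> j" "j \<le> g n" and y: "inj_on y {..<j}"
        and adj: "\<And>a. a < j \<Longrightarrow> adjacent E (y a) (y (Suc a mod j))" for y j
    proof -
      have "\<exists>i\<in>M. e i \<in> {(y a, y (Suc a mod j)), (y (Suc a mod j), y a)}" if "a < j" for a
        using adj[OF that] by (auto simp: adjacent_def E_def)
      then obtain I where I: "\<And>a. a < j \<Longrightarrow> I a \<in> M \<and> e (I a) \<in> {(y a, y (Suc a mod j)), (y (Suc a mod j), y a)}"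
        by metis
      \<comment> \<open>Equal indices would mean equal pairs of vertices. Apart from
        \<open>a = b\<close> this makes each of \<open>a\<close> and \<open>b\<close> the successor
        of the other, impossible for \<open>j \<ge> 3\<close>; hence the separate treatment of
        lengths 1 and 2.\<close>
      have "inj_on I {..<j}"
      proof (rule inj_onI)
        fix a b assume ab: "a \<in> {..<j}" "b \<in> {..<j}" "I a = I b"
        then have "{y a, y (Suc a mod j)} = {y b, y (Suc b mod j)}"
          using I[of a] I[of b] by auto
        then consider "y a = y b" | "y a = y (Suc b mod j)" "y (Suc a mod j) = y b"
          by (auto simp: doubleton_eq_iff)
        then show "a = b"
        proof cases
          case 1
          then show ?thesis using y ab by (auto dest: inj_onD)
        next
          case 2
          have "a = Suc b mod j" "Suc a mod j = b"
            using inj_onD[OF y 2(1)] inj_onD[OF y 2(2)] ab j by auto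
          then show ?thesis using ab j
            by (cases "Suc b = j"; cases "Suc a = j") auto
        qed
      qed
      then have "distinct (map I [0..<j])" by (simp add: distinct_map atLeast0LessThan)
      then have w: "closed_walk e j (map y [0..<j], map I [0..<j])"
        using I j by (auto simp: closed_walk_def)
      moreover have "y a < n" if "a < j" for a using adj[OF that] EZ by (auto simp: adjacent_def)
      ultimately have "set (map y [0..<j]) \<subseteq> ?V" "set (map I [0..<j]) \<subseteq> M" using I by auto
      with w show False using no_walk[of j "map y [0..<j]" "map I [0..<j]"] j by auto
    qed
    have cardE: "card E = card M" unfolding E_def by (rule card_image[OF inj])
    have card_hits: "card (E \<inter> Y) \<le> hits e Y" for Y
    proof -
      have "E \<inter> Y \<subseteq> e ` {i \<in> {..<m}. e i \<in> Y}" using M by (auto simp: E_def)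
      then show ?thesis unfolding hits_def by (intro surj_card_le) auto
    qed
    show ?case
      unfolding sparse_quasirandom_def
    proof (intro exI[of _ E] conjI allI impI)
      show "E \<subseteq> ?Z" by (rule EZ)
      show "real (card (E \<inter> A \<times> B)) \<le> (real (card A) * real (card B) / (real n)\<^sup>2 + \<epsilon>) * real (C * n)"
        if "A \<subseteq> ?V" "B \<subseteq> ?V" for A B
      proof -
        have "real (card (E \<inter> A \<times> B)) \<le> hits e (A \<times> B)" using card_hits by simp
        also have "\<dots> \<le> (real (card (A \<times> B)) / real (card ?Z) + \<epsilon>) * card {..<m}"
        proof (rule ccontr)
          assume "\<not> ?thesis"
          then have "e \<in> B1"
            unfolding B1_def using e(1) that by (intro UN_I[of "(A, B)"]) auto
          then show False using e(2) by blast
        qed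
        finally show ?thesis by (simp add: m_def card_cartesian_product power2_eq_square)
      qed
      show "(1 - \<epsilon>) * real (C * n) \<le> real (card E)"
      proof -
        have "card R \<le> card (X e)" unfolding R_def by (rule card_image_le[OF finX])
        moreover have "real (card (X e)) \<le> x0" using e(1,4) by (auto simp: B3_def)
        ultimately have "real (card R) \<le> x0" by linarith
        moreover have "m - card R \<le> card M"
          unfolding M_def using diff_card_le_card_Diff[of R "{..<m}"] finX by (simp add: R_def)
        ultimately have "real m - x0 \<le> card E" unfolding cardE by linarith
        then show ?thesis using x0(2) by (simp add: m_def algebra_simps)
      qed
      show "inj_on y {..l}" if "l \<le> g n" "\<forall>i<l. adjacent E (y i) (y (Suc i))"
        "\<forall>i. i + 2 \<le> l \<longrightarrow> y i \<noteq> y (i + 2)" for l y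
      proof (rule nonbacktracking_inj_on)
        show "\<not> adjacent E v v" for v using noloop[of v v] by (auto simp: adjacent_def)
      qed (use cyc that in blast)+
      show "6 * g n * card (E \<inter> U \<times> U) < (6 * g n + 1) * card U"
        if U: "U \<subseteq> ?V" "U \<noteq> {}" "(card U)\<^sup>2 \<le> n" for U
      proof -
        have "finite U" using U finite_subset by blast
        then have "1 \<le> card U" using U by (simp add: Suc_leI card_gt_0_iff)
        have "hits e (U \<times> U) < card U + d (card U)"
        proof (rule ccontr)
          assume "\<not> ?thesis"
          then have "e \<in> B2"
            unfolding B2_def using e(1) U \<open>1 \<le> card U\<close> by (intro UN_I[of "card U"]) auto
          then show False using e(3) by blast
        qed
        then have "card (E \<inter> U \<times> U) + 1 \<le> card U + d (card U)" using card_hits[of "U \<times> U"] by linarith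
        moreover have "real (d (card U)) < real (card U) / (6 * g n) + 1"
          unfolding d_def using elim by (simp add: ceiling_correct) linarith
        ultimately have "real (card (E \<inter> U \<times> U)) < real (card U) + real (card U) / (6 * g n)" by linarith
        then have "real (6 * g n) * real (card (E \<inter> U \<times> U)) < (6 * g n) * (real (card U) + real (card U) / (6 * g n))"
          using elim by (intro mult_strict_left_mono) auto
        also have "\<dots> = real ((6 * g n + 1) * card U)" using elim by (simp add: field_simps)
        finally show ?thesis by (metis of_nat_less_iff of_nat_mult)
      qed
    qed (use noloop anti in auto)
  qed
  then show thesis using that[OF C c(1)] by (simp add: g_def)
qed

section \<open>Gaussian variables with prescribed covariances\<close>

text \<open>Levy's uniqueness theorem for the probability measures with densities proportional to
  \<open>h1\<close> and \<open>h2\<close>. The weights carry the other variables, so that joint laws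
  can be compared one variable at a time by the one-dimensional theorem. The phase \<open>t\<close>
  lets cosines encode sines as well.\<close>

lemma levy_weighted:
  fixes X1 :: "'a \<Rightarrow> real" and X2 :: "'b \<Rightarrow> real"
  assumes M: "prob_space M1" "prob_space M2"
    and [measurable]: "X1 \<in> borel_measurable M1" "X2 \<in> borel_measurable M2"
      "h1 \<in> borel_measurable M1" "h2 \<in> borel_measurable M2"
    and h1: "\<And>x. 0 \<le> h1 x" "\<And>x. h1 x \<le> c" and h2: "\<And>x. 0 \<le> h2 x" "\<And>x. h2 x \<le> c"
    and eq: "\<And>s t. (LINT x|M1. h1 x * cos (s * X1 x + t)) = (LINT x|M2. h2 x * cos (s * X2 x + t))"
    and A: "A \<in> sets borel"
  shows "(LINT x|M1. h1 x * indicator A (X1 x)) = (LINT x|M2. h2 x * indicator A (X2 x))"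
proof -
  note [measurable] = A
  interpret M1: prob_space M1 by fact
  interpret M2: prob_space M2 by fact
  have int1: "integrable M1 (\<lambda>x. h1 x * f x)" if "f \<in> borel_measurable M1" "\<And>x. \<bar>f x\<bar> \<le> 1" for f
  proof (rule M1.integrable_const_bound[where B = c])
    have "h1 x * \<bar>f x\<bar> \<le> c * 1" for x
      using that h1 order_trans[OF h1] by (intro mult_mono) auto
    then show "AE x in M1. norm (h1 x * f x) \<le> c" using h1 by (simp add: abs_mult)
  qed (use that in measurable)
  have int2: "integrable M2 (\<lambda>x. h2 x * f x)" if "f \<in> borel_measurable M2" "\<And>x. \<bar>f x\<bar> \<le> 1" for f
  proof (rule M2.integrable_const_bound[where B = c])
    have "h2 x * \<bar>f x\<bar> \<le> c * 1" for x
      using that h2 order_trans[OF h2] by (intro mult_mono) auto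
    then show "AE x in M2. norm (h2 x * f x) \<le> c" using h2 by (simp add: abs_mult)
  qed (use that in measurable)
  define T where "T = (LINT x|M1. h1 x)"
  have T2: "T = (LINT x|M2. h2 x)" using eq[of 0 0] by (simp add: T_def)
  have T: "0 \<le> T" unfolding T_def using h1 by simp
  show ?thesis
  proof (cases "T = 0")
    case True
    have "(LINT x|M1. h1 x * indicator A (X1 x)) \<le> T"
      unfolding T_def using int1[of "\<lambda>_. 1"] int1[of "\<lambda>x. indicator A (X1 x)"] h1
      by (intro integral_mono) (auto simp: indicator_def)
    moreover have "(LINT x|M2. h2 x * indicator A (X2 x)) \<le> T"
      unfolding T2 using int2[of "\<lambda>_. 1"] int2[of "\<lambda>x. indicator A (X2 x)"] h2
      by (intro integral_mono) (auto simp: indicator_def)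
    moreover have "0 \<le> (LINT x|M1. h1 x * indicator A (X1 x))" "0 \<le> (LINT x|M2. h2 x * indicator A (X2 x))"
      using h1 h2 by auto
    ultimately show ?thesis using True by simp
  next
    case False
    then have T: "0 < T" using T by simp
    define N1 where "N1 = distr (density M1 (\<lambda>x. ennreal (h1 x / T))) borel X1"
    define N2 where "N2 = distr (density M2 (\<lambda>x. ennreal (h2 x / T))) borel X2"
    have N1: "(LINT x|N1. f x) = (LINT x|M1. h1 x * f (X1 x)) / T"
      if [measurable]: "f \<in> borel_measurable borel" for f :: "real \<Rightarrow> real"
      unfolding N1_def using h1 T by (simp add: integral_distr integral_density)
    have N2: "(LINT x|N2. f x) = (LINT x|M2. h2 x * f (X2 x)) / T"
      if [measurable]: "f \<in> borel_measurable borel" for f :: "real \<Rightarrow> real"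
      unfolding N2_def using h2 T by (simp add: integral_distr integral_density)
    have prob: "prob_space (density M1 (\<lambda>x. ennreal (h1 x / T)))" "prob_space (density M2 (\<lambda>x. ennreal (h2 x / T)))"
    proof -
      have "(\<integral>\<^sup>+x. ennreal (h1 x / T) \<partial>M1) = ennreal (LINT x|M1. h1 x / T)"
        using int1[of "\<lambda>_. 1"] h1 T by (intro nn_integral_eq_integral) auto
      also have "\<dots> = 1" using T by (simp add: T_def)
      finally show "prob_space (density M1 (\<lambda>x. ennreal (h1 x / T)))"
        by (intro prob_spaceI) (simp add: emeasure_density)
      have "(\<integral>\<^sup>+x. ennreal (h2 x / T) \<partial>M2) = ennreal (LINT x|M2. h2 x / T)"
        using int2[of "\<lambda>_. 1"] h2 T by (intro nn_integral_eq_integral) auto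
      also have "\<dots> = 1" using T by (simp add: T2)
      finally show "prob_space (density M2 (\<lambda>x. ennreal (h2 x / T)))"
        by (intro prob_spaceI) (simp add: emeasure_density)
    qed
    have rd: "real_distribution N1" "real_distribution N2"
      unfolding N1_def N2_def by (auto intro!: prob_space.real_distribution_distr prob)
    interpret N1: real_distribution N1 by fact
    interpret N2: real_distribution N2 by fact
    have "char N1 t = char N2 t" for t
    proof (rule complex_eqI)
      have c1: "integrable N1 (\<lambda>x. iexp (t * x))" "integrable N2 (\<lambda>x. iexp (t * x))"
        by (auto intro!: N1.integrable_const_bound[where B = 1] N2.integrable_const_bound[where B = 1])
      have "Re (char N1 t) = (LINT x|N1. cos (t * x + 0))" "Re (char N2 t) = (LINT x|N2. cos (t * x + 0))"
        unfolding char_def using c1 by (simp_all add: integral_Re[symmetric] Re_exp)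
      then show "Re (char N1 t) = Re (char N2 t)"
        using eq[of t 0] by (simp add: N1 N2)
      have "Im (char N1 t) = (LINT x|N1. cos (t * x + - pi / 2))" "Im (char N2 t) = (LINT x|N2. cos (t * x + - pi / 2))"
        unfolding char_def using c1 by (simp_all add: integral_Im[symmetric] Im_exp cos_diff)
      then show "Im (char N1 t) = Im (char N2 t)"
        using eq[of t "- pi / 2"] by (simp add: N1 N2)
    qed
    then have "N1 = N2" by (intro Levy_uniqueness rd) auto
    have "(LINT x|M1. h1 x * indicator A (X1 x)) / T = (LINT x|N1. indicator A x)"
      by (rule N1[symmetric]) measurable
    also have "\<dots> = (LINT x|N2. indicator A x)" unfolding \<open>N1 = N2\<close> ..
    also have "\<dots> = (LINT x|M2. h2 x * indicator A (X2 x)) / T"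
      by (rule N2) measurable
    finally show ?thesis using T by simp
  qed
qed

locale real_family = prob_space M for M :: "'a measure" +
  fixes X :: "'p \<Rightarrow> 'a \<Rightarrow> real" and P :: "'p set" and A :: "'p \<Rightarrow> real set"
  assumes finP: "finite P"
    and X [measurable]: "p \<in> P \<Longrightarrow> X p \<in> borel_measurable M"
    and A [measurable]: "p \<in> P \<Longrightarrow> A p \<in> sets borel"
begin

definition box :: "'p set \<Rightarrow> 'a \<Rightarrow> real" where
  "box Q x = (\<Prod>p\<in>Q. indicator (A p) (X p x))"

definition phase :: "('p \<Rightarrow> real) \<Rightarrow> real \<Rightarrow> 'a \<Rightarrow> real" where
  "phase c t x = (\<Sum>p\<in>P. c p * X p x) + t"

text \<open>Interpolates between the characteristic function, at \<open>Q = {}\<close>, and the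
  probability of a box, at \<open>Q = P\<close> with zero coefficients and phase.\<close>

definition box_cos :: "'p set \<Rightarrow> ('p \<Rightarrow> real) \<Rightarrow> real \<Rightarrow> real" where
  "box_cos Q c t = (LINT x|M. box Q x * cos (phase c t x))"

lemma measurable_phase [measurable]: "phase c t \<in> borel_measurable M"
  unfolding phase_def[abs_def] by measurable

lemma measurable_box [measurable]:
  assumes "Q \<subseteq> P" shows "box Q \<in> borel_measurable M"
  unfolding box_def[abs_def]
proof (rule borel_measurable_prod)
  fix p assume "p \<in> Q"
  then have [measurable]: "X p \<in> borel_measurable M" "A p \<in> sets borel" using assms by auto
  show "(\<lambda>x. indicator (A p) (X p x) :: real) \<in> borel_measurable M" by measurable
qed

lemma box_bounds: "0 \<le> box Q x" "box Q x \<le> 1"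
  unfolding box_def by (auto intro!: prod_nonneg prod_le_1)

lemma integrable_box:
  assumes "Q \<subseteq> P" "f \<in> borel_measurable M" "\<And>x. \<bar>f x\<bar> \<le> 1"
  shows "integrable M (\<lambda>x. box Q x * f x)"
proof (rule integrable_const_bound[where B = 1])
  have "box Q x * \<bar>f x\<bar> \<le> 1 * 1" for x using assms(3) box_bounds by (intro mult_mono) auto
  then show "AE x in M. norm (box Q x * f x) \<le> 1" using box_bounds by (simp add: abs_mult)
qed (use assms in measurable)

text \<open>The weight is \<open>1 + cos\<close> rather than \<open>cos\<close> because weights must
  be nonnegative. Products of cosines are sums of cosines, so the integral is again expressed by
  \<open>box_cos\<close> for the same \<open>Q\<close>.\<close>

lemma box_weighted_cos:
  assumes "p0 \<in> P" "Q \<subseteq> P"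
  defines "z \<equiv> \<lambda>s p. if p = p0 then s else 0"
  shows "(LINT x|M. box Q x * (1 + cos (phase c t x)) * cos (s * X p0 x + r)) =
    box_cos Q (z s) r + box_cos Q (\<lambda>p. c p + z s p) (t + r) / 2 + box_cos Q (\<lambda>p. c p - z s p) (t - r) / 2"
proof -
  have z: "phase (z s) r x = s * X p0 x + r" for x
  proof -
    have "(\<Sum>p\<in>P. z s p * X p x) = (\<Sum>p\<in>P. if p = p0 then s * X p0 x else 0)"
      unfolding z_def by (intro sum.cong) auto
    then show ?thesis using assms(1) finP by (simp add: phase_def)
  qed
  have "phase (\<lambda>p. c p + z s p) (t + r) x = phase c t x + phase (z s) r x"
    "phase (\<lambda>p. c p - z s p) (t - r) x = phase c t x - phase (z s) r x" for x
    by (simp_all add: phase_def algebra_simps sum.distrib sum_subtractf)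
  moreover have "a * (1 + cos u) * cos v = a * cos v + a * cos (u + v) / 2 + a * cos (u - v) / 2" for a u v :: real
    by (simp add: cos_add cos_diff field_simps)
  ultimately have "(LINT x|M. box Q x * (1 + cos (phase c t x)) * cos (s * X p0 x + r)) =
      (LINT x|M. box Q x * cos (phase (z s) r x) + box Q x * cos (phase (\<lambda>p. c p + z s p) (t + r) x) / 2 +
        box Q x * cos (phase (\<lambda>p. c p - z s p) (t - r) x) / 2)"
    unfolding z[symmetric] by simp
  then show ?thesis
    using integrable_box[OF assms(2), of "\<lambda>x. cos (phase _ _ x)"] by (simp add: box_cos_def)
qed

lemma box_weighted_indicator:
  assumes "p0 \<in> P" "insert p0 Q \<subseteq> P" "p0 \<notin> Q"
  shows "(LINT x|M. box Q x * (1 + cos (phase c t x)) * indicator (A p0) (X p0 x)) =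
    box_cos (insert p0 Q) (\<lambda>_. 0) 0 + box_cos (insert p0 Q) c t"
proof -
  have "finite Q" using assms(2) by (intro finite_subset[OF _ finP]) simp
  then have "box (insert p0 Q) x = box Q x * indicator (A p0) (X p0 x)" for x
    using assms(3) by (simp add: box_def)
  moreover have "phase (\<lambda>_. 0) 0 x = 0" for x by (simp add: phase_def)
  ultimately have "(LINT x|M. box Q x * (1 + cos (phase c t x)) * indicator (A p0) (X p0 x)) =
      (LINT x|M. box (insert p0 Q) x * cos (phase (\<lambda>_. 0) 0 x) + box (insert p0 Q) x * cos (phase c t x))"
    by (simp add: algebra_simps)
  then show ?thesis
    using integrable_box[OF assms(2), of "\<lambda>x. cos (phase _ _ x)"] by (simp add: box_cos_def)
qed

end

text \<open>Cosines are traded for indicators one variable at a time: equality for all coefficients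
  and phases with \<open>Q\<close> is just what \<open>levy_weighted\<close> asks of
  \<open>X p0\<close> weighted by the box over \<open>Q\<close>.\<close>

lemma cos_functionals_determine_boxes:
  assumes "real_family M1 X1 P A" "real_family M2 X2 P A"
    and eq: "\<And>c t. real_family.box_cos M1 X1 P A {} c t = real_family.box_cos M2 X2 P A {} c t"
    and "Q \<subseteq> P"
  shows "real_family.box_cos M1 X1 P A Q c t = real_family.box_cos M2 X2 P A Q c t"
proof -
  interpret R1: real_family M1 X1 P A by fact
  interpret R2: real_family M2 X2 P A by fact
  have "finite Q" using \<open>Q \<subseteq> P\<close> R1.finP by (rule finite_subset)
  then show ?thesis using \<open>Q \<subseteq> P\<close>
  proof (induction Q arbitrary: c t rule: finite_induct)
    case empty
    show ?case by (rule eq)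
  next
    case (insert p0 Q)
    have p0: "p0 \<in> P" and Q: "Q \<subseteq> P" using insert.prems by auto
    note [measurable] = R1.X[OF p0] R2.X[OF p0] R1.measurable_box[OF Q] R2.measurable_box[OF Q]
    have cos: "0 \<le> 1 + cos y" "1 + cos y \<le> 2" for y :: real using abs_cos_le_one[of y] by linarith+
    have "(LINT x|M1. R1.box Q x * (1 + cos (R1.phase c t x)) * indicator (A p0) (X1 p0 x)) =
        (LINT x|M2. R2.box Q x * (1 + cos (R2.phase c t x)) * indicator (A p0) (X2 p0 x))" for c t
    proof (rule levy_weighted[OF R1.prob_space_axioms R2.prob_space_axioms, where c = 2])
      show "X1 p0 \<in> borel_measurable M1" "X2 p0 \<in> borel_measurable M2"
        by (rule R1.X[OF p0], rule R2.X[OF p0])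
      show "(\<lambda>x. R1.box Q x * (1 + cos (R1.phase c t x))) \<in> borel_measurable M1"
        "(\<lambda>x. R2.box Q x * (1 + cos (R2.phase c t x))) \<in> borel_measurable M2"
        by measurable
      show "R1.box Q x * (1 + cos (R1.phase c t x)) \<le> 2" "R2.box Q x' * (1 + cos (R2.phase c t x')) \<le> 2" for x x'
        using mult_mono[OF R1.box_bounds(2)[of Q x] cos(2)] mult_mono[OF R2.box_bounds(2)[of Q x'] cos(2)]
          cos(1) R1.box_bounds R2.box_bounds by auto
      show "0 \<le> R1.box Q x * (1 + cos (R1.phase c t x))" "0 \<le> R2.box Q x' * (1 + cos (R2.phase c t x'))" for x x'
        using R1.box_bounds R2.box_bounds cos by (auto intro!: mult_nonneg_nonneg)
      show "A p0 \<in> sets borel" using R1.A[OF p0] .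
      show "(LINT x|M1. R1.box Q x * (1 + cos (R1.phase c t x)) * cos (s * X1 p0 x + r)) =
          (LINT x|M2. R2.box Q x * (1 + cos (R2.phase c t x)) * cos (s * X2 p0 x + r))" for s r
        by (simp only: R1.box_weighted_cos[OF p0 Q] R2.box_weighted_cos[OF p0 Q] insert.IH[OF Q])
    qed
    then have w: "R1.box_cos (insert p0 Q) (\<lambda>_. 0) 0 + R1.box_cos (insert p0 Q) c t =
        R2.box_cos (insert p0 Q) (\<lambda>_. 0) 0 + R2.box_cos (insert p0 Q) c t" for c t
      by (simp only: R1.box_weighted_indicator[OF p0 insert.prems insert.hyps(2)]
          R2.box_weighted_indicator[OF p0 insert.prems insert.hyps(2)])
    \<comment> \<open>At zero coefficients and phase the two summands of \<open>w\<close> coincide,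
      which settles the constant term; it then cancels for general \<open>c\<close> and
      \<open>t\<close>.\<close>
    from w[of "\<lambda>_. 0" 0] w[of c t] show ?case by simp
  qed
qed

section \<open>Linear forms in independent normal variables\<close>

definition gauss :: "nat \<Rightarrow> (nat \<Rightarrow> real) measure" where
  "gauss m = Pi\<^sub>M {..<m} (\<lambda>_. std_normal_distribution)"

definition linform :: "nat \<Rightarrow> (nat \<Rightarrow> real) \<Rightarrow> (nat \<Rightarrow> real) \<Rightarrow> real" where
  "linform m d \<omega> = (\<Sum>j<m. d j * \<omega> j)"

lemma prob_space_std_normal: "prob_space std_normal_distribution"
  by (rule prob_space_normal_density) simp

lemma prob_space_gauss: "prob_space (gauss m)"
  unfolding gauss_def by (intro prob_space_PiM prob_space_std_normal)

lemma measurable_linform [measurable]: "linform m d \<in> borel_measurable (gauss m)"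
proof -
  have "(\<lambda>\<omega>. \<omega> j) \<in> borel_measurable (gauss m)" if "j < m" for j
  proof -
    have "(\<lambda>\<omega>. \<omega> j) \<in> measurable (gauss m) std_normal_distribution"
      unfolding gauss_def using that by (intro measurable_component_singleton) auto
    then show ?thesis by simp
  qed
  then show ?thesis unfolding linform_def[abs_def] by auto
qed

lemma linform_sum: "(\<Sum>p\<in>P. c p * linform m (a p) \<omega>) = linform m (\<lambda>j. \<Sum>p\<in>P. c p * a p j) \<omega>"
  unfolding linform_def by (simp add: sum_distrib_left sum_distrib_right mult.assoc) (rule sum.swap)

lemma integral_cos_linform:
  "(LINT \<omega>|gauss m. cos (linform m d \<omega> + t)) = cos t * exp (- (\<Sum>j<m. (d j)\<^sup>2) / 2)"
proof -
  interpret G: prob_space "gauss m" by (rule prob_space_gauss)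
  interpret N: prob_space std_normal_distribution by (rule prob_space_std_normal)
  interpret product_prob_space "\<lambda>_ :: nat. std_normal_distribution" "{..<m}"
    by (intro product_prob_spaceI prob_space_std_normal)
  have intN: "integrable std_normal_distribution (\<lambda>x. iexp (s * x))" for s
    by (intro N.integrable_const_bound[where B = 1]) auto
  have int: "integrable (gauss m) (\<lambda>\<omega>. iexp (linform m d \<omega>))"
    by (intro G.integrable_const_bound[where B = 1]) auto
  have "iexp (linform m d \<omega>) = (\<Prod>j<m. iexp (d j * \<omega> j))" for \<omega>
    by (simp add: linform_def exp_sum[symmetric] sum_distrib_left)
  then have "(CLINT \<omega>|gauss m. iexp (linform m d \<omega>)) = (CLINT \<omega>|gauss m. \<Prod>j<m. iexp (d j * \<omega> j))"
    by simp
  also have "\<dots> = (\<Prod>j<m. CLINT x|std_normal_distribution. iexp (d j * x))"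
    unfolding gauss_def by (rule product_integral_prod) (use intN in auto)
  also have "\<dots> = (\<Prod>j<m. char std_normal_distribution (d j))" by (simp add: char_def)
  also have "\<dots> = complex_of_real (exp (- (\<Sum>j<m. (d j)\<^sup>2) / 2))"
    unfolding char_std_normal_distribution of_real_prod[symmetric]
    by (subst exp_sum[symmetric]) (simp_all add: sum_negf sum_divide_distrib)
  finally have E: "(CLINT \<omega>|gauss m. iexp (linform m d \<omega>)) = complex_of_real (exp (- (\<Sum>j<m. (d j)\<^sup>2) / 2))" .
  have c: "(LINT \<omega>|gauss m. cos (linform m d \<omega>)) = exp (- (\<Sum>j<m. (d j)\<^sup>2) / 2)"
    using arg_cong[OF E, of Re] int by (simp add: integral_Re[symmetric] Re_exp)
  have s: "(LINT \<omega>|gauss m. sin (linform m d \<omega>)) = 0"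
    using arg_cong[OF E, of Im] int by (simp add: integral_Im[symmetric] Im_exp)
  have "integrable (gauss m) (\<lambda>\<omega>. cos (linform m d \<omega>))" "integrable (gauss m) (\<lambda>\<omega>. sin (linform m d \<omega>))"
    by (auto intro!: G.integrable_const_bound[where B = 1])
  then show ?thesis using c s by (simp add: cos_add)
qed

text \<open>Cosine integrals depend on the coefficient vectors only through their inner products.
  The two families may live in different dimensions; this is what makes independently chosen
  representations of local covariances consistent.\<close>

lemma gauss_law:
  assumes "finite P"
    and K: "\<And>p q. p \<in> P \<Longrightarrow> q \<in> P \<Longrightarrow> (\<Sum>j<m. a p j * a q j) = (\<Sum>j<m'. b p j * b q j)"
    and B: "B \<in> sets (Pi\<^sub>M P (\<lambda>_. borel))"
  shows "measure (gauss m) {\<omega> \<in> space (gauss m). (\<lambda>p\<in>P. linform m (a p) \<omega>) \<in> B} =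
    measure (gauss m') {\<omega> \<in> space (gauss m'). (\<lambda>p\<in>P. linform m' (b p) \<omega>) \<in> B}"
proof -
  interpret G1: prob_space "gauss m" by (rule prob_space_gauss)
  interpret G2: prob_space "gauss m'" by (rule prob_space_gauss)
  let ?X1 = "\<lambda>\<omega>. \<lambda>p\<in>P. linform m (a p) \<omega>" and ?X2 = "\<lambda>\<omega>. \<lambda>p\<in>P. linform m' (b p) \<omega>"
  have X: "?X1 \<in> measurable (gauss m) (Pi\<^sub>M P (\<lambda>_. borel))" "?X2 \<in> measurable (gauss m') (Pi\<^sub>M P (\<lambda>_. borel))"
    by (auto intro!: measurable_restrict)
  have sq: "(\<Sum>j<m. (\<Sum>p\<in>P. c p * a p j)\<^sup>2) = (\<Sum>p\<in>P. \<Sum>q\<in>P. c p * c q * (\<Sum>j<m. a p j * a q j))"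
    for m and a :: "'a \<Rightarrow> nat \<Rightarrow> real" and c
  proof -
    have "(\<Sum>j<m. (\<Sum>p\<in>P. c p * a p j)\<^sup>2) = (\<Sum>j<m. \<Sum>p\<in>P. \<Sum>q\<in>P. c p * c q * (a p j * a q j))"
      by (simp add: power2_eq_square sum_product mult_ac)
    also have "\<dots> = (\<Sum>p\<in>P. \<Sum>j<m. \<Sum>q\<in>P. c p * c q * (a p j * a q j))" by (rule sum.swap)
    also have "\<dots> = (\<Sum>p\<in>P. \<Sum>q\<in>P. \<Sum>j<m. c p * c q * (a p j * a q j))"
      by (intro sum.cong refl sum.swap)
    finally show ?thesis by (simp add: sum_distrib_left)
  qed
  have cos: "(LINT \<omega>|gauss m. cos ((\<Sum>p\<in>P. c p * linform m (a p) \<omega>) + t)) =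
      (LINT \<omega>|gauss m'. cos ((\<Sum>p\<in>P. c p * linform m' (b p) \<omega>) + t))" for c t
  proof -
    have "(\<Sum>p\<in>P. \<Sum>q\<in>P. c p * c q * (\<Sum>j<m. a p j * a q j)) = (\<Sum>p\<in>P. \<Sum>q\<in>P. c p * c q * (\<Sum>j<m'. b p j * b q j))"
      using K by (intro sum.cong refl) simp
    then show ?thesis unfolding linform_sum integral_cos_linform sq by simp
  qed
  have box: "emeasure (distr (gauss m) (Pi\<^sub>M P (\<lambda>_. borel)) ?X1) (Pi\<^sub>E P A) =
      emeasure (distr (gauss m') (Pi\<^sub>M P (\<lambda>_. borel)) ?X2) (Pi\<^sub>E P A)"
    if A: "\<And>p. p \<in> P \<Longrightarrow> A p \<in> sets borel" for A :: "'a \<Rightarrow> real set"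
  proof -
    have box1: "emeasure (distr (gauss m) (Pi\<^sub>M P (\<lambda>_. borel)) (\<lambda>\<omega>. \<lambda>p\<in>P. linform m (a p) \<omega>)) (Pi\<^sub>E P A) =
        ennreal (LINT \<omega>|gauss m. (\<Prod>p\<in>P. indicator (A p) (linform m (a p) \<omega>)))"
      for m and a :: "'a \<Rightarrow> nat \<Rightarrow> real"
    proof -
      interpret G: prob_space "gauss m" by (rule prob_space_gauss)
      let ?S = "{\<omega> \<in> space (gauss m). \<forall>p\<in>P. linform m (a p) \<omega> \<in> A p}"
      have S: "?S \<in> sets (gauss m)"
        using \<open>finite P\<close> A by (intro sets.sets_Collect_finite_All) (auto intro!: measurable_sets_Collect[of _ _ borel])
      have Xm: "(\<lambda>\<omega>. \<lambda>p\<in>P. linform m (a p) \<omega>) \<in> measurable (gauss m) (Pi\<^sub>M P (\<lambda>_. borel))"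
        by (auto intro!: measurable_restrict)
      have "emeasure (distr (gauss m) (Pi\<^sub>M P (\<lambda>_. borel)) (\<lambda>\<omega>. \<lambda>p\<in>P. linform m (a p) \<omega>)) (Pi\<^sub>E P A) =
          emeasure (gauss m) ?S"
        using A \<open>finite P\<close> by (subst emeasure_distr[OF Xm]) (auto intro!: sets_PiM_I_finite arg_cong[where f = "emeasure (gauss m)"] simp: PiE_iff)
      also have "\<dots> = ennreal (measure (gauss m) ?S)" by (rule G.emeasure_eq_measure)
      also have "measure (gauss m) ?S = (LINT \<omega>|gauss m. indicator ?S \<omega>)" using S by simp
      also have "\<dots> = (LINT \<omega>|gauss m. (\<Prod>p\<in>P. indicator (A p) (linform m (a p) \<omega>)))"
      proof (rule Bochner_Integration.integral_cong[OF refl])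
        fix \<omega> assume "\<omega> \<in> space (gauss m)"
        then show "indicator ?S \<omega> = (\<Prod>p\<in>P. indicator (A p) (linform m (a p) \<omega>) :: real)"
          using \<open>finite P\<close> by (auto simp: indicator_def)
      qed
      finally show ?thesis .
    qed
    have "(LINT \<omega>|gauss m. (\<Prod>p\<in>P. indicator (A p) (linform m (a p) \<omega>))) =
        (LINT \<omega>|gauss m'. (\<Prod>p\<in>P. indicator (A p) (linform m' (b p) \<omega>)) :: real)"
    proof -
      interpret R1: real_family "gauss m" "\<lambda>p. linform m (a p)" P A
        using prob_space_gauss \<open>finite P\<close> A by (intro real_family.intro real_family_axioms.intro) auto
      interpret R2: real_family "gauss m'" "\<lambda>p. linform m' (b p)" P A
        using prob_space_gauss \<open>finite P\<close> A by (intro real_family.intro real_family_axioms.intro) auto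
      have "R1.box_cos {} c t = R2.box_cos {} c t" for c t
        using cos[of c t] by (simp add: R1.box_cos_def R2.box_cos_def R1.box_def R2.box_def R1.phase_def R2.phase_def)
      from cos_functionals_determine_boxes[OF R1.real_family_axioms R2.real_family_axioms this subset_refl,
          of "\<lambda>_. 0" 0]
      show ?thesis
        by (simp add: R1.box_cos_def R2.box_cos_def R1.box_def R2.box_def R1.phase_def R2.phase_def)
    qed
    then show ?thesis unfolding box1 by simp
  qed
  have "distr (gauss m) (Pi\<^sub>M P (\<lambda>_. borel)) ?X1 = distr (gauss m') (Pi\<^sub>M P (\<lambda>_. borel)) ?X2"
  proof (rule measure_eqI_PiM_finite[OF \<open>finite P\<close>])
    show "range (\<lambda>_::nat. Pi\<^sub>E P (\<lambda>_. UNIV :: real set)) \<subseteq> prod_algebra P (\<lambda>_. borel)"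
      using \<open>finite P\<close> by (auto intro!: prod_algebraI_finite)
    show "emeasure (distr (gauss m) (Pi\<^sub>M P (\<lambda>_. borel)) ?X1) (Pi\<^sub>E P (\<lambda>_. UNIV)) \<noteq> \<infinity>" for i :: nat
      using X by (simp add: emeasure_distr G1.emeasure_eq_measure sets_PiM_I_finite \<open>finite P\<close>)
  qed (use box in \<open>auto simp: space_PiM\<close>)
  then have "measure (distr (gauss m) (Pi\<^sub>M P (\<lambda>_. borel)) ?X1) B = measure (distr (gauss m') (Pi\<^sub>M P (\<lambda>_. borel)) ?X2) B"
    by simp
  then show ?thesis using X B by (simp add: measure_distr vimage_def Int_def conj_commute)
qed

text \<open>One-variable case of \<open>gauss_law\<close>: the single coefficient
  \<open>sqrt v\<close> in dimension 1 has the same length as \<open>d\<close>.\<close>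

lemma linform_law:
  assumes v: "v = (\<Sum>j<m. (d j)\<^sup>2)" and A: "A \<in> sets borel"
  shows "measure (gauss m) {\<omega> \<in> space (gauss m). linform m d \<omega> \<in> A} =
    measure std_normal_distribution {x. sqrt v * x \<in> A}"
proof -
  have v0: "0 \<le> v" unfolding v by (intro sum_nonneg) auto
  let ?P = "Pi\<^sub>M {()} (\<lambda>_. borel :: real measure)"
  let ?B = "{x \<in> space ?P. x () \<in> A}"
  have B: "?B \<in> sets ?P"
  proof -
    have "(\<lambda>x. x ()) \<in> measurable ?P borel" by (rule measurable_component_singleton) simp
    then have "(\<lambda>x. x ()) -` A \<inter> space ?P \<in> sets ?P" using A by (rule measurable_sets)
    then show ?thesis by (simp add: vimage_def Int_def conj_commute)
  qed
  have "measure (gauss m) {\<omega> \<in> space (gauss m). (\<lambda>p\<in>{()}. linform m d \<omega>) \<in> ?B} =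
      measure (gauss 1) {\<omega> \<in> space (gauss 1). (\<lambda>p\<in>{()}. linform 1 (\<lambda>_. sqrt v) \<omega>) \<in> ?B}"
    by (rule gauss_law[where P = "{()}" and m = m and a = "\<lambda>_. d" and m' = 1 and b = "\<lambda>_ _. sqrt v", OF _ _ B])
       (use v0 in \<open>auto simp: v power2_eq_square[symmetric]\<close>)
  then have "measure (gauss m) {\<omega> \<in> space (gauss m). linform m d \<omega> \<in> A} =
      measure (gauss 1) {\<omega> \<in> space (gauss 1). sqrt v * \<omega> 0 \<in> A}"
    by (simp add: space_PiM linform_def)
  also have "\<dots> = measure (distr (gauss 1) std_normal_distribution (\<lambda>\<omega>. \<omega> 0)) {x. sqrt v * x \<in> A}"
  proof -
    have A': "{x. sqrt v * x \<in> A} \<in> sets borel"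
      using A measurable_sets_Collect[of "\<lambda>x. sqrt v * x" borel borel "\<lambda>x. x \<in> A"] by simp
    have "(\<lambda>\<omega>. \<omega> 0) \<in> measurable (gauss 1) std_normal_distribution"
      unfolding gauss_def by (intro measurable_component_singleton) auto
    then show ?thesis using A' by (subst measure_distr) (simp_all add: vimage_def Int_def conj_commute)
  qed
  also have "distr (gauss 1) std_normal_distribution (\<lambda>\<omega>. \<omega> 0) = std_normal_distribution"
  proof -
    interpret product_prob_space "\<lambda>_ :: nat. std_normal_distribution" "{..<1}"
      by (intro product_prob_spaceI prob_space_std_normal)
    show ?thesis unfolding gauss_def by (rule distr_PiM_component) (auto intro: prob_space_std_normal)
  qed
  finally show ?thesis .
qed

lemma linform_concentrated:
  assumes v: "v = (\<Sum>j<m. (d j)\<^sup>2)" and "0 < s"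
  shows "measure (gauss m) {\<omega> \<in> space (gauss m). s < \<bar>linform m d \<omega>\<bar>} \<le> v / s\<^sup>2"
proof -
  interpret N: prob_space std_normal_distribution by (rule prob_space_std_normal)
  have v0: "0 \<le> v" unfolding v by (intro sum_nonneg) auto
  have "measure (gauss m) {\<omega> \<in> space (gauss m). linform m d \<omega> \<in> {x. s < \<bar>x\<bar>}} =
    measure std_normal_distribution {x. sqrt v * x \<in> {x. s < \<bar>x\<bar>}}"
    by (rule linform_law[OF v]) simp
  also have "\<dots> \<le> measure std_normal_distribution {x \<in> space std_normal_distribution. s\<^sup>2 \<le> v * x\<^sup>2}"
  proof (intro N.finite_measure_mono)
    have "s\<^sup>2 \<le> v * x\<^sup>2" if "s < \<bar>sqrt v * x\<bar>" for x
    proof -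
      have "s\<^sup>2 \<le> \<bar>sqrt v * x\<bar>\<^sup>2" using that \<open>0 < s\<close> by (intro power_mono) auto
      then show ?thesis using v0 by (simp add: power_mult_distrib)
    qed
    then show "{x. sqrt v * x \<in> {x. s < \<bar>x\<bar>}} \<subseteq> {x \<in> space std_normal_distribution. s\<^sup>2 \<le> v * x\<^sup>2}" by auto
  qed simp
  also have "\<dots> \<le> (LINT x|std_normal_distribution. v * x\<^sup>2) / s\<^sup>2"
    using v0 \<open>0 < s\<close> std_normal_distribution_even_moments(2)[of 1]
    by (intro integral_Markov_inequality_measure[where A = "space std_normal_distribution"]) auto
  also have "(LINT x|std_normal_distribution. v * x\<^sup>2) = v"
    using std_normal_distribution_even_moments(1)[of 1] by simp
  finally show ?thesis by simp
qed

text \<open>The standard normal density is at most 1, and scaling by \<open>sqrt v \<ge> 1\<close>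
  only spreads the mass.\<close>

lemma linform_anticoncentrated:
  assumes v: "v = (\<Sum>j<m. (d j)\<^sup>2)" "1 \<le> v" and "0 \<le> s"
  shows "measure (gauss m) {\<omega> \<in> space (gauss m). \<bar>linform m d \<omega>\<bar> \<le> s} \<le> 2 * s"
proof -
  interpret N: prob_space std_normal_distribution by (rule prob_space_std_normal)
  have "measure (gauss m) {\<omega> \<in> space (gauss m). linform m d \<omega> \<in> {x. \<bar>x\<bar> \<le> s}} =
    measure std_normal_distribution {x. sqrt v * x \<in> {x. \<bar>x\<bar> \<le> s}}"
    by (rule linform_law[OF v(1)]) simp
  also have "\<dots> \<le> measure std_normal_distribution {- s .. s}"
  proof (intro N.finite_measure_mono)
    have "\<bar>x\<bar> \<le> s" if "\<bar>sqrt v * x\<bar> \<le> s" for x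
    proof -
      have "1 * \<bar>x\<bar> \<le> sqrt v * \<bar>x\<bar>" using v by (intro mult_right_mono) auto
      then show ?thesis using that v by (simp add: abs_mult)
    qed
    then have "x \<in> {- s .. s}" if "\<bar>sqrt v * x\<bar> \<le> s" for x
      using that unfolding atLeastAtMost_iff by (meson abs_le_D1 abs_le_D2 minus_le_iff)
    then show "{x. sqrt v * x \<in> {x. \<bar>x\<bar> \<le> s}} \<subseteq> {- s .. s}" by blast
  qed simp
  also have "\<dots> \<le> 2 * s"
  proof -
    have "emeasure std_normal_distribution {- s .. s} = (\<integral>\<^sup>+x. ennreal (std_normal_density x) * indicator {- s .. s} x \<partial>lborel)"
      by (simp add: emeasure_density)
    also have "\<dots> \<le> (\<integral>\<^sup>+x. 1 * indicator {- s .. s} x \<partial>lborel)"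
    proof (intro nn_integral_mono mult_right_mono)
      fix x :: real
      have "1 \<le> sqrt (2 * pi)" using pi_gt3 by (simp add: real_le_rsqrt)
      then have "std_normal_density x \<le> 1 / 1 * 1"
        unfolding std_normal_density_def by (intro mult_mono divide_left_mono) auto
      then show "ennreal (std_normal_density x) \<le> 1" by simp
    qed auto
    also have "\<dots> = ennreal (2 * s)" using \<open>0 \<le> s\<close> by simp
    finally show ?thesis using \<open>0 \<le> s\<close> by (simp add: N.emeasure_eq_measure)
  qed
  finally show ?thesis by simp
qed

section \<open>Labels from Gaussian variables\<close>

definition winner :: "nat \<Rightarrow> (nat \<Rightarrow> real) \<Rightarrow> nat" where
  "winner q x = (LEAST i. i < q \<and> (\<forall>j<q. x j \<le> x i))"

lemma winner:
  assumes "0 < q"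
  shows "winner q x < q" "\<And>j. j < q \<Longrightarrow> x j \<le> x (winner q x)"
proof -
  have "Max (x ` {..<q}) \<in> x ` {..<q}" using assms by (intro Max_in) auto
  then obtain i where i: "i < q" "x i = Max (x ` {..<q})" by auto
  then have "i < q \<and> (\<forall>j<q. x j \<le> x i)" using assms by auto
  then have *: "winner q x < q \<and> (\<forall>j<q. x j \<le> x (winner q x))" unfolding winner_def by (rule LeastI)
  then show "winner q x < q" "\<And>j. j < q \<Longrightarrow> x j \<le> x (winner q x)" by auto
qed

lemma winner_eqI:
  assumes "i < q" "\<And>j. j < q \<Longrightarrow> j \<noteq> i \<Longrightarrow> x j < x i"
  shows "winner q x = i"
proof (rule ccontr)
  assume "winner q x \<noteq> i"
  moreover have "0 < q" using assms(1) by simp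
  ultimately show False
    using assms winner[where q = q and x = x] by (metis not_le)
qed

lemma winner_cong: "(\<And>i. i < q \<Longrightarrow> x i = y i) \<Longrightarrow> winner q x = winner q y"
  unfolding winner_def by (intro arg_cong[where f = Least] ext) auto

lemma measurable_winner [measurable]:
  assumes [measurable]: "\<And>i. f i \<in> borel_measurable M"
  shows "(\<lambda>\<omega>. winner q (\<lambda>i. f i \<omega>)) \<in> measurable M (count_space UNIV)"
  unfolding winner_def by measurable

definition gauss_winner :: "nat \<Rightarrow> nat \<Rightarrow> ('v \<times> nat \<Rightarrow> nat \<Rightarrow> real) \<Rightarrow> 'v \<Rightarrow> (nat \<Rightarrow> real) \<Rightarrow> nat" where
  "gauss_winner q m a u \<omega> = winner q (\<lambda>i. linform m (a (u, i)) \<omega>)"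

lemma measurable_gauss_winner [measurable]: "gauss_winner q m a u \<in> measurable (gauss m) (count_space UNIV)"
  unfolding gauss_winner_def[abs_def] by measurable

text \<open>The labels are rotated by \<open>s\<close>; averaging over \<open>s\<close> makes each of them exactly uniform.\<close>

definition label_prob :: "nat \<Rightarrow> nat \<Rightarrow> ('v \<times> nat \<Rightarrow> nat \<Rightarrow> real) \<Rightarrow> nat \<Rightarrow> 'v set \<Rightarrow> ('v \<Rightarrow> nat) \<Rightarrow> real" where
  "label_prob q m a s S \<sigma> = measure (gauss m)
    {\<omega> \<in> space (gauss m). \<forall>u\<in>S. (gauss_winner q m a u \<omega> + s) mod q + 1 = \<sigma> u}"

lemma sets_label_event [measurable]:
  assumes "finite S"
  shows "{\<omega> \<in> space (gauss m). \<forall>u\<in>S. (gauss_winner q m a u \<omega> + s) mod q + 1 = \<sigma> u} \<in> sets (gauss m)"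
  using assms by (intro sets.sets_Collect_finite_All) auto

lemma label_prob_cong:
  assumes "finite S"
    and K: "\<And>p p'. p \<in> S \<times> {..<q} \<Longrightarrow> p' \<in> S \<times> {..<q} \<Longrightarrow> (\<Sum>j<m. a p j * a p' j) = (\<Sum>j<m'. b p j * b p' j)"
  shows "label_prob q m a s S \<sigma> = label_prob q m' b s S \<sigma>"
proof -
  let ?P = "S \<times> {..<q}"
  let ?M = "Pi\<^sub>M ?P (\<lambda>_. borel :: real measure)"
  \<comment> \<open>The winner is read off from the family restricted to
    \<open>S \<times> {..<q}\<close>, so the event is a measurable set of a finite product and
    \<open>gauss_law\<close> applies. The default 0 keeps the coordinates outside the product
    measurable.\<close>
  define win where "win u x = winner q (\<lambda>i. if i < q then x (u, i) else 0)" for u :: 'a and x :: "'a \<times> nat \<Rightarrow> real"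
  have win_measurable: "win u \<in> measurable ?M (count_space UNIV)" if "u \<in> S" for u
  proof -
    have "(\<lambda>x. if i < q then x (u, i) else 0) \<in> borel_measurable ?M" for i
      using that by (cases "i < q") auto
    then show ?thesis unfolding win_def[abs_def] by measurable
  qed
  let ?B = "{x \<in> space ?M. \<forall>u\<in>S. (win u x + s) mod q + 1 = \<sigma> u}"
  have B: "?B \<in> sets ?M"
  proof (rule sets.sets_Collect_finite_All[OF _ \<open>finite S\<close>])
    fix u assume "u \<in> S"
    from win_measurable[OF this] have [measurable]: "win u \<in> measurable ?M (count_space UNIV)" .
    show "{x \<in> space ?M. (win u x + s) mod q + 1 = \<sigma> u} \<in> sets ?M" by measurable
  qed
  have "label_prob q m a s S \<sigma> = measure (gauss m) {\<omega> \<in> space (gauss m). (\<lambda>p\<in>?P. linform m (a p) \<omega>) \<in> ?B}"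
    for m and a :: "'a \<times> nat \<Rightarrow> nat \<Rightarrow> real"
  proof -
    have "gauss_winner q m a u \<omega> = win u (\<lambda>p\<in>?P. linform m (a p) \<omega>)" if "u \<in> S" for u \<omega>
      unfolding gauss_winner_def win_def using that by (intro winner_cong) auto
    then show ?thesis unfolding label_prob_def by (simp add: space_PiM)
  qed
  then show ?thesis using gauss_law[OF _ K B] \<open>finite S\<close> by simp
qed

lemma label_prob_marginal:
  assumes "S \<subseteq> T" "finite T" "0 < q" "q \<le> k" "\<sigma> \<in> S \<rightarrow>\<^sub>E {1..k}"
  shows "label_prob q m a s S \<sigma> = (\<Sum>\<rho>\<in>{\<rho> \<in> T \<rightarrow>\<^sub>E {1..k}. restrict \<rho> S = \<sigma>}. label_prob q m a s T \<rho>)"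
proof -
  interpret prob_space "gauss m" by (rule prob_space_gauss)
  define L where "L \<omega> = (\<lambda>u\<in>T. (gauss_winner q m a u \<omega> + s) mod q + 1)" for \<omega>
  let ?R = "{\<rho> \<in> T \<rightarrow>\<^sub>E {1..k}. restrict \<rho> S = \<sigma>}"
  let ?E = "\<lambda>\<rho>. {\<omega> \<in> space (gauss m). \<forall>u\<in>T. (gauss_winner q m a u \<omega> + s) mod q + 1 = \<rho> u}"
  have fin: "finite ?R" using assms by (intro finite_subset[OF _ finite_PiE[of T "\<lambda>_. {1..k}"]]) auto
  have L: "L \<omega> \<in> T \<rightarrow>\<^sub>E {1..k}" for \<omega>
  proof -
    have "(gauss_winner q m a u \<omega> + s) mod q < k" for u
      using less_le_trans[OF mod_less_divisor[OF \<open>0 < q\<close>] \<open>q \<le> k\<close>] .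
    then show ?thesis by (auto simp: L_def Suc_le_eq)
  qed
  have E: "\<omega> \<in> ?E \<rho> \<longleftrightarrow> \<omega> \<in> space (gauss m) \<and> L \<omega> = \<rho>" if "\<rho> \<in> T \<rightarrow>\<^sub>E {1..k}" for \<rho> \<omega>
    using that by (auto simp: L_def PiE_iff extensional_def fun_eq_iff)
  have S: "(\<forall>u\<in>S. (gauss_winner q m a u \<omega> + s) mod q + 1 = \<sigma> u) \<longleftrightarrow> restrict (L \<omega>) S = \<sigma>" for \<omega>
    using assms by (auto simp: L_def PiE_iff extensional_def fun_eq_iff subset_iff)
  have "{\<omega> \<in> space (gauss m). \<forall>u\<in>S. (gauss_winner q m a u \<omega> + s) mod q + 1 = \<sigma> u} = (\<Union>\<rho>\<in>?R. ?E \<rho>)"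
  proof (intro set_eqI)
    fix \<omega>
    have "\<omega> \<in> (\<Union>\<rho>\<in>?R. ?E \<rho>) \<longleftrightarrow> (\<exists>\<rho>\<in>?R. \<omega> \<in> space (gauss m) \<and> L \<omega> = \<rho>)"
      unfolding UN_iff by (rule bex_cong[OF refl], rule E) blast
    also have "\<dots> \<longleftrightarrow> \<omega> \<in> space (gauss m) \<and> restrict (L \<omega>) S = \<sigma>" using L[of \<omega>] by simp
    finally show "\<omega> \<in> {\<omega> \<in> space (gauss m). \<forall>u\<in>S. (gauss_winner q m a u \<omega> + s) mod q + 1 = \<sigma> u} \<longleftrightarrow>
        \<omega> \<in> (\<Union>\<rho>\<in>?R. ?E \<rho>)" unfolding S[symmetric] by simp
  qed
  moreover have "disjoint_family_on ?E ?R"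
    unfolding disjoint_family_on_def
  proof (intro ballI impI)
    fix \<rho> \<rho>' assume \<rho>: "\<rho> \<in> ?R" "\<rho>' \<in> ?R" "\<rho> \<noteq> \<rho>'"
    show "?E \<rho> \<inter> ?E \<rho>' = {}"
    proof (rule ccontr)
      assume "?E \<rho> \<inter> ?E \<rho>' \<noteq> {}"
      then obtain \<omega> where "\<omega> \<in> ?E \<rho>" "\<omega> \<in> ?E \<rho>'" by blast
      then have "L \<omega> = \<rho>" "L \<omega> = \<rho>'" using E[of \<rho> \<omega>] E[of \<rho>' \<omega>] \<rho> by simp_all
      then show False using \<rho>(3) by simp
    qed
  qed
  moreover have "?E ` ?R \<subseteq> events" using sets_label_event[OF \<open>finite T\<close>] by auto
  ultimately show ?thesis
    unfolding label_prob_def using fin by (simp only: finite_measure_finite_Union)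
qed

text \<open>There are two kinds of bad events. Two variables at \<open>u\<close> may be within
  \<open>2 * \<eta>\<close> of each other: at most q^2 pairs, with probability at most
  \<open>4 * \<eta>\<close> each, as the difference has variance at least 1. Or a variable at
  \<open>v\<close> may be farther than \<open>\<eta>\<close> from its partner at \<open>u\<close>,
  which Chebyshev's inequality bounds. Otherwise the gap at the top survives two perturbations by
  \<open>\<eta>\<close>, and the winner moves up by 1.\<close>

lemma shift_prob_ge:
  assumes "0 < q" "0 < \<eta>"
    and diag: "\<And>i. i < q \<Longrightarrow> (\<Sum>j<m. (a (u, i) j)\<^sup>2) = 1" "\<And>i. i < q \<Longrightarrow> (\<Sum>j<m. (a (v, i) j)\<^sup>2) = 1"
    and half: "\<And>i i'. i < q \<Longrightarrow> i' < q \<Longrightarrow> i \<noteq> i' \<Longrightarrow> (\<Sum>j<m. a (u, i) j * a (u, i') j) \<le> 1 / 2"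
    and cor: "\<And>i. i < q \<Longrightarrow> c \<le> (\<Sum>j<m. a (u, i) j * a (v, Suc i mod q) j)"
  shows "1 - (4 * real q ^ 2 * \<eta> + real q * (2 - 2 * c) / \<eta>\<^sup>2) \<le>
    measure (gauss m) {\<omega> \<in> space (gauss m). gauss_winner q m a v \<omega> = Suc (gauss_winner q m a u \<omega>) mod q}"
    (is "_ \<le> measure _ ?G")
proof -
  interpret prob_space "gauss m" by (rule prob_space_gauss)
  let ?X = "\<lambda>p \<omega>. linform m (a p) \<omega>"
  let ?I = "{(i, i'). i < q \<and> i' < q \<and> i \<noteq> i'}"
  let ?B1 = "\<lambda>(i, i'). {\<omega> \<in> space (gauss m). \<bar>linform m (\<lambda>j. a (u, i) j - a (u, i') j) \<omega>\<bar> \<le> 2 * \<eta>}"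
  let ?B2 = "\<lambda>i. {\<omega> \<in> space (gauss m). \<eta> < \<bar>linform m (\<lambda>j. a (u, i) j - a (v, Suc i mod q) j) \<omega>\<bar>}"
  have I: "finite ?I" "card ?I \<le> q ^ 2"
  proof -
    have sub: "?I \<subseteq> {..<q} \<times> {..<q}" by auto
    show "finite ?I" using finite_subset[OF sub] by simp
    show "card ?I \<le> q ^ 2" using card_mono[OF _ sub] by (simp add: power2_eq_square)
  qed
  have lin: "linform m (\<lambda>j. d j - d' j) \<omega> = linform m d \<omega> - linform m d' \<omega>" for d d' \<omega>
    by (simp add: linform_def left_diff_distrib sum_subtractf)
  have sq: "(\<Sum>j<m. (d j - d' j)\<^sup>2) = (\<Sum>j<m. (d j)\<^sup>2) + (\<Sum>j<m. (d' j)\<^sup>2) - 2 * (\<Sum>j<m. d j * d' j)" for d d' :: "nat \<Rightarrow> real"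
    by (simp add: power2_diff sum.distrib sum_subtractf sum_distrib_left mult.assoc)
  have B1: "prob (?B1 i) \<le> 4 * \<eta>" if "i \<in> ?I" for i
  proof -
    obtain k l where kl: "i = (k, l)" "k < q" "l < q" "k \<noteq> l" using \<open>i \<in> ?I\<close> by auto
    have "1 \<le> (\<Sum>j<m. (a (u, k) j - a (u, l) j)\<^sup>2)"
      unfolding sq using diag(1)[OF kl(2)] diag(1)[OF kl(3)] half[OF kl(2,3,4)] by simp
    from linform_anticoncentrated[OF refl this, of "2 * \<eta>"] show ?thesis using \<open>0 < \<eta>\<close> kl by simp
  qed
  have B2: "prob (?B2 i) \<le> (2 - 2 * c) / \<eta>\<^sup>2" if "i < q" for i
  proof -
    have "(\<Sum>j<m. (a (u, i) j - a (v, Suc i mod q) j)\<^sup>2) \<le> 2 - 2 * c"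
      unfolding sq using diag(1)[OF that] diag(2)[of "Suc i mod q"] cor[OF that] \<open>0 < q\<close> by simp
    then have "(\<Sum>j<m. (a (u, i) j - a (v, Suc i mod q) j)\<^sup>2) / \<eta>\<^sup>2 \<le> (2 - 2 * c) / \<eta>\<^sup>2"
      by (intro divide_right_mono) auto
    with linform_concentrated[OF refl \<open>0 < \<eta>\<close>] show ?thesis by (rule order_trans)
  qed
  have sets1: "?B1 x \<in> events" for x by (cases x) simp
  have sets2: "?B2 i \<in> events" for i by simp
  have "space (gauss m) - ?G \<subseteq> (\<Union>i\<in>?I. ?B1 i) \<union> (\<Union>i<q. ?B2 i)"
  proof (rule ccontr)
    assume "\<not> ?thesis"
    then obtain \<omega> where \<omega>: "\<omega> \<in> space (gauss m)" "\<omega> \<notin> ?G" "\<And>i. i \<in> ?I \<Longrightarrow> \<omega> \<notin> ?B1 i" "\<And>i. i < q \<Longrightarrow> \<omega> \<notin> ?B2 i"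
      by blast
    define w where "w = gauss_winner q m a u \<omega>"
    have w: "w < q" "\<And>j. j < q \<Longrightarrow> ?X (u, j) \<omega> \<le> ?X (u, w) \<omega>"
      using winner[OF \<open>0 < q\<close>] by (auto simp: w_def gauss_winner_def)
    have gap: "?X (u, j) \<omega> + 2 * \<eta> < ?X (u, w) \<omega>" if "j < q" "j \<noteq> w" for j
      using \<omega>(3)[of "(w, j)"] \<omega>(1) w that by (auto simp: lin)
    have near: "\<bar>?X (u, j) \<omega> - ?X (v, Suc j mod q) \<omega>\<bar> \<le> \<eta>" if "j < q" for j
      using \<omega>(4)[OF that] \<omega>(1) by (auto simp: lin)
    have "gauss_winner q m a v \<omega> = Suc w mod q"
      unfolding gauss_winner_def
    proof (rule winner_eqI)
      fix j assume j: "j < q" "j \<noteq> Suc w mod q"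
      define i where "i = (if j = 0 then q - 1 else j - 1)"
      have i: "i < q" "j = Suc i mod q" using j \<open>0 < q\<close> by (auto simp: i_def)
      then have "i \<noteq> w" using j by auto
      then show "?X (v, j) \<omega> < ?X (v, Suc w mod q) \<omega>"
        using gap[OF i(1)] near[OF i(1)] near[OF w(1)] i(2) by auto
    qed (use \<open>0 < q\<close> in simp)
    then show False using \<omega>(1,2) by (simp add: w_def)
  qed
  then have "prob (space (gauss m) - ?G) \<le> prob ((\<Union>i\<in>?I. ?B1 i) \<union> (\<Union>i<q. ?B2 i))"
    using sets1 sets2 I(1) by (intro finite_measure_mono sets.Un sets.finite_UN) simp_all
  also have "\<dots> \<le> prob (\<Union>i\<in>?I. ?B1 i) + prob (\<Union>i<q. ?B2 i)"
    using sets1 sets2 I(1) by (intro measure_Un_le sets.finite_UN) simp_all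
  also have "\<dots> \<le> (\<Sum>i\<in>?I. prob (?B1 i)) + (\<Sum>i<q. prob (?B2 i))"
    using sets1 sets2 I(1) by (intro add_mono measure_UNION_le) blast+
  also have "\<dots> \<le> (\<Sum>i\<in>?I. 4 * \<eta>) + (\<Sum>i<q. (2 - 2 * c) / \<eta>\<^sup>2)"
    using B1 B2 by (intro add_mono sum_mono) simp_all
  also have "\<dots> \<le> 4 * real q ^ 2 * \<eta> + real q * (2 - 2 * c) / \<eta>\<^sup>2"
  proof -
    have "real (card ?I) \<le> real (q ^ 2)" using I(2) by (rule of_nat_mono)
    then have "real (card ?I) * (4 * \<eta>) \<le> real (q ^ 2) * (4 * \<eta>)" using \<open>0 < \<eta>\<close> by (intro mult_right_mono) auto
    then show ?thesis by (simp add: algebra_simps)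
  qed
  finally have "prob (space (gauss m) - ?G) \<le> 4 * real q ^ 2 * \<eta> + real q * (2 - 2 * c) / \<eta>\<^sup>2" .
  moreover have "?G \<in> events" by measurable
  then have "prob (space (gauss m) - ?G) = 1 - prob ?G" by (rule prob_compl)
  ultimately show ?thesis by simp
qed

text \<open>If the winner moves up by 1, the label increases unless \<open>u\<close> carries the
  last label \<open>q\<close>. For each outcome exactly one of the \<open>q\<close> rotations causes
  that, so averaging loses the fraction 1/q.\<close>

lemma averaged_ordering_ge:
  assumes "0 < q" "q \<le> k" "u \<noteq> v"
  shows "(1 - 1 / real q) *
      measure (gauss m) {\<omega> \<in> space (gauss m). gauss_winner q m a v \<omega> = Suc (gauss_winner q m a u \<omega>) mod q}
    \<le> (\<Sum>i\<in>{1..k}. \<Sum>j\<in>{i<..k}. (\<Sum>s<q. label_prob q m a s {u, v} (\<lambda>x\<in>{u, v}. if x = u then i else j)) / real q)"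
proof -
  interpret prob_space "gauss m" by (rule prob_space_gauss)
  let ?wu = "gauss_winner q m a u" and ?wv = "gauss_winner q m a v"
  let ?G = "{\<omega> \<in> space (gauss m). ?wv \<omega> = Suc (?wu \<omega>) mod q}"
  let ?last = "\<lambda>s. {\<omega> \<in> space (gauss m). ?wv \<omega> = Suc (?wu \<omega>) mod q \<and> (?wu \<omega> + s) mod q = q - 1}"
  let ?T = "{(i, j). i \<in> {1..k} \<and> j \<in> {i<..k}}"
  have T: "?T = Sigma {1..k} (\<lambda>i. {i<..k})" by auto
  have step: "prob ?G - prob (?last s) \<le>
      (\<Sum>i\<in>{1..k}. \<Sum>j\<in>{i<..k}. label_prob q m a s {u, v} (\<lambda>x\<in>{u, v}. if x = u then i else j))" for s
  proof -
    let ?E = "\<lambda>(i, j). {\<omega> \<in> space (gauss m). (?wu \<omega> + s) mod q + 1 = i \<and> (?wv \<omega> + s) mod q + 1 = j}"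
    have E: "?E x \<in> events" for x by (cases x) simp
    have "prob ?G - prob (?last s) = prob (?G - ?last s)"
      by (subst finite_measure_Diff) auto
    also have "\<dots> \<le> prob (\<Union>x\<in>?T. ?E x)"
    proof (rule finite_measure_mono)
      show "?G - ?last s \<subseteq> (\<Union>x\<in>?T. ?E x)"
      proof
        fix \<omega> assume \<omega>: "\<omega> \<in> ?G - ?last s"
        define i where "i = (?wu \<omega> + s) mod q"
        have "i < q" "i \<noteq> q - 1" using \<omega> \<open>0 < q\<close> by (auto simp: i_def)
        then have "Suc i < q" by linarith
        have "(?wv \<omega> + s) mod q = (Suc (?wu \<omega>) + s) mod q" using \<omega> by (simp add: mod_add_left_eq)
        also have "\<dots> = Suc i mod q" by (simp add: i_def mod_Suc_eq)
        also have "\<dots> = Suc i" using \<open>Suc i < q\<close> by simp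
        finally have in_E: "\<omega> \<in> ?E (Suc i, Suc (Suc i))" using \<omega> by (auto simp: i_def)
        have "(Suc i, Suc (Suc i)) \<in> ?T" using \<open>Suc i < q\<close> \<open>q \<le> k\<close> by auto
        from this in_E show "\<omega> \<in> (\<Union>x\<in>?T. ?E x)" by (rule UN_I)
      qed
      show "(\<Union>x\<in>?T. ?E x) \<in> events" using E unfolding T by (intro sets.finite_UN) auto
    qed
    also have "\<dots> \<le> (\<Sum>x\<in>?T. prob (?E x))"
      using E unfolding T by (intro measure_UNION_le) auto
    also have "\<dots> = (\<Sum>i\<in>{1..k}. \<Sum>j\<in>{i<..k}. prob (?E (i, j)))"
      unfolding T by (subst sum.Sigma) (auto intro!: sum.cong)
    also have "\<dots> = (\<Sum>i\<in>{1..k}. \<Sum>j\<in>{i<..k}. label_prob q m a s {u, v} (\<lambda>x\<in>{u, v}. if x = u then i else j))"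
      unfolding label_prob_def using \<open>u \<noteq> v\<close> by (intro sum.cong refl arg_cong[where f = prob]) auto
    finally show ?thesis .
  qed
  have "(\<Sum>s<q. prob (?last s)) = prob (\<Union>s<q. ?last s)"
  proof (rule finite_measure_finite_Union[symmetric])
    have le: "s = t" if "(x + s) mod q = (x + t) mod q" "t < q" "s \<le> t" for x s t :: nat
    proof -
      have "q dvd t - s" using mod_eq_dvd_iff_nat[of "x + s" "x + t" q] that by simp
      then show ?thesis using that nat_dvd_not_less[of "t - s" q] by fastforce
    qed
    have eq: "s = t" if "(x + s) mod q = (x + t) mod q" "s < q" "t < q" for x s t :: nat
      using le[of x s t] le[of x t s] that by (cases "s \<le> t") auto
    show "disjoint_family_on ?last {..<q}"
      unfolding disjoint_family_on_def
    proof (intro ballI impI)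
      fix s t assume st: "s \<in> {..<q}" "t \<in> {..<q}" "s \<noteq> t"
      show "?last s \<inter> ?last t = {}"
      proof (rule ccontr)
        assume "?last s \<inter> ?last t \<noteq> {}"
        then obtain \<omega> where "\<omega> \<in> ?last s" "\<omega> \<in> ?last t" by blast
        then have "(?wu \<omega> + s) mod q = (?wu \<omega> + t) mod q" by simp
        then show False using eq st by blast
      qed
    qed
  qed auto
  also have "\<dots> \<le> prob ?G" by (intro finite_measure_mono) auto
  finally have last: "(\<Sum>s<q. prob (?last s)) \<le> prob ?G" .
  have "(1 - 1 / real q) * prob ?G = (real q * prob ?G - prob ?G) / real q"
    using \<open>0 < q\<close> by (simp add: field_simps)
  also have "\<dots> \<le> (\<Sum>s<q. prob ?G - prob (?last s)) / real q"
    using last by (intro divide_right_mono) (auto simp: sum_subtractf)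
  also have "\<dots> \<le> (\<Sum>s<q. \<Sum>i\<in>{1..k}. \<Sum>j\<in>{i<..k}. label_prob q m a s {u, v} (\<lambda>x\<in>{u, v}. if x = u then i else j)) / real q"
    by (intro divide_right_mono sum_mono step) auto
  also have "\<dots> = (\<Sum>i\<in>{1..k}. \<Sum>j\<in>{i<..k}. (\<Sum>s<q. label_prob q m a s {u, v} (\<lambda>x\<in>{u, v}. if x = u then i else j)) / real q)"
    by (subst sum.swap, subst sum_divide_distrib, intro sum.cong refl,
        subst sum.swap, subst sum_divide_distrib) simp
  finally show ?thesis .
qed

section \<open>Local covariances on the cyclic cover\<close>

text \<open>The cover of the underlying graph with fibres \<open>\<int>/q\<close>, an arc raising the fibre
  coordinate by \<open>1\<close>.\<close>

definition lift :: "'v rel \<Rightarrow> nat \<Rightarrow> 'v \<times> nat \<Rightarrow> 'v \<times> nat \<Rightarrow> bool" where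
  "lift E q p p' \<longleftrightarrow> snd p < q \<and> snd p' < q \<and>
    ((fst p, fst p') \<in> E \<and> snd p' = Suc (snd p) mod q \<or> (fst p', fst p) \<in> E \<and> snd p = Suc (snd p') mod q)"

locale sparse_digraph =
  fixes E :: "'v rel" and V :: "'v set" and g t :: nat
  assumes finV: "finite V" and EV: "E \<subseteq> V \<times> V"
    and asym: "\<And>u v. (u, v) \<in> E \<Longrightarrow> u \<noteq> v \<and> (v, u) \<notin> E"
    and girth: "\<And>l y. l \<le> g \<Longrightarrow> (\<And>i. i < l \<Longrightarrow> adjacent E (y i) (y (Suc i))) \<Longrightarrow>
      (\<And>i. i + 2 \<le> l \<Longrightarrow> y i \<noteq> y (i + 2)) \<Longrightarrow> inj_on y {..l}"
    and sparse: "\<And>U. U \<subseteq> V \<Longrightarrow> U \<noteq> {} \<Longrightarrow> card U \<le> t \<Longrightarrow>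
      6 * g * card (E \<inter> U \<times> U) < (6 * g + 1) * card U"
begin

lemma lift_sym: "lift E q p p' \<Longrightarrow> lift E q p' p"
  by (auto simp: lift_def)

lemma lift_irrefl: "\<not> lift E q p p"
  using asym by (auto simp: lift_def)

lemma lift_adjacent: "lift E q p p' \<Longrightarrow> adjacent E (fst p) (fst p')"
  by (auto simp: lift_def adjacent_def)

text \<open>By asymmetry a base edge carries only one arc, and its direction decides whether the
  fibre coordinate moves up or down.\<close>

lemma lift_local_inj:
  assumes "lift E q p p'" "lift E q p p''" "fst p' = fst p''"
  shows "p' = p''"
proof -
  have inj: "s = t" if "Suc s mod q = Suc t mod q" "s < q" "t < q" for s t
    using that by (auto simp: mod_Suc split: if_splits)
  have "snd p' = snd p''"
  proof (cases "(fst p, fst p') \<in> E")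
    case True
    then have "(fst p', fst p) \<notin> E" using asym by blast
    then show ?thesis using assms True by (simp add: lift_def)
  next
    case False
    then show ?thesis using assms by (auto simp: lift_def intro: inj)
  qed
  then show ?thesis using assms(3) by (simp add: prod_eq_iff)
qed

text \<open>The sum of the degrees counts every arc inside \<open>U\<close> twice, which turns the
  bound on arcs into one on the excess of the degrees over 2. The density bound for \<open>g\<close>
  implies the weaker one for \<open>m \<le> g\<close>.\<close>

lemma degree_excess_small:
  assumes U: "U \<subseteq> V" "U \<noteq> {}" "card U \<le> t" and deg: "\<And>v. v \<in> U \<Longrightarrow> 2 \<le> card (nbrs (adjacent E) U v)"
    and "m \<le> g"
  shows "3 * m * (\<Sum>v\<in>U. card (nbrs (adjacent E) U v) - 2) < card U"
proof -
  have fin: "finite U" using U finV finite_subset by blast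
  have finE: "finite (E \<inter> U \<times> U)" using fin by simp
  have "(\<Sum>v\<in>U. card (nbrs (adjacent E) U v)) \<le> (\<Sum>v\<in>U. card {w \<in> U. (v, w) \<in> E} + card {w \<in> U. (w, v) \<in> E})"
  proof (rule sum_mono)
    fix v
    have "nbrs (adjacent E) U v = {w \<in> U. (v, w) \<in> E} \<union> {w \<in> U. (w, v) \<in> E}"
      by (auto simp: nbrs_def adjacent_def)
    then show "card (nbrs (adjacent E) U v) \<le> card {w \<in> U. (v, w) \<in> E} + card {w \<in> U. (w, v) \<in> E}"
      by (simp add: card_Un_le)
  qed
  also have "\<dots> = (\<Sum>v\<in>U. card {w \<in> U. (v, w) \<in> E}) + (\<Sum>v\<in>U. card {w \<in> U. (w, v) \<in> E})"
    by (rule sum.distrib)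
  also have "(\<Sum>v\<in>U. card {w \<in> U. (v, w) \<in> E}) = card (SIGMA v:U. {w \<in> U. (v, w) \<in> E})"
    using fin by (subst card_SigmaI) auto
  also have "(SIGMA v:U. {w \<in> U. (v, w) \<in> E}) = E \<inter> U \<times> U" by auto
  also have "(\<Sum>v\<in>U. card {w \<in> U. (w, v) \<in> E}) = card (SIGMA v:U. {w \<in> U. (w, v) \<in> E})"
    using fin by (subst card_SigmaI) auto
  also have "(SIGMA v:U. {w \<in> U. (w, v) \<in> E}) = (E \<inter> U \<times> U)\<inverse>" by auto
  also have "card ((E \<inter> U \<times> U)\<inverse>) = card (E \<inter> U \<times> U)" by (rule card_inverse)
  finally have sum: "(\<Sum>v\<in>U. card (nbrs (adjacent E) U v)) \<le> 2 * card (E \<inter> U \<times> U)" by simp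
  have "(\<Sum>v\<in>U. card (nbrs (adjacent E) U v) - 2) + 2 * card U = (\<Sum>v\<in>U. (card (nbrs (adjacent E) U v) - 2) + 2)"
    by (subst sum.distrib) simp
  also have "\<dots> = (\<Sum>v\<in>U. card (nbrs (adjacent E) U v))"
    by (intro sum.cong refl le_add_diff_inverse2 deg)
  finally have "(\<Sum>v\<in>U. card (nbrs (adjacent E) U v) - 2) + 2 * card U \<le> 2 * card (E \<inter> U \<times> U)"
    using sum by simp
  then have "3 * m * ((\<Sum>v\<in>U. card (nbrs (adjacent E) U v) - 2) + 2 * card U) \<le> 3 * m * (2 * card (E \<inter> U \<times> U))"
    by (rule mult_left_mono) simp
  \<comment> \<open>Replacing \<open>g\<close> by a smaller \<open>m\<close> is harmless if there is
    an excess of arcs; without an excess the inequality holds for every \<open>m\<close>.\<close>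
  moreover have "6 * m * card (E \<inter> U \<times> U) < (6 * m + 1) * card U"
  proof (cases "card (E \<inter> U \<times> U) \<le> card U")
    case True
    then have "6 * m * card (E \<inter> U \<times> U) \<le> 6 * m * card U" by (rule mult_left_mono) simp
    also have "\<dots> < (6 * m + 1) * card U" using fin U by (simp add: card_gt_0_iff algebra_simps)
    finally show ?thesis .
  next
    case False
    then obtain d where d: "card (E \<inter> U \<times> U) = card U + d" by (metis le_add_diff_inverse nat_le_linear)
    have "6 * g * d < card U" using sparse[OF U] unfolding d by (simp add: algebra_simps)
    moreover have "6 * m * d \<le> 6 * g * d" using \<open>m \<le> g\<close> by simp
    ultimately have "6 * m * d < card U" by (rule le_less_trans[rotated])
    then show ?thesis unfolding d by (simp add: algebra_simps)
  qed
  ultimately show ?thesis by (simp add: algebra_simps)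
qed

lemma lift_buildable:
  assumes "0 < h" "2 * h + 1 \<le> g" "finite W" "fst ` W \<subseteq> V" "card W \<le> t"
  shows "buildable (lift E q) h W"
proof (rule buildable_cover[where A = "adjacent E" and \<pi> = fst and V = V and t = t])
  show "inj_on y {..2 * h + 1}"
    if "\<And>i. adjacent E (y i) (y (Suc i))" "\<And>i. y i \<noteq> y (i + 2)" for y
    using girth[OF assms(2), of y] that by blast
  show "3 * (2 * h + 1) * (\<Sum>v\<in>U. card (nbrs (adjacent E) U v) - 2) < card U"
    if "finite U" "U \<noteq> {}" "U \<subseteq> V" "card U \<le> t" "\<And>v. v \<in> U \<Longrightarrow> 2 \<le> card (nbrs (adjacent E) U v)" for U
    using degree_excess_small[OF that(3,2,4,5) assms(2)] .
qed (use assms lift_sym lift_adjacent lift_local_inj in \<open>auto simp: adjacent_def\<close>)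

text \<open>A shortest walk between two points of a fibre projects to a closed walk. The projection
  does not backtrack: by \<open>lift_local_inj\<close> a backtrack below is a backtrack above and
  could be cut out. So the length exceeds the girth bound, and the variables at one vertex are
  almost uncorrelated.\<close>

lemma fibre_distance:
  assumes "(p, p') \<in> induced (lift E q) W ^^ n" "fst p = fst p'" "p \<noteq> p'"
  shows "g < n"
proof (rule ccontr)
  assume "\<not> g < n"
  define l where "l = (LEAST l. (p, p') \<in> induced (lift E q) W ^^ l)"
  have l: "(p, p') \<in> induced (lift E q) W ^^ l" unfolding l_def by (rule LeastI) (rule assms(1))
  have "l \<le> n" unfolding l_def by (rule Least_le) (rule assms(1))
  then have "l \<le> g" using \<open>\<not> g < n\<close> by simp
  obtain f where f: "f 0 = p" "f l = p'" "\<And>i. i < l \<Longrightarrow> (f i, f (Suc i)) \<in> induced (lift E q) W"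
    using l unfolding relpow_fun_conv by blast
  have adj: "lift E q (f i) (f (Suc i))" if "i < l" for i
    using f(3)[OF that] by (simp add: induced_def)
  have nb: "fst (f i) \<noteq> fst (f (i + 2))" if "i + 2 \<le> l" for i
  proof
    assume "fst (f i) = fst (f (i + 2))"
    then have eq: "f i = f (i + 2)"
      using lift_local_inj[OF lift_sym[OF adj[of i]] adj[of "Suc i"]] that by auto
    define f' where "f' k = (if k \<le> i then f k else f (k + 2))" for k
    have "(p, p') \<in> induced (lift E q) W ^^ (l - 2)"
      unfolding relpow_fun_conv
    proof (intro exI[of _ f'] conjI allI impI)
      show "f' 0 = p" using f by (simp add: f'_def)
      have "l - 2 = i" if "l - 2 \<le> i" using that \<open>i + 2 \<le> l\<close> by simp
      moreover have "l - 2 + 2 = l" using \<open>i + 2 \<le> l\<close> by simp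
      ultimately show "f' (l - 2) = p'" using f(2) eq unfolding f'_def by metis
      show "(f' k, f' (Suc k)) \<in> induced (lift E q) W" if k: "k < l - 2" for k
      proof (cases "k = i")
        case True
        then show ?thesis using f(3)[of "i + 2"] eq k by (simp add: f'_def)
      next
        case False
        then show ?thesis using f(3)[of k] f(3)[of "k + 2"] k by (auto simp: f'_def)
      qed
    qed
    then have "l \<le> l - 2" unfolding l_def by (rule Least_le)
    then show False using that by simp
  qed
  have "inj_on (\<lambda>i. fst (f i)) {..l}"
    using \<open>l \<le> g\<close> adj nb by (intro girth) (auto intro: lift_adjacent)
  moreover have "fst (f 0) = fst (f l)" using f assms(2) by simp
  ultimately have "l = 0" by (auto dest: inj_onD)
  then show False using f assms(3) by simp
qed

text \<open>Adding short geodesics to \<open>S \<times> {..<q}\<close> makes distances inside the resulting set agree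
  with the global ones; \<open>\<tau>\<close> pays for the remaining errors.\<close>

lemma gram_local:
  fixes \<rho> \<tau> :: real
  assumes rho: "0 < \<rho>" "\<rho> < 1" and h: "0 < h" "2 * h + 1 \<le> g"
    and S: "S \<subseteq> V" and N: "2 * (card S * q)\<^sup>2 * (h + 1) \<le> t" and \<tau>: "5 * real t ^ 2 * \<rho> ^ h \<le> \<tau>"
  shows "gram (S \<times> {..<q}) (\<lambda>p p'. if p = p' then 1 else dist_kernel \<rho> (lift E q) (V \<times> {..<q}) p p' / (1 + \<tau>))"
proof -
  interpret kernel_graph \<rho> "lift E q"
    using rho lift_sym lift_irrefl by unfold_locales auto
  let ?F = "V \<times> {..<q}" and ?P = "S \<times> {..<q}"
  let ?R = "induced (lift E q) ?F"
  have finS: "finite S" using S finV finite_subset by blast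
  have finP: "finite ?P" using finS by simp
  \<comment> \<open>Geodesics are added only for distances up to \<open>h\<close>; beyond that the
    kernel is at most \<open>\<rho> ^ h\<close>, which the error bound tolerates.\<close>
  have "\<exists>Z. finite Z \<and> card Z \<le> h + 1 \<and> Z \<subseteq> ?F \<and> (\<forall>n. (p, p') \<in> ?R ^^ n \<longrightarrow> n \<le> h \<longrightarrow>
      (\<exists>n'\<le>n. (p, p') \<in> induced (lift E q) Z ^^ n'))" if pp: "p \<in> ?P" "p' \<in> ?P" for p p'
  proof (cases "\<exists>n\<le>h. (p, p') \<in> ?R ^^ n")
    case False
    then show ?thesis by (intro exI[of _ "{}"]) auto
  next
    case True
    define l where "l = (LEAST l. (p, p') \<in> ?R ^^ l)"
    obtain n where n: "n \<le> h" "(p, p') \<in> ?R ^^ n" using True by blast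
    have l: "(p, p') \<in> ?R ^^ l" unfolding l_def by (rule LeastI) (rule n(2))
    have le: "l \<le> n" if "(p, p') \<in> ?R ^^ n" for n unfolding l_def using that by (rule Least_le)
    have "l \<le> h" using n le[OF n(2)] by simp
    obtain f where f: "f 0 = p" "f l = p'" "\<And>i. i < l \<Longrightarrow> (f i, f (Suc i)) \<in> ?R"
      using l unfolding relpow_fun_conv by blast
    let ?Z = "f ` {..l}"
    have "card ?Z \<le> h + 1" using card_image_le[of "{..l}" f] \<open>l \<le> h\<close> by simp
    moreover have "?Z \<subseteq> ?F"
    proof
      fix z assume "z \<in> ?Z"
      then obtain i where i: "i \<le> l" "z = f i" by auto
      then show "z \<in> ?F"
        using f(2) f(3)[of i] pp S by (cases "i < l") (auto simp: induced_def)
    qed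
    moreover have "(p, p') \<in> induced (lift E q) ?Z ^^ l"
      unfolding relpow_fun_conv using f by (intro exI[of _ f]) (auto simp: induced_def)
    ultimately show ?thesis using le by (intro exI[of _ ?Z]) auto
  qed
  then obtain Z where Z: "\<And>p p'. p \<in> ?P \<Longrightarrow> p' \<in> ?P \<Longrightarrow> finite (Z p p') \<and> card (Z p p') \<le> h + 1 \<and> Z p p' \<subseteq> ?F \<and>
      (\<forall>n. (p, p') \<in> ?R ^^ n \<longrightarrow> n \<le> h \<longrightarrow> (\<exists>n'\<le>n. (p, p') \<in> induced (lift E q) (Z p p') ^^ n'))"
    by metis
  define W where "W = ?P \<union> (\<Union>x\<in>?P \<times> ?P. Z (fst x) (snd x))"
  have PW: "?P \<subseteq> W" by (auto simp: W_def)
  have ZW: "Z p p' \<subseteq> W" if "p \<in> ?P" "p' \<in> ?P" for p p'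
    unfolding W_def using that by force
  have WF: "W \<subseteq> ?F" using Z S unfolding W_def by fastforce
  have finW: "finite W" using WF finV finite_subset by blast
  have cardP: "card ?P = card S * q" by (simp add: card_cartesian_product)
  have cardW: "card W \<le> t"
  proof -
    have "card W \<le> card ?P + card (\<Union>x\<in>?P \<times> ?P. Z (fst x) (snd x))" unfolding W_def by (rule card_Un_le)
    also have "card (\<Union>x\<in>?P \<times> ?P. Z (fst x) (snd x)) \<le> (\<Sum>x\<in>?P \<times> ?P. card (Z (fst x) (snd x)))"
      using finP by (intro card_UN_le) auto
    also have "\<dots> \<le> (\<Sum>x\<in>?P \<times> ?P. h + 1)" using Z by (intro sum_mono) auto
    also have "\<dots> = (card S * q)\<^sup>2 * (h + 1)"
      by (simp add: card_cartesian_product power2_eq_square)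
    finally have "card W \<le> card ?P + (card S * q)\<^sup>2 * (h + 1)" by simp
    also have "card ?P \<le> (card S * q)\<^sup>2 * (h + 1)"
      unfolding cardP using self_le_power[of "card S * q" 2]
      by (cases "card S * q = 0") (auto intro: order_trans[of _ "(card S * q)\<^sup>2"])
    finally show ?thesis using N by simp
  qed
  have "buildable (lift E q) h W"
    using WF by (intro lift_buildable h finW cardW) auto
  from approx_buildable[OF this] obtain K where K: "gram W K" "\<And>u. u \<in> W \<Longrightarrow> K u u = 1"
    "\<And>u v. u \<in> W \<Longrightarrow> v \<in> W \<Longrightarrow> \<bar>K u v - dk W u v\<bar> \<le> 4 * real (card W) * \<rho> ^ h"
    by blast
  have local_global: "\<bar>dk W p p' - dk ?F p p'\<bar> \<le> \<rho> ^ h" if pp: "p \<in> ?P" "p' \<in> ?P" for p p'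
  proof -
    have "dk ?F p p' \<le> max (dk W p p') (\<rho> ^ h)"
    proof (rule dk_le)
      fix n assume n: "(p, p') \<in> ?R ^^ n"
      show "\<rho> ^ n \<le> max (dk W p p') (\<rho> ^ h)"
      proof (cases "n \<le> h")
        case True
        then obtain n' where n': "n' \<le> n" "(p, p') \<in> induced (lift E q) (Z p p') ^^ n'"
          using Z[OF pp] n by blast
        then have "(p, p') \<in> induced (lift E q) W ^^ n'"
          using induced_mono[OF ZW[OF pp]] unfolding relpow_fun_conv by blast
        then have "\<rho> ^ n' \<le> dk W p p'" by (rule dk_ge)
        moreover have "\<rho> ^ n \<le> \<rho> ^ n'" using n' rho by (intro power_decreasing) auto
        ultimately show ?thesis by simp
      next
        case False
        then have "\<rho> ^ n \<le> \<rho> ^ h" using rho by (intro power_decreasing) auto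
        then show ?thesis by simp
      qed
    qed (use dk_nonneg in \<open>auto simp: le_max_iff_disj\<close>)
    then show ?thesis using dk_mono[OF WF, of p p'] dk_nonneg[of W p p'] rho_power(1)[of h]
      by (auto simp: max_def abs_le_iff split: if_splits)
  qed
  have \<tau>0: "0 \<le> \<tau>" using \<tau> rho by (meson mult_nonneg_nonneg order_trans zero_le_numeral zero_le_power of_nat_0_le_iff less_imp_le)
  \<comment> \<open>What separates the global kernel from the covariance built on \<open>W\<close>.
    The construction contributes 4 and the passage from \<open>W\<close> to the whole cover 1 to the
    factor 5.\<close>
  define D where "D p p' = dk ?F p p' - K p p'" for p p'
  have D: "\<bar>D p p'\<bar> \<le> 5 * real t * \<rho> ^ h" if pp: "p \<in> ?P" "p' \<in> ?P" for p p'
  proof -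
    have "1 \<le> card W" using pp PW finW by (metis card_0_eq empty_iff less_one not_le subsetD)
    then have "1 * \<rho> ^ h \<le> real (card W) * \<rho> ^ h" using rho by (intro mult_right_mono) auto
    moreover have "\<bar>K p p' - dk W p p'\<bar> \<le> 4 * (real (card W) * \<rho> ^ h)" using K(3)[OF subsetD[OF PW pp(1)] subsetD[OF PW pp(2)]] by (simp only: mult.assoc)
    ultimately have "\<bar>D p p'\<bar> \<le> 5 * (real (card W) * \<rho> ^ h)"
      using local_global[OF pp] unfolding D_def by linarith
    also have "\<dots> \<le> 5 * (real t * \<rho> ^ h)"
      using cardW rho by (intro mult_left_mono mult_right_mono) auto
    finally show ?thesis by (simp add: mult.assoc)
  qed
  have "gram ?P (\<lambda>p p'. if p = p' then \<tau> else D p p')"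
  proof (rule gram_diagonally_dominant[OF finP])
    show "D p p' = D p' p" if "p \<in> ?P" "p' \<in> ?P" for p p'
      using gram_sym[OF K(1) subsetD[OF PW that(1)] subsetD[OF PW that(2)]] dk_sym[of ?F p p']
      by (simp add: D_def)
    show "(\<Sum>p'\<in>?P - {p}. \<bar>D p p'\<bar>) \<le> \<tau>" if "p \<in> ?P" for p
    proof -
      have "(\<Sum>p'\<in>?P - {p}. \<bar>D p p'\<bar>) \<le> (\<Sum>p'\<in>?P - {p}. 5 * real t * \<rho> ^ h)"
        using D that by (intro sum_mono) auto
      also have "\<dots> \<le> (\<Sum>p'\<in>?P. 5 * real t * \<rho> ^ h)"
        using finP rho by (intro sum_mono2) auto
      also have "\<dots> = real (card ?P) * (5 * real t * \<rho> ^ h)" by simp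
      also have "\<dots> \<le> real t * (5 * real t * \<rho> ^ h)"
        using card_mono[OF finW PW] cardW rho by (intro mult_right_mono) auto
      also have "\<dots> \<le> \<tau>" using \<tau> by (simp add: power2_eq_square mult_ac)
      finally show ?thesis .
    qed
  qed
  \<comment> \<open>Adding \<open>D\<close> makes the off-diagonal entries exactly the global ones,
    the same for every \<open>S\<close>; \<open>\<tau>\<close> on the diagonal keeps the matrix
    positive semidefinite, and division by \<open>1 + \<tau>\<close> brings the variances back to
    1.\<close>
  from gram_add[OF gram_subset[OF K(1) PW] this]
  have "gram ?P (\<lambda>p p'. inverse (1 + \<tau>) * (K p p' + (if p = p' then \<tau> else D p p')))"
    using \<tau>0 by (intro gram_scale) auto
  then show ?thesis
    by (rule gram_cong) (use K(2) PW \<tau>0 in \<open>auto simp: D_def divide_inverse mult.commute\<close>)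
qed

end

section \<open>The Sherali-Adams solution\<close>

text \<open>Representing vectors are chosen for every small set separately. The resulting label
  distributions agree on subsets because all of them represent the same kernel \<open>M\<close>, and
  the laws depend on nothing else.\<close>

lemma sa_opt_ge_of_local_gram:
  fixes D :: "'v pair_pre_digraph"
  assumes D: "pair_digraph D" "parcs D \<noteq> {}" and r: "1 \<le> r" and q: "0 < q" "q \<le> k" and \<eta>: "0 < \<eta>"
    and gram: "\<And>S. S \<subseteq> pverts D \<Longrightarrow> card S \<le> r + 1 \<Longrightarrow> gram (S \<times> {..<q}) M"
    and diag: "\<And>p. M p p = 1"
    and half: "\<And>u i i'. u \<in> pverts D \<Longrightarrow> i < q \<Longrightarrow> i' < q \<Longrightarrow> i \<noteq> i' \<Longrightarrow> M (u, i) (u, i') \<le> 1 / 2"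
    and cor: "\<And>u v i. (u, v) \<in> parcs D \<Longrightarrow> i < q \<Longrightarrow> c \<le> M (u, i) (v, Suc i mod q)"
  shows "(1 - 1 / real q) * (1 - (4 * real q ^ 2 * \<eta> + real q * (2 - 2 * c) / \<eta>\<^sup>2)) \<le> ordering_sa_opt r k D (\<lambda>_. 1)"
proof -
  interpret pair_digraph D by (rule D(1))
  let ?V = "pverts D" and ?E = "parcs D"
  have finS: "finite S" if "S \<subseteq> ?V" for S using that pair_finite_verts finite_subset by blast
  have arc: "u \<in> ?V" "v \<in> ?V" "u \<noteq> v" "{u, v} \<subseteq> ?V" "card {u, v} \<le> r + 1" if "(u, v) \<in> ?E" for u v
    using in_arcsD1[OF that] in_arcsD2[OF that] pair_no_loops[OF that] r by auto
  \<comment> \<open>Vacuous for large sets, so that a single choice function serves all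
    \<open>S\<close>.\<close>
  define represents where "represents S x \<longleftrightarrow> (S \<subseteq> ?V \<and> card S \<le> r + 1 \<longrightarrow>
      (\<forall>p\<in>S \<times> {..<q}. \<forall>p'\<in>S \<times> {..<q}. M p p' = (\<Sum>j<fst x. snd x p j * snd x p' j)))"
    for S and x :: "nat \<times> ('v \<times> nat \<Rightarrow> nat \<Rightarrow> real)"
  have "\<exists>x. represents S x" for S
  proof (cases "S \<subseteq> ?V \<and> card S \<le> r + 1")
    case True
    then have "gram (S \<times> {..<q}) M" using gram by simp
    then obtain m :: nat and b :: "'v \<times> nat \<Rightarrow> nat \<Rightarrow> real"
      where "\<forall>p\<in>S \<times> {..<q}. \<forall>p'\<in>S \<times> {..<q}. M p p' = (\<Sum>j<m. b p j * b p' j)"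
      unfolding gram_def by (elim exE) (rule that)
    then have "represents S (m, b)" unfolding represents_def fst_conv snd_conv by (rule impI)
    then show ?thesis by (rule exI)
  next
    case False
    then have "represents S undefined" unfolding represents_def by (rule impI[OF notE])
    then show ?thesis by (rule exI)
  qed
  then have "represents S (SOME x. represents S x)" for S by (rule someI_ex)
  moreover define f where "f S = (SOME x. represents S x)" for S
  ultimately have f: "represents S (f S)" for S by simp
  define m where "m S = fst (f S)" for S
  define a where "a S = snd (f S)" for S
  have a: "M p p' = (\<Sum>j<m S. a S p j * a S p' j)"
    if "S \<subseteq> ?V" "card S \<le> r + 1" "p \<in> S \<times> {..<q}" "p' \<in> S \<times> {..<q}" for S p p'
    unfolding m_def a_def
    by (rule bspec[OF bspec[OF mp[OF f[of S, unfolded represents_def] conjI[OF that(1,2)]] that(3)] that(4)])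
  define z where "z S \<sigma> = (\<Sum>s<q. label_prob q (m S) (a S) s S \<sigma>) / real q" for S \<sigma>
  define x where "x v i = z {v} (\<lambda>_\<in>{v}. i)" for v i
  define y where "y e i j = z {fst e, snd e} (\<lambda>w\<in>{fst e, snd e}. if w = fst e then i else j)" for e i j
  have label_prob_bounds: "0 \<le> label_prob q m a s S \<sigma>" "label_prob q m a s S \<sigma> \<le> 1" for m a s S and \<sigma> :: "'v \<Rightarrow> nat"
    unfolding label_prob_def by (auto intro: prob_space.prob_le_1[OF prob_space_gauss])
  have z0: "0 \<le> z S \<sigma>" "z S \<sigma> \<le> 1" for S \<sigma>
  proof -
    show "0 \<le> z S \<sigma>" unfolding z_def by (intro divide_nonneg_nonneg sum_nonneg label_prob_bounds) auto
    have "(\<Sum>s<q. label_prob q (m S) (a S) s S \<sigma>) \<le> (\<Sum>s<q. 1)" by (intro sum_mono label_prob_bounds)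
    then show "z S \<sigma> \<le> 1" unfolding z_def using q by simp
  qed
  have marginal: "z S \<sigma> = (\<Sum>\<rho>\<in>{\<rho> \<in> T \<rightarrow>\<^sub>E {1..k}. restrict \<rho> S = \<sigma>}. z T \<rho>)"
    if ST: "S \<subseteq> T" "T \<subseteq> ?V" "card T \<le> r + 1" and \<sigma>: "\<sigma> \<in> S \<rightarrow>\<^sub>E {1..k}" for S T \<sigma>
  proof -
    have S: "S \<subseteq> ?V" "card S \<le> r + 1"
      using ST card_mono[OF finS[OF ST(2)] ST(1)] by auto
    have "label_prob q (m S) (a S) s S \<sigma> = label_prob q (m T) (a T) s S \<sigma>" for s
    proof (rule label_prob_cong[OF finS[OF S(1)]])
      fix p p' assume p: "p \<in> S \<times> {..<q}" "p' \<in> S \<times> {..<q}"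
      then have "p \<in> T \<times> {..<q}" "p' \<in> T \<times> {..<q}" using ST(1) by auto
      then show "(\<Sum>j<m S. a S p j * a S p' j) = (\<Sum>j<m T. a T p j * a T p' j)"
        using a[OF S p] a[OF ST(2,3)] by simp
    qed
    then have "z S \<sigma> = (\<Sum>s<q. \<Sum>\<rho>\<in>{\<rho> \<in> T \<rightarrow>\<^sub>E {1..k}. restrict \<rho> S = \<sigma>}. label_prob q (m T) (a T) s T \<rho>) / real q"
      unfolding z_def using label_prob_marginal[OF ST(1) finS[OF ST(2)] q \<sigma>] by simp
    also have "\<dots> = (\<Sum>\<rho>\<in>{\<rho> \<in> T \<rightarrow>\<^sub>E {1..k}. restrict \<rho> S = \<sigma>}. z T \<rho>)"
      unfolding z_def by (subst sum.swap) (simp add: sum_divide_distrib)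
    finally show ?thesis .
  qed
  have z_singleton: "z {v} \<sigma> = x v (\<sigma> v)" if "\<sigma> \<in> {v} \<rightarrow>\<^sub>E {1..k}" for v \<sigma>
  proof -
    have "(\<lambda>_\<in>{v}. \<sigma> v) = \<sigma>" using that by (auto simp: fun_eq_iff PiE_iff extensional_def)
    then show ?thesis by (simp add: x_def)
  qed
  have z_pair: "z {u, v} \<sigma> = y (u, v) (\<sigma> u) (\<sigma> v)" if "\<sigma> \<in> {u, v} \<rightarrow>\<^sub>E {1..k}" for u v \<sigma>
  proof -
    have "(\<lambda>w\<in>{u, v}. if w = u then \<sigma> u else \<sigma> v) = \<sigma>" using that by (auto simp: fun_eq_iff PiE_iff extensional_def)
    then show ?thesis by (simp add: y_def)
  qed
  have sum_x: "(\<Sum>i\<in>{1..k}. x v i) = 1" if "v \<in> ?V" for v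
  proof -
    \<comment> \<open>The empty set carries no variable of the program, but \<open>z\<close> has the
      value 1 there, and its marginal identity normalizes \<open>x\<close>.\<close>
    have "z {} (\<lambda>_. undefined) = (\<Sum>\<rho>\<in>{\<rho> \<in> {v} \<rightarrow>\<^sub>E {1..k}. restrict \<rho> {} = (\<lambda>_. undefined)}. z {v} \<rho>)"
      using that r by (intro marginal) auto
    also have "\<dots> = (\<Sum>i\<in>{1..k}. x v i)"
    proof (rule sum.reindex_bij_witness[where j = "\<lambda>\<rho>. \<rho> v" and i = "\<lambda>i. \<lambda>_\<in>{v}. i"])
      fix \<rho> assume "\<rho> \<in> {\<rho> \<in> {v} \<rightarrow>\<^sub>E {1..k}. restrict \<rho> {} = (\<lambda>_. undefined)}"
      then have \<rho>: "\<rho> \<in> {v} \<rightarrow>\<^sub>E {1..k}" by simp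
      show "(\<lambda>_\<in>{v}. \<rho> v) = \<rho>" using \<rho> by (auto simp: fun_eq_iff PiE_iff extensional_def)
      show "\<rho> v \<in> {1..k}" using \<rho> by auto
      show "x v (\<rho> v) = z {v} \<rho>" using z_singleton[OF \<rho>] by simp
    qed (auto simp: fun_eq_iff)
    also have "z {} (\<lambda>_. undefined) = 1"
      using q prob_space.prob_space[OF prob_space_gauss] by (simp add: z_def label_prob_def)
    finally show ?thesis by simp
  qed
  have sum_y1: "(\<Sum>l\<in>{1..k}. y (u, v) i l) = x u i" if uv: "(u, v) \<in> ?E" and i: "i \<in> {1..k}" for u v i
  proof -
    note uv' = arc[OF uv]
    have "x u i = (\<Sum>\<rho>\<in>{\<rho> \<in> {u, v} \<rightarrow>\<^sub>E {1..k}. restrict \<rho> {u} = (\<lambda>_\<in>{u}. i)}. z {u, v} \<rho>)"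
      unfolding x_def using uv' i by (intro marginal) auto
    also have "\<dots> = (\<Sum>l\<in>{1..k}. y (u, v) i l)"
    proof (rule sum.reindex_bij_witness[where j = "\<lambda>\<rho>. \<rho> v" and i = "\<lambda>l. \<lambda>w\<in>{u, v}. if w = u then i else l"])
      fix \<rho> assume \<rho>: "\<rho> \<in> {\<rho> \<in> {u, v} \<rightarrow>\<^sub>E {1..k}. restrict \<rho> {u} = (\<lambda>_\<in>{u}. i)}"
      then have "restrict \<rho> {u} u = (\<lambda>_\<in>{u}. i) u" by simp
      then have \<rho>u: "\<rho> u = i" by simp
      show "(\<lambda>w\<in>{u, v}. if w = u then i else \<rho> v) = \<rho>"
        using \<rho> \<rho>u by (auto simp: fun_eq_iff PiE_iff extensional_def)
      show "\<rho> v \<in> {1..k}" using \<rho> by auto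
      show "y (u, v) i (\<rho> v) = z {u, v} \<rho>" using z_pair[of \<rho> u v] \<rho> \<rho>u by simp
    next
      fix l assume "l \<in> {1..k}"
      then show "(\<lambda>w\<in>{u, v}. if w = u then i else l) \<in> {\<rho> \<in> {u, v} \<rightarrow>\<^sub>E {1..k}. restrict \<rho> {u} = (\<lambda>_\<in>{u}. i)}"
        using i by (auto simp: fun_eq_iff)
    qed (use uv' in auto)
    finally show ?thesis by simp
  qed
  have sum_y2: "(\<Sum>l\<in>{1..k}. y (u, v) l j) = x v j" if uv: "(u, v) \<in> ?E" and j: "j \<in> {1..k}" for u v j
  proof -
    note uv' = arc[OF uv]
    have "x v j = (\<Sum>\<rho>\<in>{\<rho> \<in> {u, v} \<rightarrow>\<^sub>E {1..k}. restrict \<rho> {v} = (\<lambda>_\<in>{v}. j)}. z {u, v} \<rho>)"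
      unfolding x_def using uv' j by (intro marginal) auto
    also have "\<dots> = (\<Sum>l\<in>{1..k}. y (u, v) l j)"
    proof (rule sum.reindex_bij_witness[where j = "\<lambda>\<rho>. \<rho> u" and i = "\<lambda>l. \<lambda>w\<in>{u, v}. if w = u then l else j"])
      fix \<rho> assume \<rho>: "\<rho> \<in> {\<rho> \<in> {u, v} \<rightarrow>\<^sub>E {1..k}. restrict \<rho> {v} = (\<lambda>_\<in>{v}. j)}"
      then have "restrict \<rho> {v} v = (\<lambda>_\<in>{v}. j) v" by simp
      then have \<rho>v: "\<rho> v = j" by simp
      show "(\<lambda>w\<in>{u, v}. if w = u then \<rho> u else j) = \<rho>"
        using \<rho> \<rho>v by (auto simp: fun_eq_iff PiE_iff extensional_def)
      show "\<rho> u \<in> {1..k}" using \<rho> by auto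
      show "y (u, v) (\<rho> u) j = z {u, v} \<rho>" using z_pair[of \<rho> u v] \<rho> \<rho>v by simp
    next
      fix l assume "l \<in> {1..k}"
      then show "(\<lambda>w\<in>{u, v}. if w = u then l else j) \<in> {\<rho> \<in> {u, v} \<rightarrow>\<^sub>E {1..k}. restrict \<rho> {v} = (\<lambda>_\<in>{v}. j)}"
        using j uv' by (auto simp: fun_eq_iff)
    qed (use uv' in auto)
    finally show ?thesis by simp
  qed
  have feasible: "ordering_lp_feasible k D x y"
    unfolding ordering_lp_feasible_def using sum_x sum_y1 sum_y2 z0(1) by (auto simp: x_def y_def)
  have sa: "sherali_adams r k D x y z"
    unfolding sherali_adams_def
  proof (intro conjI)
    show "\<forall>S T. S \<subseteq> T \<and> T \<subseteq> ?V \<and> 1 \<le> card S \<and> card T \<le> r + 1 \<longrightarrow>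
        (\<forall>\<sigma>\<in>S \<rightarrow>\<^sub>E {1..k}. z S \<sigma> = (\<Sum>\<rho>\<in>{\<rho> \<in> T \<rightarrow>\<^sub>E {1..k}. restrict \<rho> S = \<sigma>}. z T \<rho>))"
      using marginal by blast
    show "\<forall>(u, v)\<in>?E. card {u, v} \<le> r + 1 \<longrightarrow> (\<forall>\<sigma>\<in>{u, v} \<rightarrow>\<^sub>E {1..k}. z {u, v} \<sigma> = y (u, v) (\<sigma> u) (\<sigma> v))"
      using z_pair by blast
  qed (use z0 z_singleton in auto)
  have finE: "finite ?E" and cardE: "0 < card ?E"
    using pair_finite_arcs D(2) by (auto simp: card_gt_0_iff)
  let ?b = "(1 - 1 / real q) * (1 - (4 * real q ^ 2 * \<eta> + real q * (2 - 2 * c) / \<eta>\<^sup>2))"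
  have edge: "?b \<le> (\<Sum>i\<in>{1..k}. \<Sum>j\<in>{i<..k}. y e i j)" if "e \<in> ?E" for e
  proof -
    obtain u v where uv: "e = (u, v)" "(u, v) \<in> ?E" using \<open>e \<in> ?E\<close> by (cases e) auto
    note uv' = arc[OF uv(2)]
    let ?a = "a {u, v}" and ?m = "m {u, v}"
    have K: "M p p' = (\<Sum>j<?m. ?a p j * ?a p' j)" if "p \<in> {u, v} \<times> {..<q}" "p' \<in> {u, v} \<times> {..<q}" for p p'
      using a[OF uv'(4,5) that] .
    have "?b \<le> (1 - 1 / real q) * measure (gauss ?m)
        {\<omega> \<in> space (gauss ?m). gauss_winner q ?m ?a v \<omega> = Suc (gauss_winner q ?m ?a u \<omega>) mod q}"
    proof (intro mult_left_mono shift_prob_ge)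
      show "(\<Sum>j<?m. (?a (u, i) j)\<^sup>2) = 1" if "i < q" for i
        using K[of "(u, i)" "(u, i)"] diag[of "(u, i)"] that by (simp add: power2_eq_square)
      show "(\<Sum>j<?m. (?a (v, i) j)\<^sup>2) = 1" if "i < q" for i
        using K[of "(v, i)" "(v, i)"] diag[of "(v, i)"] that by (simp add: power2_eq_square)
      show "(\<Sum>j<?m. ?a (u, i) j * ?a (u, i') j) \<le> 1 / 2" if "i < q" "i' < q" "i \<noteq> i'" for i i'
        using K[of "(u, i)" "(u, i')"] half[OF uv'(1) that] that by simp
      show "c \<le> (\<Sum>j<?m. ?a (u, i) j * ?a (v, Suc i mod q) j)" if "i < q" for i
        using K[of "(u, i)" "(v, Suc i mod q)"] cor[OF uv(2) that] that q by simp
    qed (use q \<eta> in auto)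
    also have "\<dots> \<le> (\<Sum>i\<in>{1..k}. \<Sum>j\<in>{i<..k}. y e i j)"
      unfolding uv(1) y_def z_def fst_conv snd_conv by (rule averaged_ordering_ge[OF q uv'(3)])
    finally show ?thesis .
  qed
  have "?b \<le> ordering_lp_objective k D (\<lambda>_. 1) y"
  proof -
    have "(\<Sum>e\<in>?E. ?b) \<le> (\<Sum>e\<in>?E. \<Sum>i\<in>{1..k}. \<Sum>j\<in>{i<..k}. y e i j)"
      by (intro sum_mono edge)
    then show ?thesis using cardE by (simp add: ordering_lp_objective_def pos_le_divide_eq mult.commute)
  qed
  also have "\<dots> \<le> ordering_sa_opt r k D (\<lambda>_. 1)"
    unfolding ordering_sa_opt_def
  proof (rule cSup_upper)
    show "ordering_lp_objective k D (\<lambda>_. 1) y \<in> {ordering_lp_objective k D (\<lambda>_. 1) y |x y z.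
        ordering_lp_feasible k D x y \<and> sherali_adams r k D x y z}"
      using feasible sa by blast
    \<comment> \<open>The supremum dominates the elements only of a bounded set; every arc
      contributes at most its total mass 1.\<close>
    show "bdd_above {ordering_lp_objective k D (\<lambda>_. 1) y |x y z.
        ordering_lp_feasible k D x y \<and> sherali_adams r k D x y z}"
    proof (rule bdd_aboveI[of _ 1], clarify)
      fix x y assume f: "ordering_lp_feasible k D x y"
      have "(\<Sum>i\<in>{1..k}. \<Sum>j\<in>{i<..k}. y e i j) \<le> 1" if "e \<in> ?E" for e
      proof -
        obtain u v where uv: "e = (u, v)" "(u, v) \<in> ?E" using \<open>e \<in> ?E\<close> by (cases e) auto
        have y: "\<And>i j. i \<in> {1..k} \<Longrightarrow> j \<in> {1..k} \<Longrightarrow> 0 \<le> y (u, v) i j"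
          "\<And>i. i \<in> {1..k} \<Longrightarrow> (\<Sum>l\<in>{1..k}. y (u, v) i l) = x u i" "(\<Sum>i\<in>{1..k}. x u i) = 1"
          using f uv(2) arc(1)[OF uv(2)] unfolding ordering_lp_feasible_def by fastforce+
        have "(\<Sum>i\<in>{1..k}. \<Sum>j\<in>{i<..k}. y e i j) \<le> (\<Sum>i\<in>{1..k}. \<Sum>j\<in>{1..k}. y e i j)"
          unfolding uv(1) using y(1) by (intro sum_mono sum_mono2) auto
        also have "\<dots> = 1" unfolding uv(1) using y(2,3) by simp
        finally show ?thesis .
      qed
      then have "(\<Sum>e\<in>?E. \<Sum>i\<in>{1..k}. \<Sum>j\<in>{i<..k}. y e i j) \<le> (\<Sum>e\<in>?E. 1)" by (intro sum_mono)
      then show "ordering_lp_objective k D (\<lambda>_. 1) y \<le> 1"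
        using cardE by (simp add: ordering_lp_objective_def)
    qed
  qed
  finally show ?thesis .
qed

section \<open>Labelings of quasirandom digraphs\<close>

lemma sum_pairs_split:
  fixes p :: "nat \<Rightarrow> real"
  shows "(\<Sum>i<K. p i)\<^sup>2 = 2 * (\<Sum>(i, j)\<in>{(i, j). i < j \<and> j < K}. p i * p j) + (\<Sum>i<K. (p i)\<^sup>2)"
proof (induction K)
  case (Suc K)
  have "{(i, j). i < j \<and> j < Suc K} = {(i, j). i < j \<and> j < K} \<union> (\<lambda>i. (i, K)) ` {..<K}"
    by (auto simp: less_Suc_eq)
  moreover have "finite {(i, j). i < j \<and> j < K}"
    by (rule finite_subset[of _ "{..<K} \<times> {..<K}"]) auto
  ultimately have "(\<Sum>(i, j)\<in>{(i, j). i < j \<and> j < Suc K}. p i * p j) =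
      (\<Sum>(i, j)\<in>{(i, j). i < j \<and> j < K}. p i * p j) + (\<Sum>(i, j)\<in>(\<lambda>i. (i, K)) ` {..<K}. p i * p j)"
    by (simp only:) (rule sum.union_disjoint, auto)
  also have "(\<Sum>(i, j)\<in>(\<lambda>i. (i, K)) ` {..<K}. p i * p j) = (\<Sum>i<K. p i) * p K"
    by (subst sum.reindex) (auto simp: inj_on_def sum_distrib_right)
  finally show ?case using Suc by (simp add: power2_eq_square algebra_simps)
qed simp

lemma card_block_le:
  assumes "0 < K" "0 < n" "\<And>x. x \<in> X \<Longrightarrow> K * x div n = j"
  shows "finite X \<and> real (card X) \<le> real n / real K + 1"
proof (cases "X = {}")
  case False
  have close: "K * x < K * y + n" if "x \<in> X" "y \<in> X" for x y
  proof -
    have "K * x < Suc j * n" "j * n \<le> K * y"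
      using assms(3)[OF that(1)] assms(3)[OF that(2)] \<open>0 < n\<close>
      by (metis dividend_less_div_times add.commute mult_Suc, metis div_times_less_eq_dividend)
    then show ?thesis by simp
  qed
  define y where "y = (LEAST y. y \<in> X)"
  have y: "y \<in> X" "\<And>x. x \<in> X \<Longrightarrow> y \<le> x"
    unfolding y_def using False by (auto intro: LeastI Least_le)
  define s where "s = (n - 1) div K"
  have sub: "X \<subseteq> {y..y + s}"
  proof
    fix x assume x: "x \<in> X"
    have "K * y \<le> K * x" using y(2)[OF x] by simp
    then have "K * x - K * y < n" using close[OF x y(1)] by linarith
    then have "K * (x - y) < n" by (simp only: diff_mult_distrib2)
    then have "x - y \<le> (n - 1) div K" using \<open>0 < K\<close> by (simp add: less_eq_div_iff_mult_less_eq mult.commute)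
    then show "x \<in> {y..y + s}" using y(2)[OF x] by (auto simp: s_def)
  qed
  have "card X \<le> card {y..y + s}" using sub by (intro card_mono) auto
  then have "real (card X) \<le> real s + 1" by simp
  moreover have "real s \<le> real n / real K"
  proof -
    have "real s \<le> real (n - 1) / real K" unfolding s_def by (rule of_nat_div_le_of_nat)
    also have "\<dots> \<le> real n / real K" by (intro divide_right_mono) auto
    finally show ?thesis .
  qed
  ultimately show ?thesis using finite_subset[OF sub] by simp
qed simp

locale quasirandom_digraph =
  fixes E :: "nat rel" and n :: nat and m \<epsilon> :: real
  assumes n: "0 < n" and E: "E \<subseteq> {..<n} \<times> {..<n}" and m: "0 < m" and \<epsilon>: "0 < \<epsilon>" "\<epsilon> < 1"
    and upper: "\<And>A B. A \<subseteq> {..<n} \<Longrightarrow> B \<subseteq> {..<n} \<Longrightarrow>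
      card (E \<inter> A \<times> B) \<le> (real (card A) * real (card B) / (real n)\<^sup>2 + \<epsilon>) * m"
    and card_E: "(1 - \<epsilon>) * m \<le> card E"
begin

text \<open>The additive error is paid once per pair of blocks, hence up to K^2 times; so the number
  of blocks has to be fixed before \<open>\<epsilon>\<close>.\<close>

lemma card_blocks_le:
  fixes b :: "nat \<Rightarrow> nat"
  assumes R: "R \<subseteq> {..<K} \<times> {..<K}"
  shows "card {e \<in> E. (b (fst e), b (snd e)) \<in> R} \<le>
    ((\<Sum>(i, j)\<in>R. (card {v \<in> {..<n}. b v = i} / real n) * (card {v \<in> {..<n}. b v = j} / real n)) + real K ^ 2 * \<epsilon>) * m"
proof -
  let ?B = "\<lambda>i. {v \<in> {..<n}. b v = i}"
  have finR: "finite R" using R finite_subset by blast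
  have cardR: "card R \<le> K ^ 2" using card_mono[OF _ R] by (simp add: power2_eq_square)
  have "{e \<in> E. (b (fst e), b (snd e)) \<in> R} = (\<Union>x\<in>R. E \<inter> ?B (fst x) \<times> ?B (snd x))"
    using E by auto
  then have "card {e \<in> E. (b (fst e), b (snd e)) \<in> R} \<le> (\<Sum>x\<in>R. card (E \<inter> ?B (fst x) \<times> ?B (snd x)))"
    by (simp only:) (rule card_UN_le[OF finR])
  then have "real (card {e \<in> E. (b (fst e), b (snd e)) \<in> R}) \<le> real (\<Sum>x\<in>R. card (E \<inter> ?B (fst x) \<times> ?B (snd x)))"
    by (rule of_nat_mono)
  also have "\<dots> \<le> (\<Sum>x\<in>R. (real (card (?B (fst x))) * real (card (?B (snd x))) / (real n)\<^sup>2 + \<epsilon>) * m)"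
    unfolding of_nat_sum by (intro sum_mono upper) auto
  also have "\<dots> = ((\<Sum>(i, j)\<in>R. (card (?B i) / real n) * (card (?B j) / real n)) + real (card R) * \<epsilon>) * m"
    by (simp add: sum_distrib_right[symmetric] sum.distrib case_prod_beta power2_eq_square)
  also have "\<dots> \<le> ((\<Sum>(i, j)\<in>R. (card (?B i) / real n) * (card (?B j) / real n)) + real K ^ 2 * \<epsilon>) * m"
  proof -
    have "real (card R) \<le> real (K ^ 2)" using cardR by (rule of_nat_mono)
    then have "real (card R) * \<epsilon> \<le> real K ^ 2 * \<epsilon>" using \<epsilon> by (intro mult_right_mono) auto
    then show ?thesis using m by (intro mult_right_mono[OF add_left_mono]) simp_all
  qed
  finally show ?thesis .
qed

lemma sum_blocks:
  fixes b :: "nat \<Rightarrow> nat"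
  assumes "\<And>v. v < n \<Longrightarrow> b v < K"
  shows "(\<Sum>i<K. card {v \<in> {..<n}. b v = i} / real n) = 1"
proof -
  have "(\<Sum>i<K. card {v \<in> {..<n}. b v = i}) = card (\<Union>i\<in>{..<K}. {v \<in> {..<n}. b v = i})"
    by (subst card_UN_disjoint) auto
  also have "(\<Union>i\<in>{..<K}. {v \<in> {..<n}. b v = i}) = {..<n}" using assms by auto
  finally have "(\<Sum>i<K. card {v \<in> {..<n}. b v = i}) = n" by simp
  then have "(\<Sum>i<K. real (card {v \<in> {..<n}. b v = i})) = real n" by (metis of_nat_sum)
  then show ?thesis using n by (simp add: sum_divide_distrib[symmetric])
qed

text \<open>For label densities p_i the main term is the sum of p_i p_j over i < j, which is half of
  1 minus the sum of the squares, and by Cauchy-Schwarz the squares sum to at least 1/k.\<close>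

lemma few_labels:
  assumes l: "\<And>v. v < n \<Longrightarrow> l v \<in> {1..k}" and k: "0 < k" "k \<le> K"
  shows "card {e \<in> E. l (fst e) < l (snd e)} \<le> ((1 - 1 / real k) / 2 + real K ^ 2 * \<epsilon>) * m"
proof -
  define b where "b v = l v - 1" for v
  let ?p = "\<lambda>i. card {v \<in> {..<n}. b v = i} / real n"
  let ?R = "{(i, j). i < j \<and> j < k}"
  have b: "b v < k" if "v < n" for v using l[OF that] by (auto simp: b_def)
  have sum: "(\<Sum>i<k. ?p i) = 1" by (rule sum_blocks[OF b])
  have "{e \<in> E. l (fst e) < l (snd e)} = {e \<in> E. (b (fst e), b (snd e)) \<in> ?R}"
  proof (intro Collect_cong conj_cong refl)
    fix e assume "e \<in> E"
    then have "fst e < n" "snd e < n" using E by auto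
    then show "l (fst e) < l (snd e) \<longleftrightarrow> (b (fst e), b (snd e)) \<in> ?R"
      using l[of "fst e"] l[of "snd e"] by (auto simp: b_def)
  qed
  then have "real (card {e \<in> E. l (fst e) < l (snd e)}) \<le> ((\<Sum>(i, j)\<in>?R. ?p i * ?p j) + real k ^ 2 * \<epsilon>) * m"
    by (simp only:) (rule card_blocks_le, auto)
  also have "\<dots> \<le> ((1 - 1 / real k) / 2 + real K ^ 2 * \<epsilon>) * m"
  proof (intro mult_right_mono add_mono)
    have "(\<Sum>i<k. ?p i * 1)\<^sup>2 \<le> (\<Sum>i<k. (?p i)\<^sup>2) * (\<Sum>i<k. 1\<^sup>2)" by (rule Cauchy_Schwarz_ineq_sum)
    then have "1 \<le> (\<Sum>i<k. (?p i)\<^sup>2) * real k" using sum by simp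
    then have "1 / real k \<le> (\<Sum>i<k. (?p i)\<^sup>2)" using k by (simp add: divide_le_eq)
    then show "(\<Sum>(i, j)\<in>?R. ?p i * ?p j) \<le> (1 - 1 / real k) / 2"
      using sum_pairs_split[of ?p k] sum by simp
  qed (use k \<epsilon> m in auto)
  finally show ?thesis .
qed

text \<open>For many labels, sort the vertices by label and cut the sorted order into \<open>K\<close> blocks of
  almost equal size.\<close>

lemma many_labels:
  assumes K: "0 < K"
  shows "card {e \<in> E. l (fst e) < (l (snd e) :: nat)} \<le> ((1 + 1 / real K + 1 / real n) / 2 + real K ^ 2 * \<epsilon>) * m"
proof -
  \<comment> \<open>Equal labels are ordered by vertex number, so that the ranks are distinct and
    the blocks nearly equal in size.\<close>
  define below where "below v = {w \<in> {..<n}. l w < l v \<or> l w = l v \<and> w < v}" for v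
  define \<pi> where "\<pi> v = card (below v)" for v
  define b where "b v = K * \<pi> v div n" for v
  let ?p = "\<lambda>i. card {v \<in> {..<n}. b v = i} / real n"
  \<comment> \<open>A satisfied arc never leads to an earlier block, but may stay inside one. The
    diagonal pairs add the squares of the block densities, whose sum is at most the largest
    density.\<close>
  let ?R = "{(i, j). i < j \<and> j < K} \<union> (\<lambda>i. (i, i)) ` {..<K}"
  have fin: "finite (below v)" for v by (simp add: below_def)
  have less: "\<pi> u < \<pi> v" if "u < n" "l u < l v \<or> l u = l v \<and> u < v" for u v
    unfolding \<pi>_def
  proof (rule psubset_card_mono[OF fin])
    have "u \<in> below v" "u \<notin> below u" using that by (auto simp: below_def)
    moreover have "below u \<subseteq> below v" using that by (auto simp: below_def)
    ultimately show "below u \<subset> below v" by blast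
  qed
  have inj: "inj_on \<pi> {..<n}"
  proof (rule inj_onI)
    fix u v assume uv: "u \<in> {..<n}" "v \<in> {..<n}" "\<pi> u = \<pi> v"
    show "u = v"
    proof (rule ccontr)
      assume "u \<noteq> v"
      then consider "l u < l v \<or> l u = l v \<and> u < v" | "l v < l u \<or> l v = l u \<and> v < u" by linarith
      then show False using less[of u v] less[of v u] uv by cases auto
    qed
  qed
  have \<pi>n: "\<pi> v < n" if "v < n" for v
  proof -
    have "below v \<subset> {..<n}" using that by (auto simp: below_def)
    from psubset_card_mono[OF _ this] show ?thesis by (simp add: \<pi>_def)
  qed
  have b: "b v < K" if "v < n" for v
    using \<pi>n[OF that] K n by (simp add: b_def div_less_iff_less_mult)
  have sum: "(\<Sum>i<K. ?p i) = 1" by (rule sum_blocks[OF b])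
  have block: "?p i \<le> 1 / real K + 1 / real n" for i
  proof -
    have "finite (\<pi> ` {v \<in> {..<n}. b v = i}) \<and> real (card (\<pi> ` {v \<in> {..<n}. b v = i})) \<le> real n / real K + 1"
      by (rule card_block_le[OF K n, where j = i]) (auto simp: b_def)
    moreover have "card (\<pi> ` {v \<in> {..<n}. b v = i}) = card {v \<in> {..<n}. b v = i}"
      by (rule card_image) (rule inj_on_subset[OF inj], blast)
    ultimately have "real (card {v \<in> {..<n}. b v = i}) \<le> real n / real K + 1" by simp
    then have "?p i \<le> (real n / real K + 1) / real n" by (intro divide_right_mono) auto
    then show ?thesis using n by (simp add: add_divide_distrib)
  qed
  have "{e \<in> E. l (fst e) < l (snd e)} \<subseteq> {e \<in> E. (b (fst e), b (snd e)) \<in> ?R}"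
  proof
    fix e assume e: "e \<in> {e \<in> E. l (fst e) < l (snd e)}"
    then have v: "fst e < n" "snd e < n" using E by auto
    have "\<pi> (fst e) < \<pi> (snd e)" using less[OF v(1)] e by auto
    then have "b (fst e) \<le> b (snd e)" unfolding b_def by (intro div_le_mono mult_left_mono) auto
    then show "e \<in> {e \<in> E. (b (fst e), b (snd e)) \<in> ?R}" using e b v by (auto simp: le_less)
  qed
  moreover have "finite E" using E finite_subset by blast
  ultimately have "real (card {e \<in> E. l (fst e) < l (snd e)}) \<le> real (card {e \<in> E. (b (fst e), b (snd e)) \<in> ?R})"
    by (intro of_nat_mono card_mono) auto
  also have "\<dots> \<le> ((\<Sum>(i, j)\<in>?R. ?p i * ?p j) + real K ^ 2 * \<epsilon>) * m"
    by (rule card_blocks_le) auto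
  also have "\<dots> \<le> ((1 + 1 / real K + 1 / real n) / 2 + real K ^ 2 * \<epsilon>) * m"
  proof (intro mult_right_mono add_right_mono)
    have "finite {(i, j). i < j \<and> j < K}"
      by (rule finite_subset[of _ "{..<K} \<times> {..<K}"]) auto
    then have "(\<Sum>(i, j)\<in>?R. ?p i * ?p j) =
        (\<Sum>(i, j)\<in>{(i, j). i < j \<and> j < K}. ?p i * ?p j) + (\<Sum>(i, j)\<in>(\<lambda>i. (i, i)) ` {..<K}. ?p i * ?p j)"
      by (intro sum.union_disjoint) auto
    also have "(\<Sum>(i, j)\<in>(\<lambda>i. (i, i)) ` {..<K}. ?p i * ?p j) = (\<Sum>i<K. (?p i)\<^sup>2)"
      by (subst sum.reindex) (auto simp: inj_on_def power2_eq_square)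
    also have "(\<Sum>(i, j)\<in>{(i, j). i < j \<and> j < K}. ?p i * ?p j) = (1 - (\<Sum>i<K. (?p i)\<^sup>2)) / 2"
      using sum_pairs_split[of ?p K] sum by simp
    finally have "(\<Sum>(i, j)\<in>?R. ?p i * ?p j) = (1 + (\<Sum>i<K. (?p i)\<^sup>2)) / 2" by (simp add: field_simps)
    moreover have "(\<Sum>i<K. (?p i)\<^sup>2) \<le> (\<Sum>i<K. (1 / real K + 1 / real n) * ?p i)"
      unfolding power2_eq_square using block by (intro sum_mono mult_right_mono) auto
    then have "(\<Sum>i<K. (?p i)\<^sup>2) \<le> 1 / real K + 1 / real n"
      unfolding sum_distrib_left[symmetric] sum by simp
    ultimately show "(\<Sum>(i, j)\<in>?R. ?p i * ?p j) \<le> (1 + 1 / real K + 1 / real n) / 2" by simp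
  qed (use m in auto)
  finally show ?thesis .
qed

text \<open>The value is normalized by the surviving arcs, of which there are at least
  \<open>(1 - \<epsilon>) * m\<close>; hence the factor \<open>1 - \<epsilon>\<close> in the
  hypothesis on \<open>\<beta>\<close>.\<close>

lemma max_ordering_opt_le:
  assumes "0 < k"
    and bound: "\<And>l. (\<And>v. v < n \<Longrightarrow> l v \<in> {1..k}) \<Longrightarrow>
      card {e \<in> E. l (fst e) < l (snd e)} \<le> \<beta> * m"
    and \<beta>: "\<beta> \<le> \<delta> * (1 - \<epsilon>)" "0 \<le> \<delta>"
  shows "max_ordering_opt k \<lparr>pverts = {..<n}, parcs = E\<rparr> (\<lambda>_. 1) \<le> \<delta>"
  unfolding max_ordering_opt_def
proof (rule Max.boundedI)
  let ?L = "{..<n} \<rightarrow>\<^sub>E {1..k}"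
  show "finite (ordering_value \<lparr>pverts = {..<n}, parcs = E\<rparr> (\<lambda>_. 1) ` (pverts \<lparr>pverts = {..<n}, parcs = E\<rparr> \<rightarrow>\<^sub>E {1..k}))"
    by (intro finite_imageI finite_PiE) auto
  have "?L \<noteq> {}" using \<open>0 < k\<close> by (auto simp: PiE_eq_empty_iff)
  then show "ordering_value \<lparr>pverts = {..<n}, parcs = E\<rparr> (\<lambda>_. 1) ` (pverts \<lparr>pverts = {..<n}, parcs = E\<rparr> \<rightarrow>\<^sub>E {1..k}) \<noteq> {}"
    by simp
  fix y assume "y \<in> ordering_value \<lparr>pverts = {..<n}, parcs = E\<rparr> (\<lambda>_. 1) ` (pverts \<lparr>pverts = {..<n}, parcs = E\<rparr> \<rightarrow>\<^sub>E {1..k})"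
  then obtain l where l: "l \<in> ?L" and y: "y = card {e \<in> E. l (fst e) < l (snd e)} / card E"
    by (auto simp: ordering_value_def)
  have "real (card {e \<in> E. l (fst e) < l (snd e)}) \<le> \<beta> * m"
    by (rule bound) (rule PiE_mem[OF l], simp)
  also have "\<dots> \<le> \<delta> * (1 - \<epsilon>) * m" using \<beta>(1) m by (intro mult_right_mono) auto
  also have "\<dots> \<le> \<delta> * card E" using mult_left_mono[OF card_E \<beta>(2)] by (simp add: mult.assoc)
  finally have "real (card {e \<in> E. l (fst e) < l (snd e)}) \<le> \<delta> * card E" .
  moreover have "0 < card E"
  proof -
    have "0 < (1 - \<epsilon>) * m" using m \<epsilon> by simp
    then show ?thesis using card_E by linarith
  qed
  ultimately show "y \<le> \<delta>" unfolding y by (simp add: divide_le_eq)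
qed

end

section \<open>The integrality gap\<close>

text \<open>The kernel is the power of the distance, damped by \<open>1 + \<tau>\<close> off the
  diagonal. Points of one fibre are more than \<open>g\<close> apart, which yields correlation at
  most 1/2, and an arc of the cover yields at least \<open>\<rho> / (1 + \<tau>)\<close>.\<close>

lemma (in sparse_digraph) sa_opt_ge:
  fixes \<rho> \<tau> \<eta> c :: real
  assumes E: "E \<noteq> {}" and r: "1 \<le> r" and q: "0 < q" "q \<le> k" and \<eta>: "0 < \<eta>"
    and rho: "0 < \<rho>" "\<rho> < 1" and h: "0 < h" "2 * h + 1 \<le> g" and \<tau>: "5 * real t ^ 2 * \<rho> ^ h \<le> \<tau>"
    and N: "2 * ((r + 1) * q)\<^sup>2 * (h + 1) \<le> t" and half: "\<rho> ^ g \<le> 1 / 2" and c: "c \<le> \<rho> / (1 + \<tau>)"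
  shows "(1 - 1 / real q) * (1 - (4 * real q ^ 2 * \<eta> + real q * (2 - 2 * c) / \<eta>\<^sup>2))
    \<le> ordering_sa_opt r k \<lparr>pverts = V, parcs = E\<rparr> (\<lambda>_. 1)"
proof (rule sa_opt_ge_of_local_gram[where M = "\<lambda>p p'. if p = p' then 1 else dist_kernel \<rho> (lift E q) (V \<times> {..<q}) p p' / (1 + \<tau>)"])
  interpret kernel_graph \<rho> "lift E q"
    using rho lift_sym lift_irrefl by unfold_locales auto
  have "0 \<le> 5 * real t ^ 2 * \<rho> ^ h" using rho by simp
  then have \<tau>0: "0 \<le> \<tau>" using \<tau> by linarith
  show "pair_digraph \<lparr>pverts = V, parcs = E\<rparr>"
    using finV EV asym finite_subset[OF EV] by unfold_locales auto
  show "gram (S \<times> {..<q}) (\<lambda>p p'. if p = p' then 1 else dk (V \<times> {..<q}) p p' / (1 + \<tau>))"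
    if S: "S \<subseteq> pverts \<lparr>pverts = V, parcs = E\<rparr>" "card S \<le> r + 1" for S
  proof (rule gram_local[OF rho h _ _ \<tau>])
    have "(card S * q)\<^sup>2 \<le> ((r + 1) * q)\<^sup>2" using S by (intro power_mono mult_right_mono) auto
    then have "2 * (card S * q)\<^sup>2 * (h + 1) \<le> 2 * ((r + 1) * q)\<^sup>2 * (h + 1)"
      by (intro mult_right_mono mult_left_mono) auto
    then show "2 * (card S * q)\<^sup>2 * (h + 1) \<le> t" using N by linarith
  qed (use S in simp)
  show "(if (u, i) = (u, i') then 1 else dk (V \<times> {..<q}) (u, i) (u, i') / (1 + \<tau>)) \<le> 1 / 2"
    if "i \<noteq> i'" for u i i'
  proof -
    have "dk (V \<times> {..<q}) (u, i) (u, i') \<le> 1 / 2"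
    proof (rule dk_le)
      fix n assume "((u, i), (u, i')) \<in> induced (lift E q) (V \<times> {..<q}) ^^ n"
      then have "g < n" using fibre_distance that by fastforce
      then have "\<rho> ^ n \<le> \<rho> ^ g" using rho by (intro power_decreasing) auto
      then show "\<rho> ^ n \<le> 1 / 2" using half by simp
    qed simp
    moreover have "dk (V \<times> {..<q}) (u, i) (u, i') / (1 + \<tau>) \<le> dk (V \<times> {..<q}) (u, i) (u, i') / 1"
      using \<tau>0 dk_nonneg by (intro divide_left_mono) auto
    ultimately have "dk (V \<times> {..<q}) (u, i) (u, i') / (1 + \<tau>) \<le> 1 / 2" by linarith
    then show ?thesis using that by simp
  qed
  show "c \<le> (if (u, i) = (v, Suc i mod q) then 1 else dk (V \<times> {..<q}) (u, i) (v, Suc i mod q) / (1 + \<tau>))"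
    if uv: "(u, v) \<in> parcs \<lparr>pverts = V, parcs = E\<rparr>" and i: "i < q" for u v i
  proof -
    have uvE: "(u, v) \<in> E" "u \<in> V" "v \<in> V" "u \<noteq> v" using uv EV asym by auto
    then have "((u, i), (v, Suc i mod q)) \<in> induced (lift E q) (V \<times> {..<q})"
      using i q by (auto simp: induced_def lift_def)
    from dk_step[OF this, of "(u, i)"] have "\<rho> \<le> dk (V \<times> {..<q}) (u, i) (v, Suc i mod q)"
      by (simp add: dk_refl)
    then have "\<rho> / (1 + \<tau>) \<le> dk (V \<times> {..<q}) (u, i) (v, Suc i mod q) / (1 + \<tau>)"
      using \<tau>0 by (intro divide_right_mono) auto
    then show ?thesis using c uvE by simp
  qed
qed (use assms in auto)

section \<open>The number of rounds and the choice of constants\<close>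

text \<open>At \<open>k = 3\<close> the double logarithm is below 1 and the exponent
  \<open>\<gamma> / loglog k\<close> exceeds \<open>\<gamma>\<close>; this bound limits it to
  \<open>2 * \<gamma>\<close> for all \<open>k\<close>. The binary logarithm of 3 is at least 3/2,
  and 3/2 is at least the square root of 2.\<close>

lemma loglog_ge_half:
  assumes "2 \<le> k"
  shows "1 / 2 \<le> loglog k"
proof (cases "k \<le> 2")
  case False
  have "2 powr (3 / 2) = sqrt 8"
  proof -
    have "2 powr (3 / 2) = (2 powr 3) powr (1 / 2 :: real)" by (simp only: powr_powr) simp
    also have "2 powr 3 = (8 :: real)" by simp
    finally show ?thesis by (simp add: powr_half_sqrt)
  qed
  also have "\<dots> \<le> real k" 
  proof (rule real_le_lsqrt)
    have "(3 :: real) ^ 2 \<le> real k ^ 2" using False by (intro power_mono) auto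
    then show "8 \<le> (real k)\<^sup>2" by simp
  qed auto
  finally have "3 / 2 \<le> log 2 (real k)" using False by (subst le_log_iff) auto
  moreover have "2 powr (1 / 2) \<le> (3 / 2 :: real)"
  proof -
    have "sqrt 2 \<le> (3 / 2 :: real)" by (rule real_le_lsqrt) (auto simp: power2_eq_square)
    then show ?thesis by (simp add: powr_half_sqrt)
  qed
  ultimately have "2 powr (1 / 2) \<le> log 2 (real k)" by linarith
  moreover have "0 < log 2 (real k)" using False by simp
  ultimately have "1 / 2 \<le> log 2 (log 2 (real k))" by (subst le_log_iff) auto
  then show ?thesis using False by (simp add: loglog_def)
qed (simp add: loglog_def)

lemma sa_rounds_bounds:
  assumes "0 < \<gamma>" "2 \<le> k" "1 \<le> n"
  shows "1 \<le> sa_rounds \<gamma> n k" "real (sa_rounds \<gamma> n k) \<le> real n powr (2 * \<gamma>)"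
proof -
  have l: "1 / 2 \<le> loglog k" by (rule loglog_ge_half) fact
  have "1 \<le> real n powr (\<gamma> / loglog k)" using assms l by (intro ge_one_powr_ge_zero) auto
  then show "1 \<le> sa_rounds \<gamma> n k" by (simp add: sa_rounds_def le_nat_iff le_floor_iff)
  have "real (sa_rounds \<gamma> n k) \<le> real n powr (\<gamma> / loglog k)" by (simp add: sa_rounds_def)
  also have "\<dots> \<le> real n powr (2 * \<gamma>)"
  proof (intro powr_mono)
    have "\<gamma> * (1 / 2) \<le> \<gamma> * loglog k" using l assms by (intro mult_left_mono) auto
    then show "\<gamma> / loglog k \<le> 2 * \<gamma>" using l by (simp add: divide_le_eq)
  qed (use assms in auto)
  finally show "real (sa_rounds \<gamma> n k) \<le> real n powr (2 * \<gamma>)" .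
qed

theorem theorem7:
  fixes \<epsilon> :: real
  assumes "\<epsilon> > 0"
  shows "\<exists>\<gamma>>0. \<exists>N. \<forall>n\<ge>N. \<forall>k\<in>{2..n}.
    \<exists>(D :: nat pair_pre_digraph) (w :: nat \<times> nat \<Rightarrow> real).
      weighted_digraph D w \<and> card (pverts D) = n \<and>
      max_ordering_opt k D w \<le> 1 / 2 * (1 - 1 / real k) + \<epsilon> \<and>
      ordering_sa_opt (sa_rounds \<gamma> n k) k D w \<ge> (1 - \<epsilon>) * (1 - 1 / real k)"
proof -
  define e where "e = min \<epsilon> (1 / 2)"
  have e: "0 < e" "e \<le> \<epsilon>" "e \<le> 1 / 2" using assms by (auto simp: e_def)
  \<comment> \<open>Restricting the fractional solution to \<open>K\<close> labels loses at most
    \<open>e / 2\<close>; arcs along which the winner fails to move up by 1 may cost another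
    \<open>e / 2\<close>.\<close>
  define K where "K = nat \<lceil>2 / e\<rceil>"
  have Ke: "2 / e \<le> real K" unfolding K_def by linarith
  have "4 \<le> 2 / e" using e by (simp add: field_simps)
  then have "0 < real K" using Ke by linarith
  then have K: "0 < K" "2 \<le> K * e" using Ke e by (auto simp: field_simps)
  have invK: "1 / real K \<le> e / 2" using K by (simp add: field_simps)
  \<comment> \<open>Makes \<open>real K ^ 2 * \<epsilon>' + \<epsilon>'\<close> equal to
    \<open>e / 4\<close>: the errors of all pairs of blocks and the loss by deleted arcs.\<close>
  define \<epsilon>' where "\<epsilon>' = e / (4 * (real K ^ 2 + 1))"
  have Keps: "real K ^ 2 * \<epsilon>' + \<epsilon>' = e / 4"
  proof -
    have "real K ^ 2 + 1 \<noteq> 0" by (metis add_nonneg_pos less_irrefl zero_le_power2 zero_less_one)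
    moreover have "x * (e / (4 * x)) = e / 4" if "x \<noteq> 0" for x using that by simp
    ultimately have "(real K ^ 2 + 1) * \<epsilon>' = e / 4" unfolding \<epsilon>'_def by blast
    then show ?thesis by (simp add: distrib_right)
  qed
  have eps'0: "0 < \<epsilon>'" unfolding \<epsilon>'_def using e(1) by (intro divide_pos_pos) (auto intro: add_nonneg_pos)
  have "0 \<le> real K ^ 2 * \<epsilon>'" using eps'0 by simp
  then have eps': "0 < \<epsilon>'" "\<epsilon>' < 1" "\<epsilon>' \<le> 1" using eps'0 Keps e by linarith+
  obtain C :: nat and cc :: real where C: "1 \<le> C" and cc: "0 < cc" and
    graph: "\<forall>\<^sub>F n in sequentially. \<exists>E. sparse_quasirandom (C * n) \<epsilon>' (nat \<lfloor>cc * ln n\<rfloor>) n E"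
    using sparse_quasirandom_digraph[OF eps'(1,3)] by blast
  define \<eta> where "\<eta> = e / (16 * real K ^ 2)"
  have \<eta>: "0 < \<eta>" using e K by (simp add: \<eta>_def)
  \<comment> \<open>The permitted defect of the correlation along an arc. \<open>\<eta>\<close>
    makes the first failure term of \<open>shift_prob_ge\<close> at most \<open>e / 4\<close>, and
    \<open>\<kappa>\<close> the second; \<open>\<kappa>\<close> is then split evenly between
    \<open>1 - \<rho>\<close> and \<open>\<tau>\<close>.\<close>
  define \<kappa> where "\<kappa> = min (1 / 2) (e * \<eta>\<^sup>2 / (8 * real K))"
  have \<kappa>: "0 < \<kappa>" "\<kappa> \<le> 1 / 2" "\<kappa> \<le> e * \<eta>\<^sup>2 / (8 * real K)" using e \<eta> K by (auto simp: \<kappa>_def)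
  define \<rho> where "\<rho> = 1 - \<kappa> / 2"
  define \<tau> where "\<tau> = \<kappa> / 2"
  have rho: "0 < \<rho>" "\<rho> < 1" and \<tau>: "0 < \<tau>" using \<kappa> by (auto simp: \<rho>_def \<tau>_def)
  have c: "1 - \<kappa> \<le> \<rho> / (1 + \<tau>)"
  proof -
    have "(1 - \<kappa>) * (1 + \<tau>) = \<rho> - \<kappa> * \<tau>" by (simp add: \<rho>_def \<tau>_def field_simps)
    also have "\<dots> \<le> \<rho>" using \<kappa> \<tau> by simp
    finally show ?thesis using \<tau> by (simp add: pos_le_divide_eq)
  qed
  define L where "L = - ln \<rho>"
  have L: "0 < L" using rho by (simp add: L_def)
  have rho_pow: "\<rho> ^ j = exp (- L * real j)" for j
    using rho by (simp add: L_def exp_of_nat2_mult)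
  \<comment> \<open>Sets have up to n^\<beta> points. Sparsity needs n^(2 \<beta>) \<le> n, and n^(2
    \<beta>) times \<open>\<rho> ^ h\<close>, which is of order n^(- cc L / 2), must tend to
    0.\<close>
  define \<beta> where "\<beta> = min (1 / 2) (cc * L / 8)"
  \<comment> \<open>There are at most n^(2 \<gamma>) rounds, and the enlarged sets have size
    quadratic in that number times log n, about n^(4 \<gamma>); the factor 16 leaves ample
    room.\<close>
  define \<gamma> where "\<gamma> = \<beta> / 16"
  have \<beta>: "0 < \<beta>" "\<beta> \<le> 1 / 2" "2 * \<beta> \<le> cc * L / 4" using cc L by (auto simp: \<beta>_def)
  then have \<gamma>: "0 < \<gamma>" "\<beta> = 16 * \<gamma>" by (auto simp: \<gamma>_def)
  define a where "a = L * cc / 4"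
  have a: "0 < a" using L cc by (simp add: a_def)
  have F1: "\<forall>\<^sub>F n in sequentially. 3 \<le> cc * ln (real n)" using cc by real_asymp
  have F2: "\<forall>\<^sub>F n in sequentially. 5 * exp (3 * L / 2) * real n powr (- a) \<le> \<tau>" using a \<tau> by real_asymp
  have F3: "\<forall>\<^sub>F n in sequentially. 8 * real K ^ 2 * (real n powr (2 * \<gamma>))\<^sup>2 * (cc * ln (real n) + 1) \<le> real n powr (16 * \<gamma>)"
    using \<gamma>(1) cc by real_asymp
  have F4: "\<forall>\<^sub>F n in sequentially. exp (- L * (cc * ln (real n) - 1)) \<le> 1 / 2" using L cc by real_asymp
  have "\<forall>\<^sub>F n in sequentially. \<forall>k\<in>{2..n}. \<exists>(D :: nat pair_pre_digraph) (w :: nat \<times> nat \<Rightarrow> real).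
      weighted_digraph D w \<and> card (pverts D) = n \<and>
      max_ordering_opt k D w \<le> 1 / 2 * (1 - 1 / real k) + \<epsilon> \<and>
      ordering_sa_opt (sa_rounds \<gamma> n k) k D w \<ge> (1 - \<epsilon>) * (1 - 1 / real k)"
    using graph F1 F2 F3 F4 eventually_gt_at_top[of 0]
  proof eventually_elim
    case (elim n)
    define g where "g = nat \<lfloor>cc * ln (real n)\<rfloor>"
    obtain E where sq: "sparse_quasirandom (C * n) \<epsilon>' g n E"
      using elim(1) unfolding g_def by (rule exE)
    have E: "E \<subseteq> {..<n} \<times> {..<n}" and
      upper: "\<And>A B. A \<subseteq> {..<n} \<Longrightarrow> B \<subseteq> {..<n} \<Longrightarrow>
        card (E \<inter> A \<times> B) \<le> (real (card A) * real (card B) / (real n)\<^sup>2 + \<epsilon>') * real (C * n)" and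
      card_E: "(1 - \<epsilon>') * real (C * n) \<le> card E" and
      asym: "\<And>u v. (u, v) \<in> E \<Longrightarrow> u \<noteq> v \<and> (v, u) \<notin> E" and
      girth: "\<And>l y. l \<le> g \<Longrightarrow> (\<And>i. i < l \<Longrightarrow> adjacent E (y i) (y (Suc i))) \<Longrightarrow>
        (\<And>i. i + 2 \<le> l \<Longrightarrow> y i \<noteq> y (i + 2)) \<Longrightarrow> inj_on y {..l}" and
      sparse: "\<And>U. U \<subseteq> {..<n} \<Longrightarrow> U \<noteq> {} \<Longrightarrow> (card U)\<^sup>2 \<le> n \<Longrightarrow>
        6 * g * card (E \<inter> U \<times> U) < (6 * g + 1) * card U"
      using sq unfolding sparse_quasirandom_def by (elim conjE; simp)+
    define t where "t = nat \<lfloor>real n powr \<beta>\<rfloor>"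
    have n1: "1 \<le> real n" using elim by simp
    have t: "real t \<le> real n powr \<beta>" by (simp add: t_def)
    have tn: "t\<^sup>2 \<le> n"
    proof -
      have "real t ^ 2 \<le> (real n powr \<beta>) ^ 2" using t by (intro power_mono) auto
      also have "\<dots> = real n powr (2 * \<beta>)" using n1 by (simp add: powr_power mult.commute)
      also have "\<dots> \<le> real n powr 1" using \<beta> n1 by (intro powr_mono) auto
      finally have "real (t\<^sup>2) \<le> real n" using n1 by simp
      then show ?thesis by (simp only: of_nat_le_iff)
    qed
    have g: "cc * ln n - 1 \<le> real g" "real g \<le> cc * ln n" "3 \<le> g"
      using elim(2) unfolding g_def by linarith+
    \<comment> \<open>The largest \<open>h\<close> for which an ear with \<open>2 * h + 1\<close>
      edges stays within the girth bound.\<close>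
    define h where "h = (g - 1) div 2"
    have h: "0 < h" "2 * h + 1 \<le> g" using g(3) by (auto simp: h_def)
    have h_ge: "(cc * ln n - 3) / 2 \<le> real h"
    proof -
      have "g \<le> 2 * h + 2" by (auto simp: h_def)
      then have "real g \<le> real (2 * h + 2)" by (rule of_nat_mono)
      then show ?thesis using g(1) by simp
    qed
    interpret sparse_digraph E "{..<n}" g t
    proof
      show "6 * g * card (E \<inter> U \<times> U) < (6 * g + 1) * card U"
        if "U \<subseteq> {..<n}" "U \<noteq> {}" "card U \<le> t" for U
      proof (rule sparse[OF that(1,2)])
        have "(card U)\<^sup>2 \<le> t\<^sup>2" using that(3) by (rule power_mono) simp
        then show "(card U)\<^sup>2 \<le> n" using tn by (rule order_trans)
      qed
    qed (use E asym girth in auto)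
    interpret quasirandom_digraph E n "real (C * n)" \<epsilon>'
      by unfold_locales (use elim E C eps' upper card_E in auto)
    have E0: "E \<noteq> {}"
    proof
      assume "E = {}"
      then have "(1 - \<epsilon>') * real (C * n) \<le> 0" using card_E by simp
      moreover have "0 < (1 - \<epsilon>') * real (C * n)" using eps' C elim by simp
      ultimately show False by simp
    qed
    have \<tau>_bound: "5 * real t ^ 2 * \<rho> ^ h \<le> \<tau>"
    proof -
      have "5 * real t ^ 2 * \<rho> ^ h \<le> 5 * (real n powr \<beta>) ^ 2 * exp (- L * ((cc * ln n - 3) / 2))"
        unfolding rho_pow using t L h_ge by (intro mult_mono power_mono) auto
      also have "\<dots> = 5 * (exp (3 * L / 2) * (real n powr (2 * \<beta>) * real n powr (- (2 * a))))"
      proof -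
        have "exp (- L * ((cc * ln n - 3) / 2)) = exp (3 * L / 2) * exp (- (2 * a) * ln n)"
          unfolding exp_add[symmetric] by (simp add: a_def field_simps)
        also have "exp (- (2 * a) * ln n) = real n powr (- (2 * a))" using n1 by (simp add: powr_def)
        finally show ?thesis using n1 by (simp add: powr_power mult_ac)
      qed
      also have "real n powr (2 * \<beta>) * real n powr (- (2 * a)) = real n powr (2 * \<beta> - 2 * a)"
        by (simp add: powr_add[symmetric])
      also have "5 * (exp (3 * L / 2) * real n powr (2 * \<beta> - 2 * a)) \<le> 5 * (exp (3 * L / 2) * real n powr (- a))"
        using \<beta>(3) n1 by (intro mult_left_mono powr_mono) (auto simp: a_def mult.commute)
      also have "\<dots> \<le> \<tau>" using elim(3) by simp
      finally show ?thesis .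
    qed
    have half: "\<rho> ^ g \<le> 1 / 2"
    proof -
      have "\<rho> ^ g \<le> exp (- L * (cc * ln n - 1))" unfolding rho_pow using g(1) L by simp
      then show ?thesis using elim(5) by linarith
    qed
    show ?case
    proof
      fix k assume k: "k \<in> {2..n}"
      let ?D = "\<lparr>pverts = {..<n}, parcs = E\<rparr>" and ?r = "sa_rounds \<gamma> n k"
      define q where "q = min k K"
      have q: "0 < q" "q \<le> k" "q \<le> K" using k K by (auto simp: q_def)
      have r: "1 \<le> ?r" "real ?r \<le> real n powr (2 * \<gamma>)"
        using sa_rounds_bounds[OF \<gamma>(1), of k n] k by auto
      have N: "2 * ((?r + 1) * q)\<^sup>2 * (h + 1) \<le> t"
      proof -
        have "1 \<le> real n powr (2 * \<gamma>)" using n1 \<gamma> by (intro ge_one_powr_ge_zero) auto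
        then have "real (?r + 1) \<le> 2 * real n powr (2 * \<gamma>)" using r by simp
        then have "real ((?r + 1) * q) \<le> 2 * real n powr (2 * \<gamma>) * real K"
          unfolding of_nat_mult using q by (intro mult_mono) auto
        then have "(real ((?r + 1) * q))\<^sup>2 \<le> (2 * real n powr (2 * \<gamma>) * real K)\<^sup>2" by (intro power_mono) auto
        moreover have "real (h + 1) \<le> cc * ln n + 1" using h g(2) by simp
        ultimately have "2 * (real ((?r + 1) * q))\<^sup>2 * real (h + 1) \<le> 2 * (2 * real n powr (2 * \<gamma>) * real K)\<^sup>2 * (cc * ln n + 1)"
          by (intro mult_mono) auto
        also have "\<dots> = 8 * real K ^ 2 * (real n powr (2 * \<gamma>))\<^sup>2 * (cc * ln n + 1)"
          by (simp add: power_mult_distrib)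
        also have "\<dots> \<le> real n powr \<beta>" using elim(4) \<gamma>(2) by simp
        finally have "real (2 * ((?r + 1) * q)\<^sup>2 * (h + 1)) \<le> real n powr \<beta>"
          by (simp only: of_nat_mult of_nat_power of_nat_numeral)
        then show ?thesis unfolding t_def by (simp only: le_nat_floor)
      qed
      let ?b = "4 * real q ^ 2 * \<eta> + real q * (2 - 2 * (1 - \<kappa>)) / \<eta>\<^sup>2"
      have b: "?b \<le> e / 2"
      proof -
        have "4 * real q ^ 2 * \<eta> \<le> 4 * real K ^ 2 * \<eta>"
          using q \<eta> by (intro mult_right_mono mult_left_mono power_mono) auto
        also have "\<dots> = e / 4" using K by (simp add: \<eta>_def)
        finally have 1: "4 * real q ^ 2 * \<eta> \<le> e / 4" .
        have "real q * (2 - 2 * (1 - \<kappa>)) / \<eta>\<^sup>2 \<le> real K * (2 * (e * \<eta>\<^sup>2 / (8 * real K))) / \<eta>\<^sup>2"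
          using q \<kappa> by (intro divide_right_mono mult_mono) auto
        also have "\<dots> = e / 4" using K \<eta> by (simp add: field_simps)
        finally show ?thesis using 1 by linarith
      qed
      have sa: "(1 - \<epsilon>) * (1 - 1 / real k) \<le> ordering_sa_opt ?r k ?D (\<lambda>_. 1)"
      proof -
        have k1: "0 \<le> 1 - 1 / real k" "1 - 1 / real k \<le> 1" using k by auto
        have "(1 - \<epsilon>) * (1 - 1 / real k) \<le> (1 - e) * (1 - 1 / real k)"
          using e k1 by (intro mult_right_mono) auto
        also have "\<dots> \<le> (1 - 1 / real q) * (1 - e / 2)"
        proof (cases "k \<le> K")
          case True
          have "(1 - 1 / real k) * (1 - e) \<le> (1 - 1 / real k) * (1 - e / 2)"
            using e by (intro mult_left_mono k1(1)) simp
          then show ?thesis using True by (simp add: q_def mult.commute)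
        next
          case False
          have "(1 - e) * (1 - 1 / real k) \<le> (1 - e) * 1" using e k1 by (intro mult_left_mono) auto
          also have "\<dots> \<le> (1 - 1 / real K) * (1 - e / 2)"
          proof -
            have "0 \<le> (1 / real K) * (e / 2)" using e by simp
            then show ?thesis using invK by (simp add: algebra_simps)
          qed
          finally show ?thesis using False by (simp add: q_def)
        qed
        also have "\<dots> \<le> (1 - 1 / real q) * (1 - ?b)"
          using b q by (intro mult_left_mono) auto
        also have "\<dots> \<le> ordering_sa_opt ?r k ?D (\<lambda>_. 1)"
          by (rule sa_opt_ge[OF E0 r(1) q(1,2) \<eta> rho h \<tau>_bound N half c])
        finally show ?thesis .
      qed
      have opt: "max_ordering_opt k ?D (\<lambda>_. 1) \<le> 1 / 2 * (1 - 1 / real k) + e"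
      proof -
        define x where "x = 1 / real k"
        define d where "d = 1 / 2 - x / 2 + e"
        have k0: "0 < k" using k by auto
        have x: "0 \<le> x" "x \<le> 1" using k by (auto simp: x_def)
        have half_x: "(1 - 1 / real k) / 2 = 1 / 2 - x / 2" by (simp add: x_def diff_divide_distrib)
        then have d_eq: "1 / 2 * (1 - 1 / real k) + e = d" by (simp add: d_def)
        have d0: "0 \<le> d" unfolding d_def using x e by linarith
        \<comment> \<open>As the target is at most 1, the relative loss of arcs turns into the
          additive loss \<open>\<epsilon>'\<close>.\<close>
        have "d \<le> 1" unfolding d_def using x e by linarith
        then have "d * \<epsilon>' \<le> 1 * \<epsilon>'" using eps' by (intro mult_right_mono) auto
        then have loss: "d - \<epsilon>' \<le> d * (1 - \<epsilon>')" by (simp add: right_diff_distrib)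
        show ?thesis
          unfolding d_eq
        proof (cases "k \<le> K")
          case True
          show "max_ordering_opt k ?D (\<lambda>_. 1) \<le> d"
          proof (rule max_ordering_opt_le[OF k0 few_labels _ d0])
            have "1 / 2 - x / 2 + real K ^ 2 * \<epsilon>' \<le> d - \<epsilon>'"
              unfolding d_def using Keps e by linarith
            then show "(1 - 1 / real k) / 2 + real K ^ 2 * \<epsilon>' \<le> d * (1 - \<epsilon>')"
              unfolding half_x using loss by linarith
          qed (use k0 True in auto)
        next
          case False
          define y where "y = 1 / real K"
          define z where "z = 1 / real n"
          \<comment> \<open>The bound for many labels lacks the gain \<open>x / 2\<close> of the
            target, but for \<open>k > K\<close> this is at most \<open>e / 4\<close>. The terms
            \<open>y / 2\<close> and \<open>z / 2\<close> and the error of quasirandomness with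
            deletion cost at most \<open>e / 4\<close> each, so the slack \<open>e\<close> is
            exactly enough.\<close>
          have "x \<le> y" "z \<le> y"
            using False k K by (auto simp: x_def y_def z_def intro!: divide_left_mono)
          then have inv: "x \<le> e / 2" "y \<le> e / 2" "z \<le> e / 2" using invK by (auto simp: y_def)
          show "max_ordering_opt k ?D (\<lambda>_. 1) \<le> d"
          proof (rule max_ordering_opt_le[OF k0 many_labels[OF K(1)] _ d0])
            have "(1 + y + z) / 2 + real K ^ 2 * \<epsilon>' \<le> d - \<epsilon>'"
              unfolding d_def using Keps inv e by (simp add: add_divide_distrib)
            then show "(1 + 1 / real K + 1 / real n) / 2 + real K ^ 2 * \<epsilon>' \<le> d * (1 - \<epsilon>')"
              unfolding y_def z_def using loss by linarith
          qed
        qed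
      qed
      have "pair_digraph ?D"
        using E asym finite_subset[OF E] by unfold_locales auto
      then have "weighted_digraph ?D (\<lambda>_. 1)" using E0 by (simp add: weighted_digraph_def)
      then show "\<exists>(D :: nat pair_pre_digraph) (w :: nat \<times> nat \<Rightarrow> real).
          weighted_digraph D w \<and> card (pverts D) = n \<and>
          max_ordering_opt k D w \<le> 1 / 2 * (1 - 1 / real k) + \<epsilon> \<and>
          ordering_sa_opt ?r k D w \<ge> (1 - \<epsilon>) * (1 - 1 / real k)"
        using sa opt e by (intro exI[of _ ?D] exI[of _ "\<lambda>_. 1"]) auto
    qed
  qed
  then show ?thesis using \<gamma>(1) unfolding eventually_sequentially by blast
qed

end
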